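(* Let $\lambda$ be a partition of $N$ with $\ell$ parts. Among elements of $M_\lambda$ that are symmetric (invariant under all $s_i\otimes s_i$), those homogeneous of the minimal degree at which nonzero such elements exist form a one-dimensional space spanned by $J_{T_1}$; among elements that are antisymmetric ($P(s_i\otimes s_i)=-P$ for all $i$), those homogeneous of the minimal degree at which nonzero such elements exist form a one-dimensional space spanned by $J'_{T_{\det}}$.
   Context: Partitions in French convention (rows numbered $1,\dots,\ell$ from bottom to top, columns from the left). $T_1$ is the filling of shape $\lambda$ in which every box of row $r$ contains $r-1$; $T_{\det}$ is the filling in which every box of column $c$ contains $c-1$. An RST of shape $\lambda$ is a bijective filling with $1,\dots,N$ strictly decreasing along rows (left to right) and columns (bottom to top); $\mathrm{CT}_\tau[i]=c-r$ if $i$ is in column $c$, row $r$; $\tau_\lambda$ fills the columns left to right, each bottom to top, with $N,\dots,1$. For $v\in\mathbb{N}^N$: $v^+$ decreasing rearrangement; $\sigma_v$ labels positions by $1,\dots,N$ in order of decreasing entries, ties left to right; $vs_i$ swaps entries $i,i+1$; $v\Psi=[v[2],\dots,v[N],v[1]+1]$. $\alpha$ indeterminate; $\zeta_{v,\tau}[i]=\alpha v[i]+\mathrm{CT}_\tau[\sigma_v[i]]$. Graph $G_\lambda$: vertices are pairs $(\tau,v)$ reachable from $(\tau_\lambda,0^N)$ plus $\varnothing$; from $(\tau,v)$: edge $\Psi$ to $(\tau,v\Psi)$; edge $s_i$ to $(\tau,vs_i)$ if $v[i]<v[i+1]$; if $v[i]=v[i+1]$ and $\mathrm{CT}_\tau[\sigma_v[i]]-\mathrm{CT}_\tau[\sigma_v[i]+1]\ge2$,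 edge $s_i$ to $(\tau',v)$, $\tau'$ obtained by interchanging $\sigma_v[i],\sigma_v[i]+1$; if $v[i]=v[i+1]$ and this interchange is not an RST, edge $s_i$ to $\varnothing$. $H_\lambda$: remove the $\Psi$-edges, $\varnothing$ and edges into it. For a filling $T$, $H_T$ is the connected component of $H_\lambda$ formed by the vertices $(\tau,v)$ such that replacing each entry $i$ of $\tau$ by $v^+[i]$ gives $T$. $\mathcal{E}$: equal to $1$ at the vertex of $H_T$ without incoming edge, and for an edge $s_i$ of $H_T$ from $(\tau',v')$ to $(\tau,v)$, $\mathcal{E}_{v,\tau}=\frac{\zeta'[i]-\zeta'[i+1]}{\zeta'[i]-\zeta'[i+1]+1}\mathcal{E}_{v',\tau'}$ with $\zeta'=\zeta_{v',\tau'}$; $\mathcal{F}$: equal to $1$ at that vertex, and $\mathcal{F}_{v,\tau}=-\frac{\zeta[i]-\zeta[i+1]}{\zeta[i]-\zeta[i+1]+1}\mathcal{F}_{v',\tau'}$ with $\zeta=\zeta_{v,\tau}$ (both consistently defined). $J_T=\sum_{(\tau,v)\in H_T}\mathcal{E}_{v,\tau}J_{v,\tau}$, $J'_T=\sum_{(\tau,v)\in H_T}\mathcal{F}_{v,\tau}J_{v,\tau}$. $V_\lambda$: $\mathbb{Q}(\alpha)$-space with basis the RSTs of shape $\lambda$, right action: with $b=1/(\mathrm{CT}_\tau[i]-\mathrm{CT}_\tau[i+1])$, $\tau s_i=b\tau$ if $b=\pm1$; $b\tau+\tau^{(i,i+1)}$ if $0<b\le\frac12$; $b\tau+(1-b^2)\tau^{(i,i+1)}$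 otherwise. $M_\lambda=\mathbb{Q}(\alpha)[x_1,\dots,x_N]\otimes V_\lambda$ graded by degree in $x$, operators on the right, $(f\otimes t)(\omega\otimes\omega)=(f\omega)\otimes(t\omega)$; $P\Psi=x_N\cdot(P(\theta\otimes\theta))$, $\theta=s_1\cdots s_{N-1}$. $J_{v,\tau}$: $J_{0^N,\tau_\lambda}=1\otimes\tau_\lambda$, and along edges from $(\tau,v)$: $s_i$-edge to $w$: $J_w=J_{v,\tau}\big(s_i\otimes s_i+\frac1{\zeta_{v,\tau}[i+1]-\zeta_{v,\tau}[i]}\big)$; $\Psi$-edge: $J_{v\Psi,\tau}=J_{v,\tau}\Psi$ (path-independent). *)

theory Defs
  imports
    "HOL-Library.Poly_Mapping"
    "HOL-Computational_Algebra.Polynomial"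
    "HOL-Computational_Algebra.Fraction_Field"
    "HOL-Combinatorics.Transposition"
begin

definition is_partition :: "nat \<Rightarrow> nat list \<Rightarrow> bool" where
  "is_partition N lam \<longleftrightarrow> sorted_wrt (\<ge>) lam \<and> 0 \<notin> set lam \<and> sum_list lam = N"

text \<open>A box is a pair (column, row); rows and columns are numbered from 1, and row 1 is the bottom
  row, of length \<^term>\<open>lam ! 0\<close>.\<close>

definition boxes :: "nat list \<Rightarrow> (nat \<times> nat) set" where
  "boxes lam = {(c, r). 1 \<le> r \<and> r \<le> length lam \<and> 1 \<le> c \<and> c \<le> lam ! (r - 1)}"

text \<open>All fillings of shape \<^term>\<open>lam\<close> are normalised to be 0 outside the diagram, so that two
  fillings are equal as functions iff they agree on the diagram.\<close>

type_synonym filling = "nat \<times> nat \<Rightarrow> nat"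

definition T_one :: "nat list \<Rightarrow> filling" where
  "T_one lam = (\<lambda>(c, r). if (c, r) \<in> boxes lam then r - 1 else 0)"

definition T_det :: "nat list \<Rightarrow> filling" where
  "T_det lam = (\<lambda>(c, r). if (c, r) \<in> boxes lam then c - 1 else 0)"

definition RST :: "nat list \<Rightarrow> filling set" where
  "RST lam = {\<tau>.
     bij_betw \<tau> (boxes lam) {1..sum_list lam} \<and>
     (\<forall>b. b \<notin> boxes lam \<longrightarrow> \<tau> b = 0) \<and>
     (\<forall>c c' r. (c, r) \<in> boxes lam \<and> (c', r) \<in> boxes lam \<and> c < c' \<longrightarrow> \<tau> (c', r) < \<tau> (c, r)) \<and>
     (\<forall>c r r'. (c, r) \<in> boxes lam \<and> (c, r') \<in> boxes lam \<and> r < r' \<longrightarrow> \<tau> (c, r') < \<tau> (c, r))}"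

definition CT :: "nat list \<Rightarrow> filling \<Rightarrow> nat \<Rightarrow> int" where
  "CT lam \<tau> i = (case the_inv_into (boxes lam) \<tau> i of (c, r) \<Rightarrow> int c - int r)"

definition root_tab :: "nat list \<Rightarrow> filling" where
  "root_tab lam = (\<lambda>(c, r). if (c, r) \<in> boxes lam
     then sum_list lam - card {(c', r') \<in> boxes lam. c' < c \<or> (c' = c \<and> r' < r)} else 0)"

definition interchange :: "nat \<Rightarrow> filling \<Rightarrow> filling" where
  "interchange i \<tau> = transpose i (i + 1) \<circ> \<tau>"

text \<open>Vectors in \<open>\<nat>\<^sup>N\<close> are lists of length \<open>N\<close>, with entries numbered from 1.\<close>

abbreviation entry :: "'a list \<Rightarrow> nat \<Rightarrow> 'a" where
  "entry v i \<equiv> v ! (i - 1)"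

definition swap_entries :: "nat list \<Rightarrow> nat \<Rightarrow> nat list" where
  "swap_entries v i = v[i - 1 := entry v (i + 1), i := entry v i]"

definition vplus :: "nat list \<Rightarrow> nat list" where
  "vplus v = rev (sort v)"

definition sigma :: "nat list \<Rightarrow> nat \<Rightarrow> nat" where
  "sigma v i = card {j \<in> {1..length v}. entry v j > entry v i \<or> (entry v j = entry v i \<and> j \<le> i)}"

type_synonym scalar = "rat poly fract"

definition alpha :: scalar where
  "alpha = Fract [:0, 1:] 1"

definition scalar_of_rat :: "rat \<Rightarrow> scalar" where
  "scalar_of_rat q = Fract [:q:] 1"

definition zeta :: "nat list \<Rightarrow> filling \<times> nat list \<Rightarrow> nat \<Rightarrow> scalar" where
  "zeta lam x i = (case x of (\<tau>, v) \<Rightarrow>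
     alpha * of_nat (entry v i) + of_int (CT lam \<tau> (sigma v i)))"

type_synonym vertex = "filling \<times> nat list"

datatype label = Aff | Refl nat

text \<open>\<^const>\<open>Aff\<close> labels the \<open>\<Psi>\<close>-edges and \<^term>\<open>Refl i\<close> the \<open>s\<^sub>i\<close>-edges. The vertex \<open>\<emptyset>\<close>
  is \<^const>\<open>None\<close>.\<close>

inductive G_edge :: "nat list \<Rightarrow> label \<Rightarrow> vertex \<Rightarrow> vertex option \<Rightarrow> bool" for lam where
  Psi: "G_edge lam Aff (\<tau>, a # u) (Some (\<tau>, u @ [a + 1]))"
| swap: "1 \<le> i \<Longrightarrow> i < sum_list lam \<Longrightarrow> entry v i < entry v (i + 1) \<Longrightarrow>
    G_edge lam (Refl i) (\<tau>, v) (Some (\<tau>, swap_entries v i))"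
| tab: "1 \<le> i \<Longrightarrow> i < sum_list lam \<Longrightarrow> entry v i = entry v (i + 1) \<Longrightarrow>
    CT lam \<tau> (sigma v i) - CT lam \<tau> (sigma v i + 1) \<ge> 2 \<Longrightarrow>
    G_edge lam (Refl i) (\<tau>, v) (Some (interchange (sigma v i) \<tau>, v))"
| fall: "1 \<le> i \<Longrightarrow> i < sum_list lam \<Longrightarrow> entry v i = entry v (i + 1) \<Longrightarrow>
    interchange (sigma v i) \<tau> \<notin> RST lam \<Longrightarrow>
    G_edge lam (Refl i) (\<tau>, v) None"

definition G_root :: "nat list \<Rightarrow> vertex" where
  "G_root lam = (root_tab lam, replicate (sum_list lam) 0)"

inductive_set G_verts :: "nat list \<Rightarrow> vertex option set" for lam where
  root: "Some (G_root lam) \<in> G_verts lam"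
| empty: "None \<in> G_verts lam"
| step: "Some x \<in> G_verts lam \<Longrightarrow> G_edge lam e x y \<Longrightarrow> y \<in> G_verts lam"

definition H_verts :: "nat list \<Rightarrow> vertex set" where
  "H_verts lam = {x. Some x \<in> G_verts lam}"

definition fill :: "nat list \<Rightarrow> vertex \<Rightarrow> filling" where
  "fill lam x = (case x of (\<tau>, v) \<Rightarrow>
     (\<lambda>b. if b \<in> boxes lam then entry (vplus v) (\<tau> b) else 0))"

definition HT_verts :: "nat list \<Rightarrow> filling \<Rightarrow> vertex set" where
  "HT_verts lam T = {x \<in> H_verts lam. fill lam x = T}"

definition HT_edge :: "nat list \<Rightarrow> filling \<Rightarrow> nat \<Rightarrow> vertex \<Rightarrow> vertex \<Rightarrow> bool" where
  "HT_edge lam T i x y \<longleftrightarrow>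
     x \<in> HT_verts lam T \<and> y \<in> HT_verts lam T \<and> G_edge lam (Refl i) x (Some y)"

text \<open>Quantities defined by recursion along the edges of a graph are introduced as the relation
  that collects the values along all paths; the function is its unique value.\<close>

inductive E_rel :: "nat list \<Rightarrow> filling \<Rightarrow> vertex \<Rightarrow> scalar \<Rightarrow> bool" for lam T where
  root: "x \<in> HT_verts lam T \<Longrightarrow> (\<And>i y. \<not> HT_edge lam T i y x) \<Longrightarrow> E_rel lam T x 1"
| step: "E_rel lam T x e \<Longrightarrow> HT_edge lam T i x y \<Longrightarrow>
    E_rel lam T y
      ((zeta lam x i - zeta lam x (i + 1)) / (zeta lam x i - zeta lam x (i + 1) + 1) * e)"

definition E_coeff :: "nat list \<Rightarrow> filling \<Rightarrow> vertex \<Rightarrow> scalar" where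
  "E_coeff lam T x = (THE e. E_rel lam T x e)"

inductive F_rel :: "nat list \<Rightarrow> filling \<Rightarrow> vertex \<Rightarrow> scalar \<Rightarrow> bool" for lam T where
  root: "x \<in> HT_verts lam T \<Longrightarrow> (\<And>i y. \<not> HT_edge lam T i y x) \<Longrightarrow> F_rel lam T x 1"
| step: "F_rel lam T x f \<Longrightarrow> HT_edge lam T i x y \<Longrightarrow>
    F_rel lam T y
      (- ((zeta lam y i - zeta lam y (i + 1)) / (zeta lam y i - zeta lam y (i + 1) + 1)) * f)"

definition F_coeff :: "nat list \<Rightarrow> filling \<Rightarrow> vertex \<Rightarrow> scalar" where
  "F_coeff lam T x = (THE f. F_rel lam T x f)"

text \<open>Polynomials over \<open>\<rat>(\<alpha>)\<close> are finitely supported functions on exponent vectors.\<close>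

type_synonym mpol = "(nat \<Rightarrow>\<^sub>0 nat) \<Rightarrow>\<^sub>0 scalar"

definition var :: "nat \<Rightarrow> mpol" where
  "var j = Poly_Mapping.single (Poly_Mapping.single j 1) 1"

definition pol_refl :: "nat \<Rightarrow> mpol \<Rightarrow> mpol" where
  "pol_refl i f = Poly_Mapping.map_key (Poly_Mapping.map_key (transpose i (i + 1))) f"

text \<open>Elements of \<open>V\<close> are finitely supported functions on tableaux; this is the action of \<open>s\<^sub>i\<close> on a
  basis element.\<close>

definition tab_refl :: "nat list \<Rightarrow> nat \<Rightarrow> filling \<Rightarrow> (filling \<Rightarrow>\<^sub>0 scalar)" where
  "tab_refl lam i \<tau> = (let b = 1 / of_int (CT lam \<tau> i - CT lam \<tau> (i + 1)) :: rat in
     if b = 1 \<or> b = - 1 then Poly_Mapping.single \<tau> (scalar_of_rat b)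
     else if 0 < b \<and> b \<le> 1 / 2
       then Poly_Mapping.single \<tau> (scalar_of_rat b) + Poly_Mapping.single (interchange i \<tau>) 1
     else Poly_Mapping.single \<tau> (scalar_of_rat b) + Poly_Mapping.single (interchange i \<tau>) (scalar_of_rat (1 - b\<^sup>2)))"

text \<open>\<open>\<rat>(\<alpha>)[x] \<otimes> V\<close> is the free \<open>\<rat>(\<alpha>)[x]\<close>-module on the tableaux: an element assigns to each
  tableau its polynomial coefficient.\<close>

type_synonym melem = "filling \<Rightarrow>\<^sub>0 mpol"

definition tensor :: "mpol \<Rightarrow> (filling \<Rightarrow>\<^sub>0 scalar) \<Rightarrow> melem" where
  "tensor f t = Poly_Mapping.map (\<lambda>c. Poly_Mapping.single 0 c * f) t"

definition pol_times :: "mpol \<Rightarrow> melem \<Rightarrow> melem" where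
  "pol_times f P = Poly_Mapping.map (\<lambda>p. f * p) P"

definition mscale :: "scalar \<Rightarrow> melem \<Rightarrow> melem" where
  "mscale c P = pol_times (Poly_Mapping.single 0 c) P"

definition M :: "nat list \<Rightarrow> melem set" where
  "M lam = {P. Poly_Mapping.keys P \<subseteq> RST lam \<and>
     (\<forall>\<tau>. \<forall>m \<in> Poly_Mapping.keys (Poly_Mapping.lookup P \<tau>). Poly_Mapping.keys m \<subseteq> {1..sum_list lam})}"

definition homogeneous :: "nat \<Rightarrow> melem \<Rightarrow> bool" where
  "homogeneous d P \<longleftrightarrow> (\<forall>\<tau>. \<forall>m \<in> Poly_Mapping.keys (Poly_Mapping.lookup P \<tau>).
     (\<Sum>j \<in> Poly_Mapping.keys m. Poly_Mapping.lookup m j) = d)"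

text \<open>The operator \<open>s\<^sub>i \<otimes> s\<^sub>i\<close>.\<close>

definition m_refl :: "nat list \<Rightarrow> nat \<Rightarrow> melem \<Rightarrow> melem" where
  "m_refl lam i P = (\<Sum>\<tau> \<in> Poly_Mapping.keys P.
     tensor (pol_refl i (Poly_Mapping.lookup P \<tau>)) (tab_refl lam i \<tau>))"

text \<open>Operators act on the right, so \<open>\<theta> = s\<^sub>1 \<cdots> s\<^sub>N\<^sub>-\<^sub>1\<close> applies \<open>s\<^sub>1\<close> first.\<close>

definition m_Psi :: "nat list \<Rightarrow> melem \<Rightarrow> melem" where
  "m_Psi lam P = pol_times (var (sum_list lam)) (fold (m_refl lam) [1..<sum_list lam] P)"

inductive J_rel :: "nat list \<Rightarrow> vertex \<Rightarrow> melem \<Rightarrow> bool" for lam where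
  root: "J_rel lam (G_root lam) (tensor 1 (Poly_Mapping.single (root_tab lam) 1))"
| refl: "J_rel lam x P \<Longrightarrow> G_edge lam (Refl i) x (Some y) \<Longrightarrow>
    J_rel lam y (m_refl lam i P + mscale (1 / (zeta lam x (i + 1) - zeta lam x i)) P)"
| Psi: "J_rel lam x P \<Longrightarrow> G_edge lam Aff x (Some y) \<Longrightarrow> J_rel lam y (m_Psi lam P)"

definition J :: "nat list \<Rightarrow> vertex \<Rightarrow> melem" where
  "J lam x = (THE P. J_rel lam x P)"

definition J_sym :: "nat list \<Rightarrow> filling \<Rightarrow> melem" where
  "J_sym lam T = (\<Sum>x \<in> HT_verts lam T. mscale (E_coeff lam T x) (J lam x))"

definition J_asym :: "nat list \<Rightarrow> filling \<Rightarrow> melem" where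
  "J_asym lam T = (\<Sum>x \<in> HT_verts lam T. mscale (F_coeff lam T x) (J lam x))"

definition symmetric :: "nat list \<Rightarrow> melem set" where
  "symmetric lam = {P \<in> M lam. \<forall>i \<in> {1..<sum_list lam}. m_refl lam i P = P}"

definition antisymmetric :: "nat list \<Rightarrow> melem set" where
  "antisymmetric lam = {P \<in> M lam. \<forall>i \<in> {1..<sum_list lam}. m_refl lam i P = - P}"

definition min_degree :: "melem set \<Rightarrow> nat" where
  "min_degree S = (LEAST d. \<exists>P \<in> S. P \<noteq> 0 \<and> homogeneous d P)"

definition min_degree_part :: "melem set \<Rightarrow> melem set" where
  "min_degree_part S = {P \<in> S. homogeneous (min_degree S) P}"

lemma lookup_pol_times [simp]:
  "Poly_Mapping.lookup (pol_times f P) \<tau> = f * Poly_Mapping.lookup P \<tau>"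
  by (simp add: pol_times_def Poly_Mapping.map.rep_eq when_def)

interpretation mvs: vector_space mscale
proof
  fix a b :: scalar and x y :: melem
  show "mscale a (x + y) = mscale a x + mscale a y"
    by (rule poly_mapping_eqI) (simp add: mscale_def lookup_add distrib_left)
  show "mscale (a + b) x = mscale a x + mscale b x"
    by (rule poly_mapping_eqI) (simp add: mscale_def lookup_add single_add distrib_right)
  show "mscale a (mscale b x) = mscale (a * b) x"
    by (rule poly_mapping_eqI)
      (simp add: mscale_def mult.assoc [symmetric] mult_single)
  show "mscale 1 x = x"
    by (rule poly_mapping_eqI) (simp add: mscale_def)
qed

end

theory Submission
  imports Defs
begin

text \<open>Path independence of \<open>J\<close> comes from the braid relations: the operators \<open>s\<^sub>i \<otimes> s\<^sub>i + 1 / (\<zeta>[i+1] - \<zeta>[i])\<close>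
  satisfy the Yang-Baxter equation, so a recursive choice of path already obeys the recursion along
  every edge; moreover, if \<open>v[i] = v[i+1]\<close>, then \<open>s\<^sub>i \<otimes> s\<^sub>i\<close> acts on the \<open>J\<^sub>v\<^sub>,\<^sub>\<tau>\<close> with fixed \<open>v\<close> as \<open>s\<^sub>k\<close>, \<open>k = \<sigma>\<^sub>v[i]\<close>,
  acts on the tableaux.

  The components of \<open>T\<^sub>1\<close> and \<open>T\<^sub>d\<^sub>e\<^sub>t\<close> contain only one tableau, and on the two-dimensional blocks
  spanned by \<open>J\<^sub>v\<close> and \<open>J\<^sub>v\<^sub>s\<^sub>i\<close> the coefficients \<open>\<E>\<close>, \<open>\<F>\<close> pick out the eigenvectors of \<open>s\<^sub>i \<otimes> s\<^sub>i\<close> for \<open>1\<close>, \<open>-1\<close>.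
  The sums do not vanish because \<open>J\<^sub>v\<^sub>,\<^sub>\<tau>\<close> degenerates to \<open>x\<^sup>v\<close> times a nonzero vector as \<open>\<alpha> \<rightarrow> \<infinity>\<close>.

  Conversely, a symmetric element is determined by its coefficients at dominant monomials \<open>x\<^sup>m\<close>, which are
  invariant under the stabiliser of \<open>m\<close>. A tableau in the support of such a coefficient for which
  \<open>\<Sum>k. k * CT[k]\<close> is minimal has contents that decrease strictly along runs of equal exponents,
  so the filling by the exponents increases strictly up the columns; this forces degree at least that of \<open>T\<^sub>1\<close>, with equality
  for a single tableau. The antisymmetric case exchanges rows and columns.\<close>

text \<open>The braid relation on tableaux and the Yang-Baxter equation both rest on the identity
  \<open>1/a * 1/c = 1/(a + c) * (1/a + 1/c)\<close>, for differences of contents in the first case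
  and of spectral entries in the second. At a tie the same identity lets a step with parameter
  \<open>-1/d\<close> pass through the other steps. Both halves of the theorem are one argument with
  a sign \<open>\<epsilon>\<close>. Consecutive labels in boxes with equal values of
  \<open>T\<close> always have content difference \<open>\<epsilon>\<close>, so at a tie the
  reflection acts by the scalar \<open>\<epsilon>\<close>, and both systems of coefficients become
  one product over inversions. The dimension is found with a single linear functional: the
  coefficient of the dominant monomial of the component at \<open>\<tau>\<^sub>0\<close> is nonzero
  on every nonzero solution of minimal degree, so any such solution is the known one up to a
  factor.\<close>

abbreviation "lookup \<equiv> Poly_Mapping.lookup"
abbreviation "keys \<equiv> Poly_Mapping.keys"
abbreviation "single \<equiv> Poly_Mapping.single"

section \<open>The field of scalars\<close>

lemma fract_of_int: "of_int z = Fract (of_int z) (1 :: 'a :: idom)"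
  by (cases z) (simp_all add: of_nat_fract One_fract_def)

lemma scalar_of_rat_of_int: "scalar_of_rat (of_int z) = of_int z"
  unfolding scalar_of_rat_def fract_of_int
  by (simp add: of_int_poly)

lemma scalar_of_rat_diff: "scalar_of_rat (p - q) = scalar_of_rat p - scalar_of_rat q"
  by (simp add: scalar_of_rat_def)

lemma scalar_of_rat_mult: "scalar_of_rat (p * q) = scalar_of_rat p * scalar_of_rat q"
  by (simp add: scalar_of_rat_def mult.commute)

lemma scalar_of_rat_1 [simp]: "scalar_of_rat 1 = 1"
  using scalar_of_rat_of_int[of 1] by simp

text \<open>Both fields set \<open>1/0 = 0\<close>, so the formula includes \<open>z = 0\<close> and
  later identities carry no side condition.\<close>

lemma scalar_of_rat_inverse_int: "scalar_of_rat (1 / of_int z) = 1 / of_int z"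
proof (cases "z = 0")
  case True
  then show ?thesis using scalar_of_rat_of_int[of 0] by simp
next
  case False
  have "scalar_of_rat (1 / of_int z) * of_int z = scalar_of_rat (1 / of_int z * of_int z)"
    by (simp only: scalar_of_rat_mult scalar_of_rat_of_int)
  also have "\<dots> = 1" using False by simp
  finally show ?thesis using False by (simp add: field_simps)
qed

text \<open>Polynomials are compared by the sign of the leading coefficient of their difference, and
  \<open>alpha - n\<close> has leading coefficient 1.\<close>

lemma alpha_gt_of_nat: "of_nat n < alpha"
  unfolding alpha_def of_nat_fract
  by (simp add: of_nat_poly less_poly_def pos_poly_def)

text \<open>The order on \<open>\<rat>(\<alpha>)\<close> makes \<open>\<alpha>\<close> infinitely large; finite and infinitesimal elements
  play the role of the specialisation \<open>\<alpha> \<rightarrow> \<infinity>\<close>.\<close>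

definition finite_scalar :: "scalar \<Rightarrow> bool" where
  "finite_scalar x \<longleftrightarrow> (\<exists>n::nat. \<bar>x\<bar> \<le> of_nat n)"

definition infinitesimal :: "scalar \<Rightarrow> bool" where
  "infinitesimal x \<longleftrightarrow> (\<forall>n::nat. of_nat n * \<bar>x\<bar> < 1)"

lemma finite_scalar_add: "finite_scalar x \<Longrightarrow> finite_scalar y \<Longrightarrow> finite_scalar (x + y)"
  unfolding finite_scalar_def
proof (elim exE)
  fix m n :: nat assume "\<bar>x\<bar> \<le> of_nat m" "\<bar>y\<bar> \<le> of_nat n"
  then have "\<bar>x + y\<bar> \<le> of_nat (m + n)" using abs_triangle_ineq[of x y] by simp
  then show "\<exists>n. \<bar>x + y\<bar> \<le> of_nat n" by blast
qed

lemma finite_scalar_mult: "finite_scalar x \<Longrightarrow> finite_scalar y \<Longrightarrow> finite_scalar (x * y)"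
  unfolding finite_scalar_def
proof (elim exE)
  fix m n :: nat assume "\<bar>x\<bar> \<le> of_nat m" "\<bar>y\<bar> \<le> of_nat n"
  then have "\<bar>x\<bar> * \<bar>y\<bar> \<le> of_nat m * of_nat n" by (intro mult_mono) simp_all
  then have "\<bar>x * y\<bar> \<le> of_nat (m * n)" by (simp add: abs_mult)
  then show "\<exists>n. \<bar>x * y\<bar> \<le> of_nat n" by blast
qed

lemma finite_scalar_of_int [simp]: "finite_scalar (of_int z)"
  unfolding finite_scalar_def
  by (rule exI[of _ "nat \<bar>z\<bar>"]) simp

lemma finite_scalar_0 [simp]: "finite_scalar 0" and finite_scalar_1 [simp]: "finite_scalar 1"
  using finite_scalar_of_int[of 0] finite_scalar_of_int[of 1] by simp_all

lemma finite_scalar_inverse_int [simp]: "finite_scalar (1 / of_int z)"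
proof (cases "z = 0")
  case False
  then have "1 \<le> \<bar>z\<bar>" by simp
  then have "1 \<le> \<bar>of_int z :: scalar\<bar>" by (simp only: of_int_abs[symmetric] of_int_1_le_iff)
  then show ?thesis
    unfolding finite_scalar_def by (intro exI[of _ 1]) (simp add: abs_divide divide_le_eq)
qed simp

lemma finite_scalar_minus: "finite_scalar x \<Longrightarrow> finite_scalar (- x)"
  by (simp add: finite_scalar_def)

lemma finite_scalar_diff: "finite_scalar x \<Longrightarrow> finite_scalar y \<Longrightarrow> finite_scalar (x - y)"
  using finite_scalar_add[OF _ finite_scalar_minus, of x y] by simp

lemma infinitesimal_0 [simp]: "infinitesimal 0"
  by (simp add: infinitesimal_def)

lemma not_infinitesimal_1 [simp]: "\<not> infinitesimal 1"
  unfolding infinitesimal_def by (auto intro!: exI[of _ 1])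

lemma infinitesimal_add:
  assumes "infinitesimal x" "infinitesimal y"
  shows "infinitesimal (x + y)"
  unfolding infinitesimal_def
proof
  fix n :: nat
  \<comment> \<open>The factor 2 leaves less than one half for each summand.\<close>
  have "of_nat (2 * n) * \<bar>x\<bar> < 1" "of_nat (2 * n) * \<bar>y\<bar> < 1"
    using assms unfolding infinitesimal_def by blast+
  then have "of_nat n * \<bar>x\<bar> + of_nat n * \<bar>y\<bar> < 1" by simp
  moreover have "of_nat n * \<bar>x + y\<bar> \<le> of_nat n * \<bar>x\<bar> + of_nat n * \<bar>y\<bar>"
    unfolding distrib_left[symmetric] by (intro mult_left_mono abs_triangle_ineq) simp
  ultimately show "of_nat n * \<bar>x + y\<bar> < 1" by simp
qed

lemma infinitesimal_mult:
  assumes "finite_scalar x" "infinitesimal y"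
  shows "infinitesimal (x * y)" "infinitesimal (y * x)"
proof -
  obtain k :: nat where k: "\<bar>x\<bar> \<le> of_nat k" using assms unfolding finite_scalar_def by blast
  show "infinitesimal (x * y)" unfolding infinitesimal_def
  proof
    fix n :: nat
    have "of_nat n * \<bar>x * y\<bar> = of_nat n * (\<bar>x\<bar> * \<bar>y\<bar>)" by (simp add: abs_mult)
    also have "\<dots> \<le> of_nat n * (of_nat k * \<bar>y\<bar>)"
      by (intro mult_left_mono mult_right_mono k) simp_all
    also have "\<dots> = of_nat (n * k) * \<bar>y\<bar>" by simp
    also have "\<dots> < 1" using assms unfolding infinitesimal_def by blast
    finally show "of_nat n * \<bar>x * y\<bar> < 1" .
  qed
  then show "infinitesimal (y * x)" by (simp add: mult.commute)
qed

lemma infinitesimal_minus: "infinitesimal x \<Longrightarrow> infinitesimal (- x)"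
  by (simp add: infinitesimal_def)

lemma infinitesimal_sum: "(\<And>a. a \<in> A \<Longrightarrow> infinitesimal (f a)) \<Longrightarrow> infinitesimal (sum f A)"
  by (induction A rule: infinite_finite_induct) (auto intro: infinitesimal_add)

lemma finite_scalar_prod: "(\<And>a. a \<in> A \<Longrightarrow> finite_scalar (f a)) \<Longrightarrow> finite_scalar (prod f A)"
  by (induction A rule: infinite_finite_induct) (auto intro: finite_scalar_mult)

lemma infinitesimal_imp_finite: "infinitesimal x \<Longrightarrow> finite_scalar x"
  unfolding infinitesimal_def finite_scalar_def
  by (rule exI[of _ 1]) (drule spec[of _ 1], simp)

text \<open>As \<open>alpha\<close> exceeds \<open>n + |c|\<close>, the shift by \<open>c\<close>
  cannot bring a nonzero integer multiple of it within \<open>n\<close> of zero. This controls the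
  denominators formed from spectral entries at positions with different values.\<close>

lemma alpha_multiple_large:
  fixes k c :: int
  assumes "k \<noteq> 0"
  shows "of_nat n < \<bar>alpha * of_int k + of_int c\<bar>"
proof -
  have a: "of_nat (n + nat \<bar>c\<bar>) < alpha" by (rule alpha_gt_of_nat)
  have "0 < alpha" using alpha_gt_of_nat[of 0] by simp
  moreover have "1 \<le> \<bar>of_int k :: scalar\<bar>"
  proof -
    have "1 \<le> \<bar>k\<bar>" using assms by simp
    then show ?thesis by (simp only: of_int_abs[symmetric] of_int_1_le_iff)
  qed
  ultimately have "alpha \<le> \<bar>alpha * of_int k\<bar>" by (simp add: abs_mult)
  moreover have "\<bar>of_int c :: scalar\<bar> = of_nat (nat \<bar>c\<bar>)" by simp
  moreover have "\<bar>alpha * of_int k\<bar> \<le> \<bar>alpha * of_int k + of_int c\<bar> + \<bar>of_int c\<bar>"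
    using abs_triangle_ineq[of "alpha * of_int k + of_int c" "- of_int c"] by simp
  ultimately show ?thesis using a by (simp add: of_nat_add)
qed

lemma alpha_multiple_nonzero: "(k::int) \<noteq> 0 \<Longrightarrow> alpha * of_int k + of_int c \<noteq> 0"
  using alpha_multiple_large[of k 0 c] by auto

lemma infinitesimal_inverse_alpha:
  fixes k c :: int
  assumes "k \<noteq> 0"
  shows "infinitesimal (1 / (alpha * of_int k + of_int c))"
  unfolding infinitesimal_def
proof
  fix n :: nat
  show "of_nat n * \<bar>1 / (alpha * of_int k + of_int c)\<bar> < 1"
    using alpha_multiple_large[OF assms, of n c] alpha_multiple_nonzero[OF assms, of c]
    by (simp add: abs_divide divide_less_eq)
qed

section \<open>Coefficients and the reflections\<close>

text \<open>Identities in the module are proved coefficient by coefficient, where the sums over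
  tableaux and polynomials disappear.\<close>

definition coef :: "melem \<Rightarrow> filling \<Rightarrow> (nat \<Rightarrow>\<^sub>0 nat) \<Rightarrow> scalar" where
  "coef P \<tau> m = lookup (lookup P \<tau>) m"

definition exp_swap :: "nat \<Rightarrow> (nat \<Rightarrow>\<^sub>0 nat) \<Rightarrow> (nat \<Rightarrow>\<^sub>0 nat)" where
  "exp_swap i m = Poly_Mapping.map_key (transpose i (i + 1)) m"

lemma melem_eqI: "(\<And>\<tau> m. coef P \<tau> m = coef Q \<tau> m) \<Longrightarrow> P = Q"
  unfolding coef_def by (intro poly_mapping_eqI)

lemma coef_add [simp]: "coef (P + Q) \<tau> m = coef P \<tau> m + coef Q \<tau> m"
  by (simp add: coef_def lookup_add)

lemma coef_minus [simp]: "coef (P - Q) \<tau> m = coef P \<tau> m - coef Q \<tau> m"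
  by (simp add: coef_def lookup_minus)

lemma coef_uminus [simp]: "coef (- P) \<tau> m = - coef P \<tau> m"
  by (simp add: coef_def)

lemma coef_zero [simp]: "coef 0 \<tau> m = 0"
  by (simp add: coef_def)

lemma coef_sum: "coef (sum f A) \<tau> m = (\<Sum>a\<in>A. coef (f a) \<tau> m)"
  by (simp add: coef_def lookup_sum)

lemma lookup_single_0_times: "lookup (single 0 c * p) m = c * lookup p m"
  for p :: mpol
proof -
  have "single 0 c * p = Poly_Mapping.map ((*) c) p"
    by (rule mult_map_scale_conv_mult[symmetric])
  then show ?thesis by (simp add: Poly_Mapping.map.rep_eq when_def)
qed

lemma coef_mscale [simp]: "coef (mscale c P) \<tau> m = c * coef P \<tau> m"
  by (simp add: coef_def mscale_def lookup_single_0_times)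

lemma coef_tensor: "coef (tensor f t) \<tau> m = lookup t \<tau> * lookup f m"
  by (simp add: coef_def tensor_def lookup_single_0_times Poly_Mapping.map.rep_eq when_def)

lemma lookup_exp_swap [simp]:
  "lookup (exp_swap i m) j = lookup m (transpose i (i + 1) j)"
  by (simp add: exp_swap_def map_key.rep_eq inj_transpose)

lemma exp_swap_involutory [simp]: "exp_swap i (exp_swap i m) = m"
  by (rule poly_mapping_eqI) simp

lemma exp_swap_braid:
  "exp_swap i (exp_swap (i + 1) (exp_swap i m)) = exp_swap (i + 1) (exp_swap i (exp_swap (i + 1) m))"
  by (rule poly_mapping_eqI) (auto simp: transpose_def)

lemma exp_swap_commute:
  "i + 1 < j \<Longrightarrow> exp_swap i (exp_swap j m) = exp_swap j (exp_swap i m)"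
  by (rule poly_mapping_eqI) (auto simp: transpose_def)

lemma lookup_pol_refl:
  "lookup (pol_refl i f) m = lookup f (exp_swap i m)"
proof -
  \<comment> \<open>\<open>map_key\<close> has its intended meaning only along injective maps; this
    one is an involution.\<close>
  have "inj (\<lambda>m :: nat \<Rightarrow>\<^sub>0 nat. Poly_Mapping.map_key (transpose i (i + 1)) m)"
    by (rule inj_on_inverseI[where g = "exp_swap i"])
       (metis exp_swap_def exp_swap_involutory)
  then show ?thesis
    by (simp add: pol_refl_def map_key.rep_eq exp_swap_def)
qed

lemma interchange_involutory [simp]: "interchange i (interchange i \<tau>) = \<tau>"
  by (simp add: interchange_def fun_eq_iff)

lemma interchange_eq_iff: "interchange i \<tau> = \<rho> \<longleftrightarrow> \<tau> = interchange i \<rho>"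
  by auto

lemma interchange_braid:
  "interchange i (interchange (i + 1) (interchange i \<tau>)) =
   interchange (i + 1) (interchange i (interchange (i + 1) \<tau>))"
  by (auto simp: interchange_def fun_eq_iff transpose_def)

lemma interchange_commute:
  "i + 1 < j \<Longrightarrow> interchange i (interchange j \<tau>) = interchange j (interchange i \<tau>)"
  by (auto simp: interchange_def fun_eq_iff transpose_def)

text \<open>The off-diagonal entry of a reflection as a function of the content difference. It
  vanishes at 1 and -1, so one formula covers all branches of the action.\<close>

definition swap_coeff :: "int \<Rightarrow> scalar" where
  "swap_coeff d = (if d \<ge> 2 then 1 else 1 - (1 / of_int d)\<^sup>2)"

abbreviation CTdiff :: "nat list \<Rightarrow> filling \<Rightarrow> nat \<Rightarrow> int" where
  "CTdiff lam \<tau> i \<equiv> CT lam \<tau> i - CT lam \<tau> (i + 1)"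

text \<open>The equation has no side condition: if the content difference is 0, division by zero
  gives \<open>b = 0\<close>, and both sides have coefficients 0 and 1.\<close>

lemma tab_refl_eq:
  "tab_refl lam i \<tau> = single \<tau> (1 / of_int (CTdiff lam \<tau> i)) +
     single (interchange i \<tau>) (swap_coeff (CTdiff lam \<tau> i))"
proof -
  define d where "d = CTdiff lam \<tau> i"
  define b :: rat where "b = 1 / of_int d"
  have b: "scalar_of_rat b = 1 / of_int d"
    unfolding b_def by (rule scalar_of_rat_inverse_int)
  have c: "scalar_of_rat (1 - b\<^sup>2) = 1 - (1 / of_int d)\<^sup>2"
    using b by (simp add: scalar_of_rat_diff scalar_of_rat_mult power2_eq_square)
  have one: "b = 1 \<or> b = - 1 \<longleftrightarrow> d = 1 \<or> d = - 1"
  proof -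
    have "(of_int d :: rat) = - 1 \<longleftrightarrow> d = - 1"
      using of_int_eq_iff[of d "- 1", where 'a = rat] by simp
    then show ?thesis unfolding b_def
      by (cases "d = 0") (simp_all add: divide_eq_eq eq_commute[of 1] eq_commute[of "- 1"] minus_equation_iff[of 1] del: of_int_eq_iff)
  qed
  have two: "d \<ge> 2" if "0 < b" "b \<le> 1 / 2"
  proof -
    have "d > 0" using that(1) unfolding b_def by simp
    then have "(2::rat) \<le> of_int d" using that(2) unfolding b_def by (simp add: field_simps)
    then show ?thesis by (metis of_int_le_iff of_int_numeral)
  qed
  have two': "0 < b \<and> b \<le> 1 / 2" if "d \<ge> 2"
  proof -
    have "(2::rat) \<le> of_int d" using that by (metis of_int_le_iff of_int_numeral)
    then show ?thesis unfolding b_def by (simp add: field_simps)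
  qed
  show ?thesis
    unfolding tab_refl_def Let_def d_def[symmetric] b_def[symmetric] swap_coeff_def
    using one two two' b c by auto
qed

text \<open>The transposed form of the action: \<open>\<tau>\<close> receives from itself and from
  \<open>interchange i \<tau>\<close>. The off-diagonal weight belongs to the source, which is why
  its content difference is taken at the interchanged filling.\<close>

lemma coef_m_refl:
  "coef (m_refl lam i P) \<tau> m =
     coef P \<tau> (exp_swap i m) / of_int (CTdiff lam \<tau> i) +
     swap_coeff (CTdiff lam (interchange i \<tau>) i) * coef P (interchange i \<tau>) (exp_swap i m)"
proof -
  let ?c = "\<lambda>\<rho>. coef P \<rho> (exp_swap i m)"
  have "coef (m_refl lam i P) \<tau> m = (\<Sum>\<rho>\<in>keys P.
      lookup (tab_refl lam i \<rho>) \<tau> * ?c \<rho>)"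
    unfolding m_refl_def coef_sum coef_tensor lookup_pol_refl by (simp add: coef_def)
  also have "\<dots> = (\<Sum>\<rho>\<in>keys P.
      (if \<rho> = \<tau> then ?c \<rho> / of_int (CTdiff lam \<rho> i) else 0) +
      (if \<rho> = interchange i \<tau> then swap_coeff (CTdiff lam \<rho> i) * ?c \<rho> else 0))"
    by (intro sum.cong refl)
       (auto simp: tab_refl_eq lookup_add lookup_single when_def interchange_eq_iff distrib_right)
  also have "\<dots> = ?c \<tau> / of_int (CTdiff lam \<tau> i) +
     swap_coeff (CTdiff lam (interchange i \<tau>) i) * ?c (interchange i \<tau>)"
    by (auto simp: sum.distrib coef_def in_keys_iff)
  finally show ?thesis .
qed

lemma m_refl_add: "m_refl lam i (P + Q) = m_refl lam i P + m_refl lam i Q"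
  by (rule melem_eqI) (simp add: coef_m_refl algebra_simps add_divide_distrib)

lemma m_refl_mscale: "m_refl lam i (mscale c P) = mscale c (m_refl lam i P)"
  by (rule melem_eqI) (simp add: coef_m_refl algebra_simps)

lemma m_refl_0 [simp]: "m_refl lam i 0 = 0"
  by (rule melem_eqI) (simp add: coef_m_refl)

lemma m_refl_sum: "m_refl lam i (sum f A) = (\<Sum>a\<in>A. m_refl lam i (f a))"
  by (induction A rule: infinite_finite_induct) (simp_all add: m_refl_add)

section \<open>Multiplication by variables\<close>

definition exp_unit :: "nat \<Rightarrow> (nat \<Rightarrow>\<^sub>0 nat)" where
  "exp_unit j = single j 1"

lemma lookup_var_times:
  "lookup (var j * p) m =
    (if lookup m j = 0 then 0 else lookup p (m - exp_unit j))"
proof -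
  have "lookup (var j * p) m =
      (\<Sum>l. (1 when exp_unit j = l) * (\<Sum>q. lookup p q when m = l + q))"
    by (simp add: lookup_mult var_def lookup_single exp_unit_def)
  also have "\<dots> = (\<Sum>q. lookup p q when m = exp_unit j + q)"
    by (simp add: when_mult)
  also have "\<dots> = (if lookup m j = 0 then 0 else lookup p (m - exp_unit j))"
  proof (cases "lookup m j = 0")
    case True
    then have "m \<noteq> exp_unit j + q" for q
      by (auto simp: exp_unit_def lookup_add lookup_single)
    then show ?thesis using True by simp
  next
    case False
    have "m = exp_unit j + q \<longleftrightarrow> m - exp_unit j = q" for q
    proof
      assume "m - exp_unit j = q"
      then show "m = exp_unit j + q" using False
        by (auto intro!: poly_mapping_eqI simp: exp_unit_def lookup_add lookup_minus lookup_single when_def)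
    qed simp
    then show ?thesis using False by simp
  qed
  finally show ?thesis .
qed

lemma coef_var_times:
  "coef (pol_times (var j) P) \<tau> m =
    (if lookup m j = 0 then 0 else coef P \<tau> (m - exp_unit j))"
  by (simp add: coef_def lookup_var_times)

lemma exp_swap_minus: "exp_swap i (m - m') = exp_swap i m - exp_swap i m'"
  by (rule poly_mapping_eqI) (simp add: lookup_minus)

lemma exp_swap_unit: "exp_swap i (exp_unit j) = exp_unit (transpose i (i + 1) j)"
  by (rule poly_mapping_eqI) (auto simp: exp_unit_def lookup_single when_def transpose_def)

lemma m_refl_var_times:
  "m_refl lam i (pol_times (var j) P) = pol_times (var (transpose i (i + 1) j)) (m_refl lam i P)"
  by (rule melem_eqI)
     (auto simp: coef_m_refl coef_var_times exp_swap_minus exp_swap_unit)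

lemma pol_times_commute: "pol_times f (pol_times g P) = pol_times g (pol_times f P)"
  by (rule poly_mapping_eqI) (simp add: mult.left_commute)

lemma pol_times_add: "pol_times f (P + Q) = pol_times f P + pol_times f Q"
  by (rule poly_mapping_eqI) (simp add: lookup_add distrib_left)

lemma pol_times_mscale: "pol_times f (mscale c P) = mscale c (pol_times f P)"
  unfolding mscale_def by (rule pol_times_commute)

lemma fold_m_refl_add: "fold (m_refl lam) is (P + Q) = fold (m_refl lam) is P + fold (m_refl lam) is Q"
  by (induction "is" arbitrary: P Q) (simp_all add: m_refl_add)

lemma fold_m_refl_mscale: "fold (m_refl lam) is (mscale c P) = mscale c (fold (m_refl lam) is P)"
  by (induction "is" arbitrary: P) (simp_all add: m_refl_mscale)

lemma m_Psi_add: "m_Psi lam (P + Q) = m_Psi lam P + m_Psi lam Q"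
  by (simp add: m_Psi_def fold_m_refl_add pol_times_add)

lemma m_Psi_mscale: "m_Psi lam (mscale c P) = mscale c (m_Psi lam P)"
  by (simp add: m_Psi_def fold_m_refl_mscale pol_times_mscale)

section \<open>Reverse standard tableaux\<close>

locale shape =
  fixes lam :: "nat list"
  assumes partition: "is_partition (sum_list lam) lam"
begin

abbreviation "N \<equiv> sum_list lam"
abbreviation "B \<equiv> boxes lam"
abbreviation "S \<equiv> m_refl lam"

text \<open>Unlike being a tableau, this is stable under every interchange of labels in range, so
  contents can also be computed for fillings met in the middle of a braid.\<close>

definition bijective :: "filling \<Rightarrow> bool" where
  "bijective \<tau> \<longleftrightarrow> bij_betw \<tau> B {1..N}"

lemma box_below:
  assumes "(c, r) \<in> B" "1 \<le> c'" "c' \<le> c" "1 \<le> r'" "r' \<le> r"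
  shows "(c', r') \<in> B"
proof -
  have s: "sorted_wrt (\<ge>) lam" using partition by (simp add: is_partition_def)
  have "lam ! (r - 1) \<le> lam ! (r' - 1)"
  proof (cases "r = r'")
    case False
    then show ?thesis using assms sorted_wrt_nth_less[OF s, of "r' - 1" "r - 1"]
      by (auto simp: boxes_def)
  qed simp
  then show ?thesis using assms by (auto simp: boxes_def)
qed

lemma boxes_pos: "(c, r) \<in> B \<Longrightarrow> 1 \<le> c \<and> 1 \<le> r"
  by (simp add: boxes_def)

lemma boxes_image:
  "B = (\<lambda>(r, c). (c, r)) ` (SIGMA r:{1..length lam}. {1..lam ! (r - 1)})"
  by (auto simp: boxes_def image_iff)

lemma finite_boxes [simp]: "finite B"
  unfolding boxes_image by simp

lemma card_boxes: "card B = N"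
proof -
  have "card B = card (SIGMA r:{1..length lam}. {1..lam ! (r - 1)})"
    unfolding boxes_image by (intro card_image) (auto simp: inj_on_def)
  also have "\<dots> = (\<Sum>r\<in>{1..length lam}. lam ! (r - 1))" by simp
  also have "\<dots> = (\<Sum>r\<in>{0..<length lam}. lam ! r)"
    by (rule sum.reindex_bij_witness[of _ "\<lambda>r. r + 1" "\<lambda>r. r - 1"]) auto
  also have "\<dots> = N" by (simp add: sum_list_sum_nth)
  finally show ?thesis .
qed

lemma RST_bijective: "\<tau> \<in> RST lam \<Longrightarrow> bijective \<tau>"
  by (simp add: RST_def bijective_def)

lemma RST_outside: "\<tau> \<in> RST lam \<Longrightarrow> b \<notin> B \<Longrightarrow> \<tau> b = 0"
  unfolding RST_def by blast

lemma RST_decreasing: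
  assumes \<tau>: "\<tau> \<in> RST lam" and b: "(c, r) \<in> B" and b': "(c', r') \<in> B"
    and le: "c \<le> c'" "r \<le> r'" and ne: "(c, r) \<noteq> (c', r')"
  shows "\<tau> (c', r') < \<tau> (c, r)"
proof -
  have mid: "(c', r) \<in> B" using box_below[OF b'] boxes_pos[OF b] boxes_pos[OF b'] le by simp
  have row: "\<tau> (c', r) < \<tau> (c, r)" if "c < c'"
    using \<tau> that b mid unfolding RST_def by blast
  have col: "\<tau> (c', r') < \<tau> (c', r)" if "r < r'"
    using \<tau> that b' mid unfolding RST_def by blast
  show ?thesis using row col le ne by (cases "c < c'"; cases "r < r'") auto
qed

lemma bijective_range: "bijective \<tau> \<Longrightarrow> b \<in> B \<Longrightarrow> 1 \<le> \<tau> b \<and> \<tau> b \<le> N"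
  unfolding bijective_def by (drule bij_betwE) auto

lemma bijective_inj: "bijective \<tau> \<Longrightarrow> b \<in> B \<Longrightarrow> b' \<in> B \<Longrightarrow> \<tau> b = \<tau> b' \<Longrightarrow> b = b'"
  unfolding bijective_def bij_betw_def inj_on_def by blast

lemma bijective_box:
  assumes "bijective \<tau>" "1 \<le> i" "i \<le> N"
  obtains c r where "(c, r) \<in> B" "\<tau> (c, r) = i"
proof -
  have "i \<in> \<tau> ` B" using assms unfolding bijective_def bij_betw_def by simp
  then show ?thesis using that by force
qed

lemma CT_box:
  assumes "bijective \<tau>" "(c, r) \<in> B"
  shows "CT lam \<tau> (\<tau> (c, r)) = int c - int r"
proof -
  have "the_inv_into B \<tau> (\<tau> (c, r)) = (c, r)"
    using assms by (intro the_inv_into_f_f) (simp_all add: bijective_def bij_betw_def)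
  then show ?thesis by (simp add: CT_def)
qed

lemma bijective_interchange:
  assumes "bijective \<tau>" "1 \<le> i" "i < N"
  shows "bijective (interchange i \<tau>)"
  using assms unfolding bijective_def interchange_def
  by (intro bij_betw_trans[of \<tau> _ "{1..N}"] bij_betw_transpose_iff) auto

lemma CT_interchange:
  assumes "bijective \<tau>" "1 \<le> i" "i < N" "1 \<le> j" "j \<le> N"
  shows "CT lam (interchange i \<tau>) j = CT lam \<tau> (transpose i (i + 1) j)"
proof -
  have "1 \<le> transpose i (i + 1) j" "transpose i (i + 1) j \<le> N"
    using assms by (auto simp: transpose_def)
  then obtain c r where b: "(c, r) \<in> B" "\<tau> (c, r) = transpose i (i + 1) j"
    using bijective_box assms(1) by metis
  then have "interchange i \<tau> (c, r) = j" by (simp add: interchange_def)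
  then show ?thesis
    using CT_box[OF assms(1) b(1)] CT_box[OF bijective_interchange[OF assms(1-3)] b(1)] b(2) by simp
qed

text \<open>Boxes of equal content lie on one diagonal, so the lower left one has a right and an
  upper neighbour in the shape, whose two distinct labels lie strictly between the given ones.
  Excluding the distances 1 and 2 keeps the denominators in the braid relation nonzero.\<close>

lemma equal_contents_far:
  assumes \<tau>: "\<tau> \<in> RST lam" and ij: "1 \<le> i" "i < j" "j \<le> N" and eq: "CT lam \<tau> i = CT lam \<tau> j"
  shows "i + 3 \<le> j"
proof -
  note bij = RST_bijective[OF \<tau>]
  obtain c' r' where i: "(c', r') \<in> B" "\<tau> (c', r') = i"
    by (rule bijective_box[OF bij, of i]) (use ij in auto)
  obtain c r where j: "(c, r) \<in> B" "\<tau> (c, r) = j"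
    by (rule bijective_box[OF bij, of j]) (use ij in auto)
  have ct: "int c' - int r' = int c - int r"
    using eq CT_box[OF bij i(1)] CT_box[OF bij j(1)] i(2) j(2) by simp
  have "c < c'"
  proof (rule ccontr)
    assume "\<not> c < c'"
    moreover have "(c', r') \<noteq> (c, r)" using i j ij by auto
    ultimately have "\<tau> (c, r) < \<tau> (c', r')" using ct by (intro RST_decreasing[OF \<tau> i(1) j(1)]) auto
    then show False using i j ij by simp
  qed
  then have lt: "c < c'" "r < r'" using ct by auto
  have b1: "(c + 1, r) \<in> B" and b2: "(c, r + 1) \<in> B"
    using box_below[OF i(1)] boxes_pos[OF j(1)] lt by auto
  have "\<tau> (c + 1, r) < \<tau> (c, r)" "\<tau> (c, r + 1) < \<tau> (c, r)"
    by (rule RST_decreasing[OF \<tau> j(1) b1] RST_decreasing[OF \<tau> j(1) b2]; simp)+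
  moreover have "\<tau> (c', r') < \<tau> (c + 1, r)" "\<tau> (c', r') < \<tau> (c, r + 1)"
    by (rule RST_decreasing[OF \<tau> b1 i(1)] RST_decreasing[OF \<tau> b2 i(1)]; use lt in simp)+
  moreover have "\<tau> (c + 1, r) \<noteq> \<tau> (c, r + 1)"
    using bijective_inj[OF bij b1 b2] by auto
  ultimately show ?thesis unfolding i(2) j(2) by linarith
qed

lemma CTdiff_nonzero:
  assumes "\<tau> \<in> RST lam" "1 \<le> i" "i < N"
  shows "CTdiff lam \<tau> i \<noteq> 0"
  using equal_contents_far[OF assms(1), of i "i + 1"] assms by auto

text \<open>A box between the two would need a label strictly between \<open>i\<close> and
  \<open>i + 1\<close>, so they are neighbours.\<close>

lemma same_row_consecutive:
  assumes \<tau>: "\<tau> \<in> RST lam" and b: "(c, r) \<in> B" "(c', r) \<in> B"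
    and lab: "\<tau> (c', r) = i" "\<tau> (c, r) = i + 1"
  shows "CTdiff lam \<tau> i = 1"
proof -
  note bij = RST_bijective[OF \<tau>]
  have "c < c'"
    using RST_decreasing[OF \<tau> b(2,1)] lab by (cases "c < c'") (force simp: not_less)+
  moreover have "c' \<le> c + 1"
  proof (rule ccontr)
    assume *: "\<not> c' \<le> c + 1"
    have m: "(c + 1, r) \<in> B" using box_below[OF b(2)] boxes_pos[OF b(1)] * by simp
    show False
      using RST_decreasing[OF \<tau> b(1) m] RST_decreasing[OF \<tau> m b(2)] * lab by simp
  qed
  ultimately show ?thesis using CT_box[OF bij b(1)] CT_box[OF bij b(2)] lab by simp
qed

lemma same_column_consecutive:
  assumes \<tau>: "\<tau> \<in> RST lam" and b: "(c, r) \<in> B" "(c, r') \<in> B"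
    and lab: "\<tau> (c, r') = i" "\<tau> (c, r) = i + 1"
  shows "CTdiff lam \<tau> i = - 1"
proof -
  note bij = RST_bijective[OF \<tau>]
  have "r < r'"
    using RST_decreasing[OF \<tau> b(2,1)] lab by (cases "r < r'") (force simp: not_less)+
  moreover have "r' \<le> r + 1"
  proof (rule ccontr)
    assume *: "\<not> r' \<le> r + 1"
    have m: "(c, r + 1) \<in> B" using box_below[OF b(2)] boxes_pos[OF b(1)] * by simp
    show False
      using RST_decreasing[OF \<tau> b(1) m] RST_decreasing[OF \<tau> m b(2)] * lab by simp
  qed
  ultimately show ?thesis using CT_box[OF bij b(1)] CT_box[OF bij b(2)] lab by simp
qed

text \<open>Interchanging consecutive labels reverses only the comparison between these two, and
  that one matters only if they share a row or a column, where the content difference is 1 or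
  -1.\<close>

lemma interchange_RST:
  assumes \<tau>: "\<tau> \<in> RST lam" and i: "1 \<le> i" "i < N" and d: "\<bar>CTdiff lam \<tau> i\<bar> \<ge> 2"
  shows "interchange i \<tau> \<in> RST lam"
proof -
  have tr: "transpose i (i + 1) x < transpose i (i + 1) y" if "x < y" "\<not> (x = i \<and> y = i + 1)" for x y
    using that by (auto simp: transpose_def)
  have "interchange i \<tau> (c', r) < interchange i \<tau> (c, r)"
    if "(c, r) \<in> B" "(c', r) \<in> B" "c < c'" for c c' r
    unfolding interchange_def o_def
    using that d same_row_consecutive[OF \<tau> that(1,2)]
    by (intro tr RST_decreasing[OF \<tau>]) auto
  moreover have "interchange i \<tau> (c, r') < interchange i \<tau> (c, r)"
    if "(c, r) \<in> B" "(c, r') \<in> B" "r < r'" for c r r'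
    unfolding interchange_def o_def
    using that d same_column_consecutive[OF \<tau> that(1,2)]
    by (intro tr RST_decreasing[OF \<tau>]) auto
  moreover have "interchange i \<tau> b = 0" if "b \<notin> B" for b
    using RST_outside[OF \<tau> that] i by (simp add: interchange_def)
  moreover have "bij_betw (interchange i \<tau>) B {1..N}"
    using bijective_interchange[OF RST_bijective[OF \<tau>] i] by (simp add: bijective_def)
  ultimately show ?thesis unfolding RST_def by blast
qed

lemma swap_coeff_pm1 [simp]: "swap_coeff 1 = 0" "swap_coeff (- 1) = 0"
  by (simp_all add: swap_coeff_def)

lemma swap_coeff_RST:
  assumes "\<tau> \<in> RST lam" "1 \<le> i" "i < N" "swap_coeff (CTdiff lam \<tau> i) \<noteq> 0"
  shows "interchange i \<tau> \<in> RST lam"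
proof (rule interchange_RST[OF assms(1-3)])
  have "CTdiff lam \<tau> i \<noteq> 1" "CTdiff lam \<tau> i \<noteq> - 1"
    using assms(4) swap_coeff_pm1 by metis+
  then show "\<bar>CTdiff lam \<tau> i\<bar> \<ge> 2"
    using CTdiff_nonzero[OF assms(1-3)] by linarith
qed

text \<open>With diagonal entries \<open>1/d\<close> and \<open>-1/d\<close>, this product of the
  off-diagonal entries makes the 2 by 2 block an involution.\<close>

lemma swap_coeff_mult:
  assumes "d \<noteq> 0"
  shows "swap_coeff d * swap_coeff (- d) = 1 - (1 / of_int d)\<^sup>2"
proof -
  consider "d \<ge> 2" | "d \<le> - 2" | "d = 1" | "d = - 1" using assms by linarith
  then show ?thesis by cases (auto simp: swap_coeff_def)
qed

section \<open>Relations between the reflections\<close>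

lemma M_iff:
  "P \<in> M lam \<longleftrightarrow> (\<forall>\<tau> m. coef P \<tau> m \<noteq> 0 \<longrightarrow> \<tau> \<in> RST lam \<and> keys m \<subseteq> {1..N})"
proof
  assume P: "P \<in> M lam"
  show "\<forall>\<tau> m. coef P \<tau> m \<noteq> 0 \<longrightarrow> \<tau> \<in> RST lam \<and> keys m \<subseteq> {1..N}"
  proof (intro allI impI)
    fix \<tau> m assume nz: "coef P \<tau> m \<noteq> 0"
    then have "\<tau> \<in> keys P" "m \<in> keys (lookup P \<tau>)"
      by (auto simp: coef_def in_keys_iff)
    then show "\<tau> \<in> RST lam \<and> keys m \<subseteq> {1..N}" using P unfolding M_def by blast
  qed
next
  assume *: "\<forall>\<tau> m. coef P \<tau> m \<noteq> 0 \<longrightarrow> \<tau> \<in> RST lam \<and> keys m \<subseteq> {1..N}"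
  have "\<tau> \<in> RST lam" if "\<tau> \<in> keys P" for \<tau>
  proof -
    have "lookup P \<tau> \<noteq> 0" using that by (simp add: in_keys_iff)
    then have "\<exists>m. coef P \<tau> m \<noteq> 0" unfolding coef_def
      by (metis lookup_zero poly_mapping_eqI)
    then show ?thesis using * by blast
  qed
  then show "P \<in> M lam" using * unfolding M_def coef_def by (auto simp: in_keys_iff)
qed

lemma M_coef_outside: "P \<in> M lam \<Longrightarrow> \<tau> \<notin> RST lam \<Longrightarrow> coef P \<tau> m = 0"
  using M_iff by blast

lemma M_add: "P \<in> M lam \<Longrightarrow> Q \<in> M lam \<Longrightarrow> P + Q \<in> M lam"
  unfolding M_iff
proof (intro allI impI)
  fix \<tau> m
  assume *: "\<forall>\<tau> m. coef P \<tau> m \<noteq> 0 \<longrightarrow> \<tau> \<in> RST lam \<and> keys m \<subseteq> {1..N}"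
    "\<forall>\<tau> m. coef Q \<tau> m \<noteq> 0 \<longrightarrow> \<tau> \<in> RST lam \<and> keys m \<subseteq> {1..N}"
  assume "coef (P + Q) \<tau> m \<noteq> 0"
  then have "coef P \<tau> m \<noteq> 0 \<or> coef Q \<tau> m \<noteq> 0" by auto
  then show "\<tau> \<in> RST lam \<and> keys m \<subseteq> {1..N}" using * by blast
qed

lemma M_mscale: "P \<in> M lam \<Longrightarrow> mscale c P \<in> M lam"
  unfolding M_iff by auto

lemma M_zero [simp]: "0 \<in> M lam"
  unfolding M_iff by simp

lemma M_sum: "(\<And>a. a \<in> A \<Longrightarrow> f a \<in> M lam) \<Longrightarrow> sum f A \<in> M lam"
  by (induction A rule: infinite_finite_induct) (auto intro: M_add)

lemma keys_exp_swap:
  assumes "1 \<le> i" "i < n" "keys (exp_swap i m) \<subseteq> {1..n}"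
  shows "keys m \<subseteq> {1..n}"
proof
  fix j assume "j \<in> keys m"
  then have "transpose i (i + 1) j \<in> keys (exp_swap i m)" by (simp add: in_keys_iff)
  then have "transpose i (i + 1) j \<in> {1..n}" using assms by blast
  then show "j \<in> {1..n}" using assms by (auto simp: transpose_def split: if_splits)
qed

text \<open>A filling that is not a tableau can receive only through the off-diagonal term, whose
  weight then vanishes by \<open>swap_coeff_RST\<close>.\<close>

lemma M_S:
  assumes P: "P \<in> M lam" and i: "1 \<le> i" "i < N"
  shows "S i P \<in> M lam"
  unfolding M_iff
proof (intro allI impI)
  fix \<tau> m assume nz: "coef (S i P) \<tau> m \<noteq> 0"
  let ?\<rho> = "interchange i \<tau>"
  have "coef P \<tau> (exp_swap i m) \<noteq> 0 \<or>
      swap_coeff (CTdiff lam ?\<rho> i) \<noteq> 0 \<and> coef P ?\<rho> (exp_swap i m) \<noteq> 0"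
    using nz by (auto simp: coef_m_refl)
  then show "\<tau> \<in> RST lam \<and> keys m \<subseteq> {1..N}"
  proof
    assume "coef P \<tau> (exp_swap i m) \<noteq> 0"
    then show ?thesis using P keys_exp_swap[OF i, of m] unfolding M_iff by blast
  next
    assume *: "swap_coeff (CTdiff lam ?\<rho> i) \<noteq> 0 \<and> coef P ?\<rho> (exp_swap i m) \<noteq> 0"
    then have "?\<rho> \<in> RST lam" using P unfolding M_iff by blast
    then have "interchange i ?\<rho> \<in> RST lam" using swap_coeff_RST i * by blast
    then show ?thesis using * P keys_exp_swap[OF i, of m] unfolding M_iff by auto
  qed
qed

lemma M_eqI:
  assumes "P \<in> M lam" "Q \<in> M lam" "\<And>\<tau> m. \<tau> \<in> RST lam \<Longrightarrow> coef P \<tau> m = coef Q \<tau> m"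
  shows "P = Q"
proof (rule melem_eqI)
  fix \<tau> m show "coef P \<tau> m = coef Q \<tau> m"
    using assms M_coef_outside by (cases "\<tau> \<in> RST lam") auto
qed

lemma CTdiff_interchange:
  assumes "bijective \<tau>" "1 \<le> i" "i < N"
  shows "CTdiff lam (interchange i \<tau>) i = - CTdiff lam \<tau> i"
  using assms by (simp add: CT_interchange)

lemma S_involutory:
  assumes P: "P \<in> M lam" and i: "1 \<le> i" "i < N"
  shows "S i (S i P) = P"
proof (rule M_eqI)
  fix \<tau> m assume \<tau>: "\<tau> \<in> RST lam"
  define d where "d = CTdiff lam \<tau> i"
  have d0: "d \<noteq> 0" using CTdiff_nonzero[OF \<tau> i] by (simp add: d_def)
  have d': "CTdiff lam (interchange i \<tau>) i = - d"
    using CTdiff_interchange[OF RST_bijective[OF \<tau>] i] by (simp add: d_def)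
  let ?p = "coef P \<tau> m" and ?q = "coef P (interchange i \<tau>) m"
  have "coef (S i (S i P)) \<tau> m = (?p / of_int d + swap_coeff (- d) * ?q) / of_int d +
      swap_coeff (- d) * (?q / of_int (- d) + swap_coeff d * ?p)"
    by (simp only: coef_m_refl d' d_def[symmetric] interchange_involutory exp_swap_involutory)
  also have "\<dots> = ?p * (1 / of_int d)\<^sup>2 + (swap_coeff d * swap_coeff (- d)) * ?p"
    by (simp add: algebra_simps add_divide_distrib power2_eq_square)
  also have "\<dots> = ?p" unfolding swap_coeff_mult[OF d0] by (simp add: algebra_simps)
  finally show "coef (S i (S i P)) \<tau> m = ?p" .
qed (use assms M_S in auto)

lemma S_commute:
  assumes P: "P \<in> M lam" and ij: "1 \<le> i" "i + 1 < j" "j < N"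
  shows "S i (S j P) = S j (S i P)"
proof (rule M_eqI)
  fix \<tau> m assume \<tau>: "\<tau> \<in> RST lam"
  note bij = RST_bijective[OF \<tau>]
  have i': "1 \<le> i" "i < N" and j': "1 \<le> j" "j < N" using ij by auto
  have bi: "bijective (interchange i \<tau>)" and bj: "bijective (interchange j \<tau>)"
    using bijective_interchange[OF bij] i' j' by auto
  have *: "CTdiff lam (interchange i \<tau>) j = CTdiff lam \<tau> j"
    "CTdiff lam (interchange j \<tau>) i = CTdiff lam \<tau> i"
    "CTdiff lam (interchange j (interchange i \<tau>)) j = CTdiff lam (interchange j \<tau>) j"
    "CTdiff lam (interchange j (interchange i \<tau>)) i = CTdiff lam (interchange i \<tau>) i"
    using ij i' j' bij bi bj by (simp_all add: CT_interchange)
  show "coef (S i (S j P)) \<tau> m = coef (S j (S i P)) \<tau> m"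
    unfolding coef_m_refl interchange_commute[OF ij(2)] exp_swap_commute[OF ij(2)] *
    by (simp add: algebra_simps add_divide_distrib)
qed (use assms M_S in auto)

end

text \<open>The braid relation at one coefficient. \<open>xyz\<close>, ..., \<open>zyx\<close> are
  the values at the six fillings got by permuting three consecutive labels, each named by the
  contents of these labels in order; \<open>p\<close>, \<open>q\<close>, \<open>r\<close> are the
  reciprocals of \<open>x - y\<close>, \<open>y - z\<close>, \<open>x - z\<close>, and
  \<open>gxy\<close> is the off-diagonal weight for \<open>x - y\<close>. Beyond \<open>pq\<close>
  only two products of weights matter; the other weights occur alike on both sides.\<close>

lemma braid_identity:
  fixes p q r :: "'a :: field"
  assumes pq: "p * q = r * (p + q)"
    and gxy: "gxy * gyx = 1 - p\<^sup>2" and gyz: "gyz * gzy = 1 - q\<^sup>2"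
  shows "p * (q * (p * xyz + gyx * yxz) + gzy * (r * xzy + gzx * zxy))
      + gyx * (r * (- p * yxz + gxy * xyz) + gzx * (q * yzx + gzy * zyx))
    = q * (p * (q * xyz + gzy * xzy) + gyx * (r * yxz + gzx * yzx))
      + gzy * (r * (- q * xzy + gyz * xyz) + gzx * (p * zxy + gyx * zyx))"
proof -
  have 1: "gyx * (r * (- p * yxz + gxy * xyz)) = - (r * p * gyx * yxz) + r * (1 - p\<^sup>2) * xyz"
    unfolding gxy[symmetric] by (simp add: algebra_simps)
  have 2: "gzy * (r * (- q * xzy + gyz * xyz)) = - (r * q * gzy * xzy) + r * (1 - q\<^sup>2) * xyz"
    unfolding gyz[symmetric] by (simp add: algebra_simps)
  have 3: "p * q * p + r * (1 - p\<^sup>2) = q * p * q + r * (1 - q\<^sup>2)"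
  proof -
    have "p * q * p - q * p * q = r * (p + q) * (p - q)" using pq by (simp add: algebra_simps)
    then show ?thesis by (simp add: algebra_simps power2_eq_square)
  qed
  have 4: "p * q * gyx - r * p * gyx = q * r * gyx" using pq by (simp add: algebra_simps)
  have 5: "q * p * gzy - r * q * gzy = p * r * gzy" using pq by (simp add: algebra_simps)
  have "p * (q * (p * xyz + gyx * yxz) + gzy * (r * xzy + gzx * zxy))
      + gyx * (r * (- p * yxz + gxy * xyz) + gzx * (q * yzx + gzy * zyx))
    = (p * q * p + r * (1 - p\<^sup>2)) * xyz + (p * q * gyx - r * p * gyx) * yxz + p * r * gzy * xzy
      + p * gzy * gzx * zxy + gyx * gzx * q * yzx + gyx * gzx * gzy * zyx"
    using 1 by (simp add: algebra_simps)
  also have "\<dots> = (q * p * q + r * (1 - q\<^sup>2)) * xyz + q * r * gyx * yxz + (q * p * gzy - r * q * gzy) * xzy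
      + p * gzy * gzx * zxy + gyx * gzx * q * yzx + gyx * gzx * gzy * zyx"
    unfolding 3 4 5 ..
  also have "\<dots> = q * (p * (q * xyz + gzy * xzy) + gyx * (r * yxz + gzx * yzx))
      + gzy * (r * (- q * xzy + gyz * xyz) + gzx * (p * zxy + gyx * zyx))"
    using 2 by (simp add: algebra_simps)
  finally show ?thesis .
qed

context shape begin

lemma S_braid:
  assumes P: "P \<in> M lam" and i: "1 \<le> i" "i + 1 < N"
  shows "S i (S (i + 1) (S i P)) = S (i + 1) (S i (S (i + 1) P))"
proof (rule M_eqI)
  fix \<tau> m assume \<tau>: "\<tau> \<in> RST lam"
  note bij = RST_bijective[OF \<tau>]
  let ?j = "i + 1"
  have i': "1 \<le> i" "i < N" and j': "1 \<le> ?j" "?j < N" using i by auto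
  let ?I = "interchange i" and ?J = "interchange ?j"
  define x y z where "x = CT lam \<tau> i" and "y = CT lam \<tau> (i + 1)" and "z = CT lam \<tau> (i + 2)"
  have ne: "x \<noteq> y" "y \<noteq> z" "x \<noteq> z"
    using equal_contents_far[OF \<tau>, of i "i + 1"] equal_contents_far[OF \<tau>, of "i + 1" "i + 2"]
      equal_contents_far[OF \<tau>, of i "i + 2"] i by (auto simp: x_def y_def z_def)
  \<comment> \<open>The five other fillings may fail to be tableaux, but bijectivity is enough to
    follow the three contents through them.\<close>
  have b: "bijective (?I \<tau>)" "bijective (?J \<tau>)" "bijective (?J (?I \<tau>))" "bijective (?I (?J \<tau>))"
    "bijective (?I (?J (?I \<tau>)))"
    using bijective_interchange[OF _ i'] bijective_interchange[OF _ j'] bij by auto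
  have rng: "i \<le> N" "1 \<le> i" "i + 1 \<le> N" "i + 2 \<le> N" "1 \<le> i + 1" "1 \<le> i + 2" using i by auto
  have a: "i + 1 + 1 = i + 2" by simp
  have ctI: "CT lam (?I \<rho>) i = CT lam \<rho> (i + 1)" "CT lam (?I \<rho>) (i + 1) = CT lam \<rho> i"
    "CT lam (?I \<rho>) (i + 2) = CT lam \<rho> (i + 2)" if "bijective \<rho>" for \<rho>
    using rng by (subst CT_interchange[OF that i']; simp)+
  have ctJ: "CT lam (?J \<rho>) i = CT lam \<rho> i" "CT lam (?J \<rho>) (i + 1) = CT lam \<rho> (i + 2)"
    "CT lam (?J \<rho>) (i + 2) = CT lam \<rho> (i + 1)" if "bijective \<rho>" for \<rho>
    using rng by (subst CT_interchange[OF that j']; simp)+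
  note ct = ctI[OF bij] ctJ[OF bij] ctI[OF b(1)] ctI[OF b(2)] ctI[OF b(3)] ctI[OF b(4)]
    ctJ[OF b(1)] ctJ[OF b(2)] ctJ[OF b(3)] ctJ[OF b(4)]
  have ct0: "CTdiff lam \<tau> i = x - y" "CTdiff lam \<tau> ?j = y - z"
    by (simp_all only: a x_def y_def z_def)
  have ct1: "CTdiff lam (?I \<tau>) i = y - x" "CTdiff lam (?I \<tau>) ?j = x - z"
    "CTdiff lam (?J \<tau>) i = x - z" "CTdiff lam (?J \<tau>) ?j = z - y"
    by (simp_all only: a ct x_def y_def z_def)
  have ct2: "CTdiff lam (?J (?I \<tau>)) i = y - z" "CTdiff lam (?J (?I \<tau>)) ?j = z - x"
    "CTdiff lam (?I (?J \<tau>)) i = z - x" "CTdiff lam (?I (?J \<tau>)) ?j = x - y"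
    by (simp_all only: a ct x_def y_def z_def)
  have ct3: "CTdiff lam (?I (?J (?I \<tau>))) i = z - y" "CTdiff lam (?I (?J (?I \<tau>))) ?j = y - x"
    by (simp_all only: a ct x_def y_def z_def)
  define p q r :: scalar where "p = 1 / of_int (x - y)" and "q = 1 / of_int (y - z)" and "r = 1 / of_int (x - z)"
  define g where "g = (\<lambda>a b. swap_coeff (a - b))"
  define m' where "m' = exp_swap i (exp_swap ?j (exp_swap i m))"
  have m'2: "exp_swap ?j (exp_swap i (exp_swap ?j m)) = m'"
    unfolding m'_def by (rule exp_swap_braid[symmetric])
  have inv: "1 / of_int (y - x) = - p" "1 / of_int (z - y) = - q"
    "1 / of_int (z - x) = - r"
    unfolding p_def q_def r_def by (simp_all add: divide_simps)
  have pq: "p * q = r * (p + q)"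
  proof -
    have "of_int x - of_int y \<noteq> (0 :: scalar)" "of_int y - of_int z \<noteq> (0 :: scalar)"
      "of_int x - of_int z \<noteq> (0 :: scalar)" using ne by auto
    then show ?thesis unfolding p_def q_def r_def by (simp add: field_simps)
  qed
  have gg: "g x y * g y x = 1 - p\<^sup>2" "g y z * g z y = 1 - q\<^sup>2"
    using swap_coeff_mult[of "x - y"] swap_coeff_mult[of "y - z"] ne
    by (simp_all add: g_def p_def q_def)
  have c: "coef (S k Q) \<rho> n = (1 / of_int (CTdiff lam \<rho> k)) * coef Q \<rho> (exp_swap k n) +
      swap_coeff (CTdiff lam (interchange k \<rho>) k) * coef Q (interchange k \<rho>) (exp_swap k n)" for k Q \<rho> n
    by (simp add: coef_m_refl)
  have gs: "swap_coeff (x - y) = g x y" "swap_coeff (y - x) = g y x" "swap_coeff (y - z) = g y z"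
    "swap_coeff (z - y) = g z y" "swap_coeff (z - x) = g z x" "swap_coeff (x - z) = g x z"
    by (simp_all add: g_def)
  have "coef (S i (S ?j (S i P))) \<tau> m = p * (q * (p * coef P \<tau> m' + g y x * coef P (?I \<tau>) m')
        + g z y * (r * coef P (?J \<tau>) m' + g z x * coef P (?I (?J \<tau>)) m'))
      + g y x * (r * (- p * coef P (?I \<tau>) m' + g x y * coef P \<tau> m')
        + g z x * (q * coef P (?J (?I \<tau>)) m' + g z y * coef P (?I (?J (?I \<tau>))) m'))"
    by (simp only: c interchange_involutory ct0 ct1 ct2 ct3 inv gs m'_def[symmetric]
      p_def[symmetric] q_def[symmetric] r_def[symmetric])
  moreover have "coef (S ?j (S i (S ?j P))) \<tau> m =
      q * (p * (q * coef P \<tau> m' + g z y * coef P (?J \<tau>) m')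
        + g y x * (r * coef P (?I \<tau>) m' + g z x * coef P (?J (?I \<tau>)) m'))
      + g z y * (r * (- q * coef P (?J \<tau>) m' + g y z * coef P \<tau> m')
        + g z x * (p * coef P (?I (?J \<tau>)) m' + g y x * coef P (?I (?J (?I \<tau>))) m'))"
    by (simp only: c interchange_involutory ct0 ct1 ct2 ct3 inv gs m'2
      p_def[symmetric] q_def[symmetric] r_def[symmetric] interchange_braid[of i \<tau>, symmetric])
  ultimately show "coef (S i (S ?j (S i P))) \<tau> m = coef (S ?j (S i (S ?j P))) \<tau> m"
    by (simp only: braid_identity[OF pq gg])
qed (use assms M_S in auto)


section \<open>The affine operator\<close>

lemma M_fold_S: "P \<in> M lam \<Longrightarrow> set is \<subseteq> {1..<N} \<Longrightarrow> fold S is P \<in> M lam"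
  by (induction "is" arbitrary: P) (auto simp: M_S)

lemma S_fold_commute:
  assumes "P \<in> M lam" "1 \<le> i" "i < N" "set is \<subseteq> {1..<N}" "\<And>k. k \<in> set is \<Longrightarrow> k + 1 < i \<or> i + 1 < k"
  shows "S i (fold S is P) = fold S is (S i P)"
  using assms
proof (induction "is" arbitrary: P)
  case (Cons k "is")
  have k: "1 \<le> k" "k < N" "k + 1 < i \<or> i + 1 < k" using Cons.prems by auto
  have "S i (fold S is (S k P)) = fold S is (S i (S k P))"
    using Cons.prems k by (intro Cons.IH M_S) auto
  also have "S i (S k P) = S k (S i P)"
    using k(3) S_commute[OF Cons.prems(1) \<open>1 \<le> i\<close> _ k(2)]
      S_commute[OF Cons.prems(1) k(1) _ \<open>i < N\<close>] by fastforce
  finally show ?case by simp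
qed simp

abbreviation "\<Theta> P \<equiv> fold S [1..<N] P"

lemma M_Theta: "P \<in> M lam \<Longrightarrow> \<Theta> P \<in> M lam"
  by (rule M_fold_S) auto

text \<open>The factor s_(i+1) passes s_1, ..., s_(i-1), the braid relation turns s_(i+1) s_i
  s_(i+1) into s_i s_(i+1) s_i, and the final s_i passes the remaining factors: the long cycle
  shifts indices by one.\<close>

lemma Theta_S:
  assumes P: "P \<in> M lam" and i: "1 \<le> i" "i + 1 < N"
  shows "\<Theta> (S (i + 1) P) = S i (\<Theta> P)"
proof -
  have split: "[1..<N] = [1..<i] @ [i, i + 1] @ [i + 2..<N]"
  proof -
    have "[1..<N] = [1..<i] @ [i..<N]" using i upt_add_eq_append[of 1 i "N - i"] by simp
    moreover have "[i..<N] = i # (i + 1) # [i + 2..<N]" using i by (simp add: upt_conv_Cons)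
    ultimately show ?thesis by simp
  qed
  define Q where "Q = fold S [1..<i] P"
  have Q: "Q \<in> M lam" unfolding Q_def using i by (intro M_fold_S P) auto
  have "\<Theta> (S (i + 1) P) = fold S [i + 2..<N] (S (i + 1) (S i (fold S [1..<i] (S (i + 1) P))))"
    unfolding split by simp
  also have "fold S [1..<i] (S (i + 1) P) = S (i + 1) Q"
    unfolding Q_def using i by (intro S_fold_commute[symmetric] P) auto
  also have "S (i + 1) (S i (S (i + 1) Q)) = S i (S (i + 1) (S i Q))"
    by (rule S_braid[OF Q i, symmetric])
  also have "fold S [i + 2..<N] (S i (S (i + 1) (S i Q))) = S i (fold S [i + 2..<N] (S (i + 1) (S i Q)))"
    using i Q by (intro S_fold_commute[symmetric] M_S) auto
  also have "fold S [i + 2..<N] (S (i + 1) (S i Q)) = \<Theta> P"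
    unfolding split Q_def by simp
  finally show ?thesis .
qed

lemma Theta_fold_shift:
  assumes "P \<in> M lam" "\<And>k. k \<in> set is \<Longrightarrow> 1 \<le> k \<and> k + 1 < N"
  shows "\<Theta> (fold S (map Suc is) P) = fold S is (\<Theta> P)"
  using assms
proof (induction "is" arbitrary: P)
  case (Cons k "is")
  have "\<Theta> (fold S (map Suc is) (S (Suc k) P)) = fold S is (\<Theta> (S (Suc k) P))"
    using Cons.prems by (intro Cons.IH M_S) auto
  also have "\<Theta> (S (Suc k) P) = S k (\<Theta> P)" using Theta_S[of P k] Cons.prems by simp
  finally show ?case by simp
qed simp

text \<open>The leading s_1 cancels the first factor of the first \<theta>. What remains, s_2 ...
  s_(N-1), passes the second \<theta> as s_1 ... s_(N-2), which is \<theta> without its last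
  factor.\<close>

lemma Theta_Theta_S:
  assumes P: "P \<in> M lam" and N: "2 \<le> N"
  shows "\<Theta> (\<Theta> (S 1 P)) = S (N - 1) (\<Theta> (\<Theta> P))"
proof -
  have first: "[1..<N] = 1 # map Suc [1..<N - 1]"
    using N by (simp add: upt_conv_Cons map_Suc_upt)
  have last: "[1..<N] = [1..<N - 1] @ [N - 1]"
    using N upt_Suc_append[of 1 "N - 1"] by simp
  have shift: "\<Theta> (S 1 P) = fold S (map Suc [1..<N - 1]) P"
    using S_involutory[OF P, of 1] N unfolding first by simp
  have "\<Theta> (\<Theta> (S 1 P)) = fold S [1..<N - 1] (\<Theta> P)"
  proof -
    have "1 \<le> k \<and> k + 1 < N" if "k \<in> set [1..<N - 1]" for k using that by auto
    from Theta_fold_shift[OF P this] show ?thesis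
      by (simp only: shift)
  qed
  also have "\<dots> = S (N - 1) (S (N - 1) (fold S [1..<N - 1] (\<Theta> P)))"
    using N by (intro S_involutory[symmetric] M_fold_S M_Theta P) auto
  also have "S (N - 1) (fold S [1..<N - 1] (\<Theta> P)) = \<Theta> (\<Theta> P)"
    using last by (rule arg_cong[where f = "\<lambda>is. fold S is (\<Theta> P)", THEN trans, symmetric]) simp
  finally show ?thesis .
qed

abbreviation "\<Psi> \<equiv> m_Psi lam"

lemma M_var_times:
  assumes "P \<in> M lam" "1 \<le> j" "j \<le> N"
  shows "pol_times (var j) P \<in> M lam"
  unfolding M_iff
proof (intro allI impI)
  fix \<tau> m assume "coef (pol_times (var j) P) \<tau> m \<noteq> 0"
  then have "coef P \<tau> (m - exp_unit j) \<noteq> 0" by (auto simp: coef_var_times split: if_splits)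
  then have *: "\<tau> \<in> RST lam" "keys (m - exp_unit j) \<subseteq> {1..N}" using assms unfolding M_iff by blast+
  have "k \<in> keys (m - exp_unit j) \<or> k = j" if "k \<in> keys m" for k
    using that by (auto simp: in_keys_iff lookup_minus exp_unit_def lookup_single when_def)
  then have "keys m \<subseteq> insert j (keys (m - exp_unit j))" by blast
  also have "\<dots> \<subseteq> {1..N}" using * assms by simp
  finally show "\<tau> \<in> RST lam \<and> keys m \<subseteq> {1..N}" using * by blast
qed

lemma M_Psi: "P \<in> M lam \<Longrightarrow> 1 \<le> N \<Longrightarrow> \<Psi> P \<in> M lam"
  unfolding m_Psi_def by (intro M_var_times M_Theta) auto

lemma S_Psi:
  assumes "P \<in> M lam" "1 \<le> i" "i + 1 < N"
  shows "S i (\<Psi> P) = \<Psi> (S (i + 1) P)"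
  using assms by (simp add: m_Psi_def m_refl_var_times Theta_S[simplified])

lemma fold_S_var_times:
  "(\<And>k. k \<in> set is \<Longrightarrow> k + 1 < j) \<Longrightarrow> fold S is (pol_times (var j) P) = pol_times (var j) (fold S is P)"
proof (induction "is" arbitrary: P)
  case (Cons k "is")
  have "k + 1 < j" using Cons.prems by simp
  then have "transpose k (k + 1) j = j" by simp
  then show ?case using Cons by (simp add: m_refl_var_times)
qed simp

text \<open>The variable x_N is fixed by s_1, ..., s_(N-2); only the last factor moves it.\<close>

lemma Theta_var_times:
  assumes "2 \<le> N"
  shows "\<Theta> (pol_times (var N) P) = pol_times (var (N - 1)) (\<Theta> P)"
proof -
  have last: "[1..<N] = [1..<N - 1] @ [N - 1]"
    using assms upt_Suc_append[of 1 "N - 1"] by simp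
  have tr: "transpose (N - 1) (N - 1 + 1) N = N - 1" using assms by simp
  have "\<Theta> (pol_times (var N) P) = S (N - 1) (fold S [1..<N - 1] (pol_times (var N) P))"
    by (subst last) simp
  also have "fold S [1..<N - 1] (pol_times (var N) P) = pol_times (var N) (fold S [1..<N - 1] P)"
    by (rule fold_S_var_times) auto
  also have "S (N - 1) \<dots> = pol_times (var (N - 1)) (S (N - 1) (fold S [1..<N - 1] P))"
    unfolding m_refl_var_times tr ..
  also have "S (N - 1) (fold S [1..<N - 1] P) = \<Theta> P"
    by (subst last) simp
  finally show ?thesis .
qed

text \<open>Two applications of \<Psi> produce the product of x_N and x_(N-1), which s_(N-1) leaves
  invariant. This covers the index \<open>N - 1\<close>, which \<open>S_Psi\<close> cannot
  reach.\<close>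

lemma S_Psi_Psi:
  assumes P: "P \<in> M lam" and N: "2 \<le> N"
  shows "S (N - 1) (\<Psi> (\<Psi> P)) = \<Psi> (\<Psi> (S 1 P))"
proof -
  have tr: "transpose (N - 1) (N - 1 + 1) N = N - 1" "transpose (N - 1) (N - 1 + 1) (N - 1) = N"
    using N by simp_all
  have PP: "\<Psi> (\<Psi> Q) = pol_times (var N) (pol_times (var (N - 1)) (\<Theta> (\<Theta> Q)))" for Q
    unfolding m_Psi_def Theta_var_times[OF N] ..
  show ?thesis
    unfolding PP m_refl_var_times tr Theta_Theta_S[OF P N] by (rule pol_times_commute)
qed

section \<open>Intertwining steps and the Yang-Baxter equation\<close>

definition step :: "nat \<Rightarrow> scalar \<Rightarrow> melem \<Rightarrow> melem" where
  "step i c P = S i P + mscale c P"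

lemma M_step: "P \<in> M lam \<Longrightarrow> 1 \<le> i \<Longrightarrow> i < N \<Longrightarrow> step i c P \<in> M lam"
  unfolding step_def by (intro M_add M_S M_mscale)

lemma step_mscale: "step i c (mscale a P) = mscale a (step i c P)"
  by (rule melem_eqI) (simp add: step_def m_refl_mscale algebra_simps)

lemma step_commute:
  assumes "P \<in> M lam" "1 \<le> i" "i + 1 < j" "j < N"
  shows "step i c (step j d P) = step j d (step i c P)"
  by (rule melem_eqI)
     (simp add: step_def m_refl_add m_refl_mscale S_commute[OF assms] algebra_simps)

text \<open>The condition \<open>rel\<close> is met by \<open>p = 1/a\<close>,
  \<open>r = 1/c\<close>, \<open>q = 1/(a + c)\<close>. On expansion the cubic terms agree by the
  braid relation, the constants because reflections are involutions, and the terms linear in a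
  reflection by \<open>rel\<close>.\<close>

lemma yang_baxter:
  assumes P: "P \<in> M lam" and i: "1 \<le> i" "i + 1 < N" and rel: "p * r = q * (p + r)"
  shows "step i r (step (i + 1) q (step i p P)) = step (i + 1) p (step i q (step (i + 1) r P))"
proof (rule melem_eqI)
  fix \<tau> m
  let ?A = "coef (S i P) \<tau> m" and ?B = "coef (S (i + 1) P) \<tau> m"
  have inv: "S i (S i P) = P" "S (i + 1) (S (i + 1) P) = P"
    using S_involutory[OF P] i by auto
  have *: "?A * (p * r) = ?A * (q * p) + ?A * (q * r)" "?B * (p * r) = ?B * (q * p) + ?B * (q * r)"
    unfolding rel by (simp_all add: algebra_simps)
  show "coef (step i r (step (i + 1) q (step i p P))) \<tau> m = coef (step (i + 1) p (step i q (step (i + 1) r P))) \<tau> m"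
    unfolding step_def m_refl_add m_refl_mscale S_braid[OF P i] inv
    using * by (simp add: algebra_simps)
qed

lemma step_Psi:
  assumes "P \<in> M lam" "1 \<le> i" "i + 1 < N"
  shows "step i c (\<Psi> P) = \<Psi> (step (i + 1) c P)"
  by (simp only: step_def m_Psi_add m_Psi_mscale S_Psi[OF assms])

lemma step_Psi_Psi:
  assumes "P \<in> M lam" "2 \<le> N"
  shows "step (N - 1) c (\<Psi> (\<Psi> P)) = \<Psi> (\<Psi> (step 1 c P))"
  by (simp only: step_def m_Psi_add m_Psi_mscale S_Psi_Psi[OF assms])

end

section \<open>Vectors and their standardisation\<close>

lemma entry_swap:
  assumes "1 \<le> i" "i < length v" "1 \<le> j" "j \<le> length v"
  shows "entry (swap_entries v i) j = entry v (transpose i (i + 1) j)"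
  using assms by (auto simp: swap_entries_def transpose_def nth_list_update)

lemma length_swap [simp]: "length (swap_entries v i) = length v"
  by (simp add: swap_entries_def)

lemma entry_eqI:
  assumes "length v = length w" "\<And>j. 1 \<le> j \<Longrightarrow> j \<le> length v \<Longrightarrow> entry v j = entry w j"
  shows "v = w"
proof (rule nth_equalityI[OF assms(1)])
  fix k assume "k < length v"
  then show "v ! k = w ! k" using assms(2)[of "k + 1"] by simp
qed

lemma transpose_range:
  "1 \<le> i \<Longrightarrow> i < n \<Longrightarrow> 1 \<le> j \<Longrightarrow> j \<le> n \<Longrightarrow>
    1 \<le> transpose i (i + 1) j \<and> transpose i (i + 1) j \<le> (n :: nat)"
  by (auto simp: transpose_def)

lemma swap_swap [simp]:
  assumes "1 \<le> i" "i < length v"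
  shows "swap_entries (swap_entries v i) i = v"
proof (rule entry_eqI)
  fix j assume "1 \<le> j" "j \<le> length (swap_entries (swap_entries v i) i)"
  then show "entry (swap_entries (swap_entries v i) i) j = entry v j"
    using assms transpose_range[OF assms, of j] by (simp only: entry_swap length_swap transpose_involutory)
qed simp

lemma swap_commute:
  assumes "1 \<le> i" "i + 1 < j" "j < length v"
  shows "swap_entries (swap_entries v i) j = swap_entries (swap_entries v j) i"
  using assms by (intro nth_equalityI) (auto simp: swap_entries_def nth_list_update)

lemma swap_braid:
  assumes "1 \<le> i" "i + 1 < length v"
  shows "swap_entries (swap_entries (swap_entries v i) (i + 1)) i =
    swap_entries (swap_entries (swap_entries v (i + 1)) i) (i + 1)"
  using assms by (intro nth_equalityI) (auto simp: swap_entries_def nth_list_update)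

lemma mset_swap: "1 \<le> i \<Longrightarrow> i < length v \<Longrightarrow> mset (swap_entries v i) = mset v"
  unfolding swap_entries_def using Multiset.mset_swap[of i v "i - 1"] by simp

lemma sum_list_swap: "1 \<le> i \<Longrightarrow> i < length v \<Longrightarrow> sum_list (swap_entries v i) = sum_list v"
  by (metis mset_swap sum_mset_sum_list)

text \<open>The positions ranked no later than \<open>i\<close>. These sets are nested, so ranks are
  compared by inclusion.\<close>

definition before :: "nat list \<Rightarrow> nat \<Rightarrow> nat set" where
  "before v i = {j \<in> {1..length v}. entry v j > entry v i \<or> (entry v j = entry v i \<and> j \<le> i)}"

lemma sigma_before: "sigma v i = card (before v i)"
  by (simp add: sigma_def before_def)

lemma finite_before [simp]: "finite (before v i)"
  by (simp add: before_def)

lemma sigma_range: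
  assumes "1 \<le> i" "i \<le> length v"
  shows "1 \<le> sigma v i" "sigma v i \<le> length v"
proof -
  have "i \<in> before v i" using assms by (simp add: before_def)
  then have "before v i \<noteq> {}" by blast
  then show "1 \<le> sigma v i" unfolding sigma_before by (simp add: Suc_le_eq card_gt_0_iff)
  have "before v i \<subseteq> {1..length v}" by (auto simp: before_def)
  from card_mono[OF _ this] show "sigma v i \<le> length v" unfolding sigma_before by simp
qed

lemma sigma_inj:
  assumes "i \<in> {1..length v}" "j \<in> {1..length v}" "sigma v i = sigma v j"
  shows "i = j"
proof -
  have less: "sigma v i < sigma v j"
    if "i \<in> {1..length v}" "j \<in> {1..length v}" "entry v i > entry v j \<or> (entry v i = entry v j \<and> i < j)" for i j
  proof -
    have "before v i \<subset> before v j"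
    proof (rule psubsetI)
      show "before v i \<subseteq> before v j" using that by (auto simp: before_def)
      have "j \<in> before v j" "j \<notin> before v i" using that by (auto simp: before_def)
      then show "before v i \<noteq> before v j" by blast
    qed
    then show ?thesis unfolding sigma_before by (intro psubset_card_mono) simp
  qed
  show ?thesis
  proof (rule ccontr)
    assume "i \<noteq> j"
    then consider "entry v i > entry v j \<or> (entry v i = entry v j \<and> i < j)" |
      "entry v j > entry v i \<or> (entry v j = entry v i \<and> j < i)" by linarith
    then show False using less[OF assms(1,2)] less[OF assms(2,1)] assms(3) by cases auto
  qed
qed

text \<open>Unequal entries take their ranks along when exchanged. Equal entries do not: the vector
  stays the same, while ties are ranked by position.\<close>

lemma sigma_swap:
  assumes i: "1 \<le> i" "i < length v" and ne: "entry v i \<noteq> entry v (i + 1)" and j: "1 \<le> j" "j \<le> length v"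
  shows "sigma (swap_entries v i) j = sigma v (transpose i (i + 1) j)"
proof -
  let ?t = "transpose i (i + 1)"
  have "k \<in> before (swap_entries v i) j \<longleftrightarrow> ?t k \<in> before v (?t j)" for k
  proof (cases "k \<in> {1..length v}")
    case True
    have "?t k \<le> ?t j \<longleftrightarrow> k \<le> j" if "entry v (?t k) = entry v (?t j)"
      using that ne by (auto simp: transpose_def split: if_splits)
    moreover have "entry (swap_entries v i) k = entry v (?t k)" "entry (swap_entries v i) j = entry v (?t j)"
      using True i j by (intro entry_swap; simp)+
    moreover have "?t k \<in> {1..length v}" using True transpose_range[OF i, of k] by simp
    ultimately show ?thesis using True unfolding before_def length_swap mem_Collect_eq by auto
  next
    case False
    then have "?t k = k" using i by (auto simp: transpose_def)
    then show ?thesis using False by (auto simp: before_def)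
  qed
  then have "before (swap_entries v i) j = ?t ` before v (?t j)"
    by (intro set_eqI) (simp only: in_transpose_image_iff)
  then show ?thesis unfolding sigma_before by (simp add: card_image)
qed

lemma sigma_tie:
  assumes "1 \<le> i" "i < length v" "entry v i = entry v (i + 1)"
  shows "sigma v (i + 1) = sigma v i + 1"
proof -
  have "before v (i + 1) = insert (i + 1) (before v i)"
    using assms by (auto simp: before_def le_Suc_eq)
  moreover have "i + 1 \<notin> before v i" using assms by (simp add: before_def)
  ultimately show ?thesis unfolding sigma_before by simp
qed

text \<open>The moved entry keeps its rank: as first entry \<open>a\<close> it preceded all entries
  equal to \<open>a\<close> and followed those equal to \<open>a + 1\<close>, and as last entry
  \<open>a + 1\<close> it still does, because ties are ranked from left to right.\<close>

lemma sigma_rotate: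
  assumes j: "1 \<le> j" "j \<le> length u + 1"
  shows "sigma (u @ [a + 1]) j = sigma (a # u) (if j = length u + 1 then 1 else j + 1)"
proof -
  let ?n = "length u + 1"
  let ?f = "\<lambda>j. if j = ?n then 1 else j + 1"
  have e: "entry (u @ [a + 1]) k = (if k = ?n then a + 1 else entry (a # u) (?f k))"
    if "1 \<le> k" "k \<le> ?n" for k
    using that by (auto simp: nth_append nth_Cons')
  have "bij_betw ?f (before (u @ [a + 1]) j) (before (a # u) (?f j))"
    unfolding bij_betw_def
  proof
    show "inj_on ?f (before (u @ [a + 1]) j)" by (auto simp: inj_on_def before_def)
    show "?f ` before (u @ [a + 1]) j = before (a # u) (?f j)"
    proof (intro equalityI subsetI)
      fix x assume "x \<in> ?f ` before (u @ [a + 1]) j"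
      then obtain k where k: "k \<in> before (u @ [a + 1]) j" "x = ?f k" by blast
      have kr: "1 \<le> k" "k \<le> ?n" using k by (auto simp: before_def)
      show "x \<in> before (a # u) (?f j)"
        using k kr j e[OF kr] e[OF j] unfolding before_def
        by (auto split: if_splits)
    next
      fix x assume x: "x \<in> before (a # u) (?f j)"
      define k where "k = (if x = 1 then ?n else x - 1)"
      have kr: "1 \<le> k" "k \<le> ?n" and xk: "x = ?f k" using x by (auto simp: k_def before_def)
      have "k \<in> before (u @ [a + 1]) j"
        using x kr j e[OF kr] e[OF j] unfolding before_def xk
        by (auto split: if_splits)
      then show "x \<in> ?f ` before (u @ [a + 1]) j" using xk by blast
    qed
  qed
  then show ?thesis unfolding sigma_before by (rule bij_betw_same_card)
qed

section \<open>Spectral vectors\<close>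

lemma zeta_eq: "zeta lam (\<tau>, v) i = alpha * of_int (int (entry v i)) + of_int (CT lam \<tau> (sigma v i))"
  by (simp add: zeta_def)

lemma zeta_swap:
  assumes "1 \<le> i" "i < length v" "entry v i \<noteq> entry v (i + 1)" "1 \<le> j" "j \<le> length v"
  shows "zeta lam (\<tau>, swap_entries v i) j = zeta lam (\<tau>, v) (transpose i (i + 1) j)"
  unfolding zeta_eq entry_swap[OF assms(1,2,4,5)] sigma_swap[OF assms] ..

lemma zeta_rotate:
  assumes "1 \<le> j" "j \<le> length u"
  shows "zeta lam (\<tau>, u @ [a + 1]) j = zeta lam (\<tau>, a # u) (j + 1)"
proof -
  have "j - 1 < length u" using assms by simp
  then show ?thesis using assms sigma_rotate[of j u a] by (simp add: zeta_eq nth_append)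
qed

lemma zeta_rotate_last:
  "zeta lam (\<tau>, u @ [a + 1]) (length u + 1) = zeta lam (\<tau>, a # u) 1 + alpha"
  using sigma_rotate[of "length u + 1" u a] by (simp add: zeta_eq nth_append algebra_simps)

lemma zeta_diff:
  "zeta lam (\<tau>, v) i - zeta lam (\<tau>, v) j =
    alpha * of_int (int (entry v i) - int (entry v j)) +
    of_int (CT lam \<tau> (sigma v i) - CT lam \<tau> (sigma v j))"
  by (simp add: zeta_eq algebra_simps)

text \<open>Different entries leave a nonzero multiple of \<open>alpha\<close>. The integer shift
  serves the denominators \<open>D + 1\<close> and \<open>D - 1\<close> of the coefficients of the
  sums.\<close>

lemma zeta_diff_nonzero:
  assumes "entry v i \<noteq> entry v j"
  shows "zeta lam (\<tau>, v) i - zeta lam (\<tau>, v) j + of_int c \<noteq> 0"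
proof -
  have "zeta lam (\<tau>, v) i - zeta lam (\<tau>, v) j + of_int c = alpha * of_int (int (entry v i) - int (entry v j)) +
    of_int (CT lam \<tau> (sigma v i) - CT lam \<tau> (sigma v j) + c)"
    unfolding zeta_diff by simp
  moreover have "int (entry v i) - int (entry v j) \<noteq> 0" using assms by simp
  ultimately show ?thesis by (simp only: alpha_multiple_nonzero not_False_eq_True)
qed

lemma infinitesimal_zeta_diff:
  assumes "entry v i \<noteq> entry v j"
  shows "infinitesimal (1 / (zeta lam (\<tau>, v) i - zeta lam (\<tau>, v) j + of_int c))"
proof -
  have "zeta lam (\<tau>, v) i - zeta lam (\<tau>, v) j + of_int c = alpha * of_int (int (entry v i) - int (entry v j)) +
    of_int (CT lam \<tau> (sigma v i) - CT lam \<tau> (sigma v j) + c)"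
    unfolding zeta_diff by simp
  moreover have nz: "int (entry v i) - int (entry v j) \<noteq> 0" using assms by simp
  ultimately show ?thesis
    using infinitesimal_inverse_alpha[OF nz] by (simp only:)
qed

context shape begin

text \<open>The entries of \<open>v\<close> agree at a tie, so only the contents move: the two
  spectral entries change places just as under a swap of unequal entries.\<close>

lemma zeta_interchange:
  assumes "bijective \<tau>" "length v = N" "1 \<le> i" "i < N" "entry v i = entry v (i + 1)" "1 \<le> j" "j \<le> N"
  shows "zeta lam (interchange (sigma v i) \<tau>, v) j = zeta lam (\<tau>, v) (transpose i (i + 1) j)"
proof -
  let ?k = "sigma v i"
  have tie: "sigma v (i + 1) = ?k + 1" using sigma_tie assms by simp
  have k: "1 \<le> ?k" "?k + 1 \<le> N" using sigma_range[of i v] sigma_range[of "i + 1" v] tie assms by auto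
  have j: "1 \<le> sigma v j" "sigma v j \<le> N" using sigma_range[of j v] assms by auto
  have "transpose ?k (?k + 1) (sigma v j) = sigma v (transpose i (i + 1) j)"
  proof -
    consider "j = i" | "j = i + 1" | "j \<noteq> i" "j \<noteq> i + 1" by blast
    then show ?thesis
    proof cases
      case 3
      then have "sigma v j \<noteq> ?k" "sigma v j \<noteq> ?k + 1"
        unfolding tie[symmetric] using sigma_inj[of j v] assms by force+
      then show ?thesis using 3 by simp
    qed (use tie in simp_all)
  qed
  moreover have "entry v (transpose i (i + 1) j) = entry v j" using assms by (auto simp: transpose_def)
  ultimately show ?thesis unfolding zeta_eq using CT_interchange[of \<tau> ?k "sigma v j"] assms k j by simp
qed

end

section \<open>The vector-valued Jack polynomials as a recursive function\<close>

definition descent :: "nat list \<Rightarrow> nat \<Rightarrow> bool" where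
  "descent v i \<longleftrightarrow> 1 \<le> i \<and> i < length v \<and> entry v (i + 1) < entry v i"

definition weight :: "nat list \<Rightarrow> nat" where
  "weight v = (\<Sum>j\<in>{1..length v}. (length v - j) * entry v j)"

lemma entry_swap_simps:
  assumes "1 \<le> i" "i < length v"
  shows "entry (swap_entries v i) i = entry v (i + 1)" "entry (swap_entries v i) (i + 1) = entry v i"
    "1 \<le> j \<Longrightarrow> j \<noteq> i \<Longrightarrow> j \<noteq> i + 1 \<Longrightarrow> entry (swap_entries v i) j = entry v j"
  using assms by (auto simp: swap_entries_def nth_list_update)

lemma sum_split_pair:
  fixes f :: "nat \<Rightarrow> 'a :: comm_monoid_add"
  assumes "1 \<le> i" "i < n"
  shows "(\<Sum>j\<in>{1..n}. f j) = f i + f (i + 1) + (\<Sum>j\<in>{1..n} - {i, i + 1}. f j)"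
proof -
  let ?A = "{1..n} - {i, i + 1}"
  have "{1..n} = {i, i + 1} \<union> ?A" using assms by auto
  then have "(\<Sum>j\<in>{1..n}. f j) = (\<Sum>j\<in>{i, i + 1}. f j) + (\<Sum>j\<in>?A. f j)"
    by (metis sum.union_disjoint Diff_disjoint finite_Diff finite_atLeastAtMost finite.emptyI finite_insert)
  then show ?thesis by simp
qed

lemma weight_swap:
  assumes "descent v i"
  shows "weight (swap_entries v i) < weight v"
proof -
  have i: "1 \<le> i" "i < length v" "entry v (i + 1) < entry v i" using assms by (auto simp: descent_def)
  let ?n = "length v" and ?A = "{1..length v} - {i, i + 1}"
  note split = sum_split_pair[OF i(1,2)]
  define R where "R = (\<Sum>j\<in>?A. (?n - j) * entry v j)"
  have R': "(\<Sum>j\<in>?A. (?n - j) * entry (swap_entries v i) j) = R"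
    unfolding R_def using entry_swap_simps(3)[OF i(1,2)] by (intro sum.cong) auto
  have n: "?n - i = (?n - (i + 1)) + 1" using i by simp
  have "weight (swap_entries v i) = (?n - i) * entry v (i + 1) + (?n - (i + 1)) * entry v i + R"
    unfolding weight_def length_swap split R' entry_swap_simps[OF i(1,2)] ..
  moreover have "weight v = (?n - i) * entry v i + (?n - (i + 1)) * entry v (i + 1) + R"
    unfolding weight_def split R_def ..
  ultimately show ?thesis using i(3) unfolding n by (simp add: distrib_right del: One_nat_def)
qed

text \<open>Undoing a \<Psi>-edge lowers the degree. Undoing a swap keeps the degree and lowers
  \<open>weight\<close>, since the larger entry moves to the right.\<close>

definition smaller :: "(nat list \<times> nat list) set" where
  "smaller = measures [sum_list, weight]"

lemma wf_smaller: "wf smaller"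
  by (simp add: smaller_def)

lemma smaller_swap: "descent v i \<Longrightarrow> (swap_entries v i, v) \<in> smaller"
  using weight_swap[of v i] sum_list_swap[of i v] by (simp add: smaller_def descent_def)

lemma smaller_sum: "sum_list w < sum_list v \<Longrightarrow> (w, v) \<in> smaller"
  by (simp add: smaller_def)

context shape begin

definition par :: "filling \<Rightarrow> nat list \<Rightarrow> nat \<Rightarrow> scalar" where
  "par \<tau> v i = 1 / (zeta lam (\<tau>, v) i - zeta lam (\<tau>, v) (i + 1))"

text \<open>A canonical path: undo the leftmost descent; without descents the vector increases
  weakly, so unless it is zero its last entry is positive and a \<Psi>-edge can be undone. The
  tableau stays fixed along the path, so each \<open>\<tau>\<close> has its own start at the zero
  vector; edges that change the tableau are accounted for by \<open>tie_ok\<close>.\<close>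

function jack :: "filling \<Rightarrow> nat list \<Rightarrow> melem" where
  "jack \<tau> v =
    (if \<exists>i. descent v i
     then step (LEAST i. descent v i) (par \<tau> v (LEAST i. descent v i))
       (jack \<tau> (swap_entries v (LEAST i. descent v i)))
     else if v \<noteq> [] \<and> last v > 0 then \<Psi> (jack \<tau> ((last v - 1) # butlast v))
     else tensor 1 (single \<tau> 1))"
  by auto
termination
proof (relation "inv_image smaller snd", goal_cases)
  case 1
  show ?case by (simp add: wf_smaller)
next
  case (2 \<tau> v)
  then show ?case using smaller_swap[OF LeastI_ex[of "descent v"]] by simp
next
  case (3 \<tau> v)
  then have "v = butlast v @ [last v]" "0 < last v" by auto
  then have "sum_list v = sum_list (butlast v) + last v" by (metis add.right_neutral sum_list.Cons sum_list.Nil sum_list_append)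
  then have "sum_list ((last v - 1) # butlast v) < sum_list v" using \<open>0 < last v\<close> by simp
  then show ?case by (simp add: smaller_sum)
qed

declare jack.simps [simp del]

lemma jack_descent:
  "\<exists>i. descent v i \<Longrightarrow> jack \<tau> v = step (LEAST i. descent v i) (par \<tau> v (LEAST i. descent v i))
     (jack \<tau> (swap_entries v (LEAST i. descent v i)))"
  by (subst jack.simps) (rule if_P)

lemma jack_Psi:
  "\<not> (\<exists>i. descent v i) \<Longrightarrow> v \<noteq> [] \<and> last v > 0 \<Longrightarrow> jack \<tau> v = \<Psi> (jack \<tau> ((last v - 1) # butlast v))"
  by (subst jack.simps) (rule if_not_P[THEN trans, OF _ if_P])

lemma jack_base:
  "\<not> (\<exists>i. descent v i) \<Longrightarrow> \<not> (v \<noteq> [] \<and> last v > 0) \<Longrightarrow> jack \<tau> v = tensor 1 (single \<tau> 1)"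
  by (subst jack.simps) (rule if_not_P[THEN trans, OF _ if_not_P])

lemma M_jack:
  assumes "\<tau> \<in> RST lam" "length v = N"
  shows "jack \<tau> v \<in> M lam"
  using assms
proof (induction \<tau> v rule: jack.induct)
  case (1 \<tau> v)
  show ?case
  proof (cases "\<exists>i. descent v i")
    case True
    define i where "i = (LEAST i. descent v i)"
    have "descent v i" unfolding i_def using True by (rule LeastI_ex)
    then have i: "1 \<le> i" "i < N" using 1 by (auto simp: descent_def)
    have "jack \<tau> (swap_entries v i) \<in> M lam" using 1 True unfolding i_def by simp
    then show ?thesis using M_step[OF _ i] unfolding jack_descent[OF True] i_def by simp
  next
    case False
    show ?thesis
    proof (cases "v \<noteq> [] \<and> last v > 0")
      case True
      have "1 \<le> N" using True 1 by (cases v) auto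
      moreover from this have "jack \<tau> ((last v - 1) # butlast v) \<in> M lam" using 1 False True by simp
      ultimately show ?thesis unfolding jack_Psi[OF False True] by (simp add: M_Psi)
    next
      case noPsi: False
      have "tensor 1 (single \<tau> 1) \<in> M lam"
        unfolding M_iff using 1 by (auto simp: coef_tensor lookup_single lookup_one when_def split: if_splits)
      then show ?thesis unfolding jack_base[OF False noPsi] .
    qed
  qed
qed

text \<open>Quantifying over all tableaux leaves the vector as the only induction variable. Every
  descent is allowed here, not only the leftmost one.\<close>

definition swap_ok :: "nat list \<Rightarrow> bool" where
  "swap_ok v \<longleftrightarrow> (\<forall>\<tau>\<in>RST lam. \<forall>i. descent v i \<longrightarrow> jack \<tau> v = step i (par \<tau> v i) (jack \<tau> (swap_entries v i)))"

definition rotate_ok :: "nat list \<Rightarrow> bool" where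
  "rotate_ok v \<longleftrightarrow> (\<forall>\<tau>\<in>RST lam. \<forall>u a. v = u @ [a + 1] \<longrightarrow> jack \<tau> v = \<Psi> (jack \<tau> (a # u)))"

text \<open>Solved for the reflection, this is the action of s_k on \<open>\<tau>\<close> with
  \<open>k = sigma v i\<close>. If the content difference is 1 or -1, the right side is zero and the
  interchanged filling is not a tableau.\<close>

definition tie_ok :: "nat list \<Rightarrow> bool" where
  "tie_ok v \<longleftrightarrow> (\<forall>\<tau>\<in>RST lam. \<forall>i. 1 \<le> i \<and> i < N \<and> entry v i = entry v (i + 1) \<longrightarrow>
     step i (- (1 / of_int (CTdiff lam \<tau> (sigma v i)))) (jack \<tau> v) =
       mscale (swap_coeff (CTdiff lam \<tau> (sigma v i))) (jack (interchange (sigma v i) \<tau>) v))"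

section \<open>Independence of the chosen descent\<close>

lemma zeta_swap_simps:
  assumes "length v = N" "1 \<le> i" "i < N" "entry v i \<noteq> entry v (i + 1)"
  shows "zeta lam (\<tau>, swap_entries v i) i = zeta lam (\<tau>, v) (i + 1)"
    "zeta lam (\<tau>, swap_entries v i) (i + 1) = zeta lam (\<tau>, v) i"
    "1 \<le> j \<Longrightarrow> j \<le> N \<Longrightarrow> j \<noteq> i \<Longrightarrow> j \<noteq> i + 1 \<Longrightarrow> zeta lam (\<tau>, swap_entries v i) j = zeta lam (\<tau>, v) j"
    "sigma (swap_entries v i) i = sigma v (i + 1)"
    "sigma (swap_entries v i) (i + 1) = sigma v i"
    "1 \<le> j \<Longrightarrow> j \<le> N \<Longrightarrow> j \<noteq> i \<Longrightarrow> j \<noteq> i + 1 \<Longrightarrow> sigma (swap_entries v i) j = sigma v j"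
  using assms zeta_swap[of i v i lam \<tau>] zeta_swap[of i v "i + 1" lam \<tau>] zeta_swap[of i v j lam \<tau>]
    sigma_swap[of i v i] sigma_swap[of i v "i + 1"] sigma_swap[of i v j]
  by simp_all

lemma zeta_diff_ne:
  assumes "entry v i \<noteq> entry v j"
  shows "zeta lam (\<tau>, v) i \<noteq> zeta lam (\<tau>, v) j"
  using zeta_diff_nonzero[OF assms, of lam \<tau> 0] by auto

text \<open>Local confluence: two descents are joined at a common smaller vector, by commutation if
  they are far apart and by a Yang-Baxter hexagon if they are adjacent.\<close>

lemma swap_ok_induct:
  assumes v: "length v = N"
    and IH: "\<And>w. (w, v) \<in> smaller \<Longrightarrow> length w = N \<Longrightarrow> swap_ok w"
  shows "swap_ok v"
proof -
  have pair: "step i (par \<tau> v i) (jack \<tau> (swap_entries v i)) = step j (par \<tau> v j) (jack \<tau> (swap_entries v j))"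
    if \<tau>: "\<tau> \<in> RST lam" and di: "descent v i" and dj: "descent v j" and ij: "i < j" for \<tau> i j
  proof -
    have i: "1 \<le> i" "i < N" "entry v (i + 1) < entry v i" using di v by (auto simp: descent_def)
    have j: "1 \<le> j" "j < N" "entry v (j + 1) < entry v j" using dj v by (auto simp: descent_def)
    have ii: "1 \<le> i" "i < length v" and jj: "1 \<le> j" "j < length v" using i j v by auto
    define vi vj where "vi = swap_entries v i" and "vj = swap_entries v j"
    have li: "length vi = N" and lj: "length vj = N" by (simp_all add: vi_def vj_def v)
    have oki: "swap_ok vi" and okj: "swap_ok vj"
      unfolding vi_def vj_def by (intro IH smaller_swap di dj; simp add: v)+
    note zi = zeta_swap_simps[OF v i(1,2) less_imp_neq[OF i(3), symmetric], folded vi_def]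
    note zj = zeta_swap_simps[OF v j(1,2) less_imp_neq[OF j(3), symmetric], folded vj_def]
    note ei = entry_swap_simps[OF ii, folded vi_def]
    note ej = entry_swap_simps[OF jj, folded vj_def]
    consider "i + 1 < j" | "j = i + 1" using ij by linarith
    then show ?thesis
    proof cases
      case 1
      define w where "w = swap_entries vi j"
      have w: "w = swap_entries vj i" unfolding w_def vi_def vj_def using swap_commute[of i j v] 1 i j v by simp
      have "entry vi j = entry v j" "entry vi (j + 1) = entry v (j + 1)"
        using 1 by (intro ei(3); simp)+
      then have "descent vi j" using j li by (simp add: descent_def)
      moreover have "entry vj i = entry v i" "entry vj (i + 1) = entry v (i + 1)"
        using 1 i by (intro ej(3); simp)+
      then have "descent vj i" using i lj by (simp add: descent_def)
      moreover have "par \<tau> vi j = par \<tau> v j"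
        using zi(3)[of j \<tau>] zi(3)[of "j + 1" \<tau>] 1 j by (simp add: par_def)
      moreover have "par \<tau> vj i = par \<tau> v i"
        using zj(3)[of i \<tau>] zj(3)[of "i + 1" \<tau>] 1 i j by (simp add: par_def)
      ultimately have "jack \<tau> vi = step j (par \<tau> v j) (jack \<tau> w)" "jack \<tau> vj = step i (par \<tau> v i) (jack \<tau> w)"
        using oki okj \<tau> unfolding swap_ok_def w_def by (simp_all add: w[unfolded w_def])
      moreover have "jack \<tau> w \<in> M lam" by (intro M_jack \<tau>) (simp add: w_def li)
      ultimately show ?thesis
        unfolding vi_def[symmetric] vj_def[symmetric] using step_commute[of _ i j] 1 i j by simp
    next
      case 2
      \<comment> \<open>The three entries decrease strictly, and both paths lead down to
        \<open>w\<close>, where they are reversed. The parameters on the two paths are the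
        reciprocals of \<open>x - y\<close>, \<open>x - z\<close>, \<open>y - z\<close> in opposite
        orders.\<close>
      define x y z where "x = zeta lam (\<tau>, v) i" and "y = zeta lam (\<tau>, v) (i + 1)" and "z = zeta lam (\<tau>, v) (i + 2)"
      have i2: "i + 2 \<le> N" using 2 j by simp
      have ent: "entry v (i + 2) < entry v (i + 1)" using j(3) 2 by simp
      have ne: "x \<noteq> y" "y \<noteq> z" "x \<noteq> z"
        unfolding x_def y_def z_def using ent i by (intro zeta_diff_ne; simp)+
      define vij vji where "vij = swap_entries vi (i + 1)" and "vji = swap_entries vj i"
      have e_vi: "entry vi i = entry v (i + 1)" "entry vi (i + 1) = entry v i" "entry vi (i + 2) = entry v (i + 2)"
        using ei(1,2) ei(3)[of "i + 2"] by auto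
      have z_vi: "zeta lam (\<tau>, vi) i = y" "zeta lam (\<tau>, vi) (i + 1) = x" "zeta lam (\<tau>, vi) (i + 2) = z"
        using zi(1,2)[of \<tau>] zi(3)[of "i + 2" \<tau>] i2 by (auto simp: x_def y_def z_def)
      have e_vj: "entry vj i = entry v i" "entry vj (i + 1) = entry v (i + 2)" "entry vj (i + 2) = entry v (i + 1)"
        using ej(1,2) ej(3)[of i] i 2 by auto
      have z_vj: "zeta lam (\<tau>, vj) i = x" "zeta lam (\<tau>, vj) (i + 1) = z" "zeta lam (\<tau>, vj) (i + 2) = y"
        using zj(1,2)[of \<tau>] zj(3)[of i \<tau>] i i2 2 by (auto simp: x_def y_def z_def)
      have d_vi: "descent vi (i + 1)" using e_vi ent i i2 li by (simp add: descent_def)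
      have d_vj: "descent vj i" using e_vj ent i i2 lj by (simp add: descent_def)
      have lij: "length vij = N" "length vji = N" by (simp_all add: vij_def vji_def li lj)
      have sm: "(vij, v) \<in> smaller" "(vji, v) \<in> smaller"
        using smaller_swap[OF di] smaller_swap[OF dj] smaller_swap[OF d_vi] smaller_swap[OF d_vj]
        unfolding vij_def vji_def vi_def vj_def smaller_def by (auto dest: less_trans)
      have okij: "swap_ok vij" "swap_ok vji" using IH sm lij by auto
      have e_vij: "entry vij i = entry v (i + 1)" "entry vij (i + 1) = entry v (i + 2)"
        using entry_swap_simps(1)[of "i + 1" vi] entry_swap_simps(3)[of "i + 1" vi i] e_vi i i2 li
        by (auto simp: vij_def)
      have z_vij: "zeta lam (\<tau>, vij) i = y" "zeta lam (\<tau>, vij) (i + 1) = z"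
        using zeta_swap_simps(1)[OF li, of "i + 1" \<tau>] zeta_swap_simps(3)[OF li, of "i + 1" i \<tau>] z_vi e_vi ent i i2
        by (auto simp: vij_def)
      have e_vji: "entry vji (i + 1) = entry v i" "entry vji (i + 2) = entry v (i + 1)"
        using entry_swap_simps(2)[of i vj] entry_swap_simps(3)[of i vj "i + 2"] e_vj i i2 lj
        by (auto simp: vji_def)
      have z_vji: "zeta lam (\<tau>, vji) (i + 1) = x" "zeta lam (\<tau>, vji) (i + 2) = y"
        using zeta_swap_simps(2)[OF lj, of i \<tau>] zeta_swap_simps(3)[OF lj, of i "i + 2" \<tau>] z_vj e_vj ent i i2
        by (auto simp: vji_def)
      have d_vij: "descent vij i" using e_vij ent i lij by (simp add: descent_def)
      have d_vji: "descent vji (i + 1)" using e_vji i i2 lij by (simp add: descent_def)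
      define w where "w = swap_entries vij i"
      have w: "w = swap_entries vji (i + 1)"
        unfolding w_def vij_def vji_def vi_def vj_def 2 using swap_braid[of i v] i i2 v by simp
      have "jack \<tau> vi = step (i + 1) (par \<tau> vi (i + 1)) (jack \<tau> vij)"
        using oki \<tau> d_vi unfolding swap_ok_def vij_def by blast
      also have "jack \<tau> vij = step i (par \<tau> vij i) (jack \<tau> w)"
        using okij \<tau> d_vij unfolding swap_ok_def w_def by blast
      finally have 3: "jack \<tau> vi = step (i + 1) (1 / (x - z)) (step i (1 / (y - z)) (jack \<tau> w))"
        using z_vi z_vij by (simp add: par_def)
      have "jack \<tau> vj = step i (par \<tau> vj i) (jack \<tau> vji)"
        using okj \<tau> d_vj unfolding swap_ok_def vji_def by blast
      also have "jack \<tau> vji = step (i + 1) (par \<tau> vji (i + 1)) (jack \<tau> w)"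
        using okij \<tau> d_vji unfolding swap_ok_def w by blast
      finally have 4: "jack \<tau> vj = step i (1 / (x - z)) (step (i + 1) (1 / (x - y)) (jack \<tau> w))"
        using z_vj z_vji by (simp add: par_def)
      have wM: "jack \<tau> w \<in> M lam" by (intro M_jack \<tau>) (simp add: w_def lij)
      have rel: "1 / (y - z) * (1 / (x - y)) = 1 / (x - z) * (1 / (y - z) + 1 / (x - y))"
        using ne by (simp add: field_simps)
      have "par \<tau> v i = 1 / (x - y)" "par \<tau> v j = 1 / (y - z)"
        by (simp_all add: par_def x_def y_def z_def 2)
      then show ?thesis
        unfolding vi_def[symmetric] vj_def[symmetric] 3 4
        using yang_baxter[OF wM, of i, OF _ _ rel] i i2 2 by simp
    qed
  qed
  show ?thesis unfolding swap_ok_def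
  proof (intro ballI allI impI)
    fix \<tau> i assume \<tau>: "\<tau> \<in> RST lam" and di: "descent v i"
    define k where "k = (LEAST i. descent v i)"
    have dk: "descent v k" unfolding k_def using di by (rule LeastI)
    have "jack \<tau> v = step k (par \<tau> v k) (jack \<tau> (swap_entries v k))"
      using di unfolding k_def by (intro jack_descent) blast
    also have "\<dots> = step i (par \<tau> v i) (jack \<tau> (swap_entries v i))"
    proof (cases "k = i")
      case False
      then have "k < i" unfolding k_def using di Least_le[of "descent v" i] by simp
      then show ?thesis using pair \<tau> dk di by blast
    qed simp
    finally show "jack \<tau> v = step i (par \<tau> v i) (jack \<tau> (swap_entries v i))" .
  qed
qed

lemma swap_ok_all: "length v = N \<Longrightarrow> swap_ok v"
  by (induction v rule: wf_induct_rule[OF wf_smaller]) (rule swap_ok_induct)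

lemma jack_swap:
  "\<tau> \<in> RST lam \<Longrightarrow> length v = N \<Longrightarrow> descent v i \<Longrightarrow>
    jack \<tau> v = step i (par \<tau> v i) (jack \<tau> (swap_entries v i))"
  using swap_ok_all unfolding swap_ok_def by blast

section \<open>Recursion along the affine edges\<close>

lemma par_rotate:
  assumes "1 \<le> i" "i + 1 \<le> length u"
  shows "par \<tau> (u @ [a + 1]) i = par \<tau> (a # u) (i + 1)"
  using zeta_rotate[of i u lam \<tau> a] zeta_rotate[of "i + 1" u lam \<tau> a] assms by (simp add: par_def)

text \<open>Both spectral entries gain \<open>alpha\<close> on their way to the end, so their
  difference survives.\<close>

lemma par_rotate2:
  "par \<tau> (u @ [b + 1, a + 1]) (length u + 1) = par \<tau> (b # a # u) 1"
proof -
  have "zeta lam (\<tau>, (u @ [b + 1]) @ [a + 1]) (length u + 1) = zeta lam (\<tau>, a # u @ [b + 1]) (length u + 2)"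
    using zeta_rotate[of "length u + 1" "u @ [b + 1]"] by simp
  also have "\<dots> = zeta lam (\<tau>, (a # u) @ [b + 1]) (length (a # u) + 1)" by simp
  also have "\<dots> = zeta lam (\<tau>, b # a # u) 1 + alpha" by (rule zeta_rotate_last)
  finally have 1: "zeta lam (\<tau>, (u @ [b + 1]) @ [a + 1]) (length u + 1) = zeta lam (\<tau>, b # a # u) 1 + alpha" .
  have "zeta lam (\<tau>, (u @ [b + 1]) @ [a + 1]) (length (u @ [b + 1]) + 1) = zeta lam (\<tau>, a # u @ [b + 1]) 1 + alpha"
    by (rule zeta_rotate_last)
  also have "zeta lam (\<tau>, a # u @ [b + 1]) 1 = zeta lam (\<tau>, b # a # u) 2"
    using zeta_rotate[of 1 "a # u" lam \<tau> b] by (simp add: numeral_2_eq_2)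
  finally have 2: "zeta lam (\<tau>, (u @ [b + 1]) @ [a + 1]) (length u + 2) = zeta lam (\<tau>, b # a # u) 2 + alpha" by simp
  show ?thesis unfolding par_def using 1 2 by (simp add: numeral_2_eq_2)
qed

text \<open>Without descents this is the defining equation of \<open>jack\<close>. Otherwise a
  descent is undone and its step is moved through \<Psi>.\<close>

lemma rotate_ok_induct:
  assumes v: "length v = N"
    and IH: "\<And>w. (w, v) \<in> smaller \<Longrightarrow> length w = N \<Longrightarrow> rotate_ok w"
  shows "rotate_ok v"
  unfolding rotate_ok_def
proof (intro ballI allI impI)
  fix \<tau> u a assume \<tau>: "\<tau> \<in> RST lam" and va: "v = u @ [a + 1]"
  have lu: "length u + 1 = N" using v va by simp
  show "jack \<tau> v = \<Psi> (jack \<tau> (a # u))"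
  proof (cases "\<exists>i. descent v i")
    case False
    then show ?thesis using jack_Psi[of v \<tau>] by (simp add: va)
  next
    case True
    then obtain i where di: "descent v i" by blast
    have i: "1 \<le> i" "i < N" using di v by (auto simp: descent_def)
    note jv = jack_swap[OF \<tau> v di]
    show ?thesis
    proof (cases "i + 1 < N")
      case True
      have sw: "swap_entries v i = swap_entries u i @ [a + 1]"
      proof -
        have "i - 1 < length u" "i < length u" using True i lu by auto
        then show ?thesis unfolding va swap_entries_def by (simp add: nth_append list_update_append)
      qed
      have sw': "swap_entries (a # u) (i + 1) = a # swap_entries u i"
        unfolding swap_entries_def using i by (cases i) auto
      have "rotate_ok (swap_entries v i)" using IH smaller_swap[OF di] v by simp
      then have 1: "jack \<tau> (swap_entries v i) = \<Psi> (jack \<tau> (a # swap_entries u i))"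
        using \<tau> unfolding rotate_ok_def sw by blast
      have "descent (a # u) (i + 1)"
        using di True i lu unfolding descent_def va by (cases i) (auto simp: nth_append)
      then have 2: "jack \<tau> (a # u) = step (i + 1) (par \<tau> (a # u) (i + 1)) (jack \<tau> (a # swap_entries u i))"
        using jack_swap[OF \<tau>, of "a # u" "i + 1"] lu unfolding sw' by simp
      have m: "jack \<tau> (a # swap_entries u i) \<in> M lam" using lu by (intro M_jack \<tau>) simp
      have "par \<tau> v i = par \<tau> (a # u) (i + 1)"
        unfolding va using par_rotate i True lu by simp
      then show ?thesis unfolding jv 1 2 using step_Psi[OF m i(1) True] by simp
    next
      case False
      \<comment> \<open>The descent occupies the last two positions. Its left entry exceeds
        \<open>a + 1\<close>, so it is positive as well and \<Psi> can be undone twice; the step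
        passes both as a step at index 1.\<close>
      then have iN: "i = N - 1" "2 \<le> N" using i by auto
      then have "u \<noteq> []" using lu by auto
      then obtain u' b' where u: "u = u' @ [b']" by (metis append_butlast_last_id)
      have i': "i = length u' + 1" using iN lu u by simp
      have "a + 1 < b'" using di unfolding descent_def va u i' by (simp add: nth_append)
      then obtain b where b: "b' = b + 1" "a < b" by (metis Suc_eq_plus1 add_less_cancel_right less_imp_Suc_add add_Suc_right)
      have v2: "v = u' @ [b + 1, a + 1]" by (simp add: va u b)
      have sw: "swap_entries v i = (u' @ [a + 1]) @ [b + 1]"
        unfolding v2 i' swap_entries_def by (simp add: nth_append list_update_append)
      have l: "length u' + 2 = N" using lu u by simp
      have "rotate_ok (swap_entries v i)" using IH smaller_swap[OF di] v by simp
      then have 1: "jack \<tau> (swap_entries v i) = \<Psi> (jack \<tau> (b # u' @ [a + 1]))"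
        using \<tau> unfolding rotate_ok_def sw by blast
      have "rotate_ok ((b # u') @ [a + 1])"
        using l by (intro IH smaller_sum) (auto simp: v2)
      then have 2: "jack \<tau> (b # u' @ [a + 1]) = \<Psi> (jack \<tau> (a # b # u'))"
        using \<tau> unfolding rotate_ok_def by (metis append_Cons)
      have "rotate_ok ((a # u') @ [b + 1])"
        using l by (intro IH smaller_sum) (auto simp: v2)
      then have 3: "jack \<tau> (a # u) = \<Psi> (jack \<tau> (b # a # u'))"
        using \<tau> unfolding rotate_ok_def u b by (metis append_Cons)
      have "descent (b # a # u') 1" using b by (simp add: descent_def)
      moreover have "swap_entries (b # a # u') 1 = a # b # u'" by (simp add: swap_entries_def)
      ultimately have 4: "jack \<tau> (b # a # u') = step 1 (par \<tau> (b # a # u') 1) (jack \<tau> (a # b # u'))"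
        using jack_swap[OF \<tau>, of "b # a # u'" 1] l by simp
      have m: "jack \<tau> (a # b # u') \<in> M lam" using l by (intro M_jack \<tau>) simp
      have "par \<tau> v i = par \<tau> (b # a # u') 1" unfolding v2 i' by (rule par_rotate2)
      then show ?thesis unfolding jv 1 2 3 4 using step_Psi_Psi[OF m iN(2)] iN by simp
    qed
  qed
qed

lemma rotate_ok_all: "length v = N \<Longrightarrow> rotate_ok v"
  by (induction v rule: wf_induct_rule[OF wf_smaller]) (rule rotate_ok_induct)

lemma jack_rotate:
  "\<tau> \<in> RST lam \<Longrightarrow> length u + 1 = N \<Longrightarrow> jack \<tau> (u @ [a + 1]) = \<Psi> (jack \<tau> (a # u))"
  using rotate_ok_all[of "u @ [a + 1]"] unfolding rotate_ok_def by simp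

end

section \<open>Ties between adjacent entries\<close>

lemma no_descent_zero:
  assumes "\<And>i. \<not> descent v i" "v = [] \<or> last v = 0"
  shows "v = replicate (length v) 0"
proof -
  have "v ! j \<le> v ! (length v - 1)" if "j < length v" for j
  proof -
    have "v ! j \<le> v ! (j + k)" if "j + k < length v" for k
      using that
    proof (induction k)
      case (Suc k)
      have "v ! (j + k) \<le> v ! (j + Suc k)"
        using assms(1)[of "j + k + 1"] Suc.prems by (simp add: descent_def not_less)
      then show ?case using Suc by simp
    qed simp
    from this[of "length v - 1 - j"] show ?thesis using that by simp
  qed
  moreover have "v ! (length v - 1) = 0" if "v \<noteq> []" using that assms(2) by (simp add: last_conv_nth)
  ultimately have "v ! j = 0" if "j < length v" for j using that by (cases "v = []") fastforce+
  then show ?thesis by (intro nth_equalityI) auto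
qed

lemma sigma_replicate: "1 \<le> i \<Longrightarrow> i \<le> n \<Longrightarrow> sigma (replicate n a) i = i"
proof -
  assume i: "1 \<le> i" "i \<le> n"
  have "j - Suc 0 < n" if "j \<le> i" for j using that i by simp
  then have "before (replicate n a) i = {1..i}" using i by (auto simp: before_def)
  then show ?thesis by (simp add: sigma_before)
qed

text \<open>The condition \<open>rel\<close> of \<open>yang_baxter\<close> as it occurs at a tie:
  \<open>A\<close> and \<open>C\<close> are the spectral differences of the two tied positions to a
  third one, and \<open>A - C\<close> is up to sign a content difference.\<close>

lemma partial_fractions:
  fixes A C :: "'a :: field"
  assumes "A \<noteq> 0" "C \<noteq> 0" "A - C \<noteq> 0"
  shows "1 / A * - (1 / (A - C)) = 1 / C * (1 / A + - (1 / (A - C)))"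
proof -
  have "1 / A + - (1 / (A - C)) = - (C / (A * (A - C)))"
    using assms by (simp add: divide_simps)
  then show ?thesis using assms by simp
qed

context shape begin

lemma S_tensor_one:
  "S i (tensor 1 (single \<tau> 1)) =
    mscale (1 / of_int (CTdiff lam \<tau> i)) (tensor 1 (single \<tau> 1)) +
    mscale (swap_coeff (CTdiff lam \<tau> i)) (tensor 1 (single (interchange i \<tau>) 1))"
proof (rule melem_eqI)
  fix \<rho> m
  have "exp_swap i m = 0 \<longleftrightarrow> m = 0"
    by (metis exp_swap_involutory exp_swap_def inj_transpose map_key_zero)
  then show "coef (S i (tensor 1 (single \<tau> 1))) \<rho> m =
    coef (mscale (1 / of_int (CTdiff lam \<tau> i)) (tensor 1 (single \<tau> 1)) +
      mscale (swap_coeff (CTdiff lam \<tau> i)) (tensor 1 (single (interchange i \<tau>) 1))) \<rho> m"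
    unfolding coef_m_refl coef_add coef_mscale coef_tensor
    by (auto simp: lookup_single lookup_one when_def interchange_eq_iff)
qed

lemma jack_zero: "jack \<tau> (replicate n 0) = tensor 1 (single \<tau> 1)"
proof -
  have "\<not> descent (replicate n 0) i" for i
    by (auto simp: descent_def)
  moreover have "\<not> (replicate n (0::nat) \<noteq> [] \<and> last (replicate n (0::nat)) > 0)"
    by (cases "n = 0") simp_all
  ultimately show ?thesis by (intro jack_base) blast+
qed

lemma step_eqI: "S i P = mscale b P + Q \<Longrightarrow> step i (- b) P = Q"
  by (rule melem_eqI) (simp add: step_def)

lemma step_far_step:
  assumes "P \<in> M lam" "1 \<le> i" "i < N" "1 \<le> j" "j < N" "i + 1 < j \<or> j + 1 < i"
  shows "step i c (step j d P) = step j d (step i c P)"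
  using assms step_commute[of P i j c d] step_commute[of P j i d c] by auto

lemma tie_rel:
  assumes v: "length v = N" and \<tau>: "\<tau> \<in> RST lam" and i: "1 \<le> i" "i < N" "entry v i = entry v (i + 1)"
  shows "1 \<le> sigma v i" "sigma v i < N" "sigma v (i + 1) = sigma v i + 1"
    "zeta lam (\<tau>, v) i - zeta lam (\<tau>, v) (i + 1) = of_int (CTdiff lam \<tau> (sigma v i))"
proof -
  show s: "sigma v (i + 1) = sigma v i + 1" using sigma_tie i v by simp
  then show "1 \<le> sigma v i" "sigma v i < N" using sigma_range[of i v] sigma_range[of "i + 1" v] i v by auto
  show "zeta lam (\<tau>, v) i - zeta lam (\<tau>, v) (i + 1) = of_int (CTdiff lam \<tau> (sigma v i))"
    unfolding zeta_diff s i(3) by simp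
qed

text \<open>Undoing \<Psi> moves the tie one place to the right and keeps its labels. A tie at the
  last two positions is followed through two applications and reappears at the front.\<close>

lemma tie_ok_rotate:
  assumes v: "length v = N" and va: "v = u @ [a + 1]"
    and IH: "\<And>w. (w, v) \<in> smaller \<Longrightarrow> length w = N \<Longrightarrow> tie_ok w"
  shows "tie_ok v"
  unfolding tie_ok_def
proof (intro ballI allI impI)
  fix \<tau> i assume \<tau>: "\<tau> \<in> RST lam" and "1 \<le> i \<and> i < N \<and> entry v i = entry v (i + 1)"
  then have i: "1 \<le> i" "i < N" "entry v i = entry v (i + 1)" by auto
  have lu: "length u + 1 = N" using v va by simp
  define k where "k = sigma v i"
  define d where "d = CTdiff lam \<tau> k"
  define \<tau>' where "\<tau>' = interchange k \<tau>"
  have k: "1 \<le> k" "k < N" using tie_rel[OF v \<tau> i] by (simp_all add: k_def)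
  \<comment> \<open>The interchanged filling is a tableau unless its term is multiplied by
    zero.\<close>
  have R: "\<tau>' \<in> RST lam" if "swap_coeff d \<noteq> 0"
    unfolding \<tau>'_def using swap_coeff_RST[OF \<tau> k] that by (simp add: d_def)
  have "step i (- (1 / of_int d)) (jack \<tau> v) = mscale (swap_coeff d) (jack \<tau>' v)"
  proof (cases "i + 1 < N")
    case True
    let ?w = "a # u"
    have lw: "length ?w = N" using lu by simp
    have t: "entry ?w (i + 1) = entry ?w (i + 1 + 1)"
      using i True lu unfolding va by (cases i) (auto simp: nth_append)
    have s: "sigma ?w (i + 1) = k"
      unfolding k_def va using sigma_rotate[of i u a] i True lu by simp
    have ok: "tie_ok ?w" using lw by (intro IH smaller_sum) (simp_all add: va)
    have 1: "step (i + 1) (- (1 / of_int d)) (jack \<tau> ?w) = mscale (swap_coeff d) (jack \<tau>' ?w)"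
      using ok \<tau> i True t unfolding tie_ok_def d_def \<tau>'_def s[symmetric] by simp
    have m: "jack \<tau> ?w \<in> M lam" using lw \<tau> by (rule M_jack[rotated])
    have "step i (- (1 / of_int d)) (jack \<tau> v) = \<Psi> (mscale (swap_coeff d) (jack \<tau>' ?w))"
      unfolding va jack_rotate[OF \<tau> lu] step_Psi[OF m i(1) True] 1 ..
    also have "\<dots> = mscale (swap_coeff d) (jack \<tau>' v)"
      using R jack_rotate[OF _ lu, of \<tau>' a] unfolding m_Psi_mscale va
      by (cases "swap_coeff d = 0") simp_all
    finally show ?thesis .
  next
    case False
    then have iN: "i = N - 1" "2 \<le> N" using i by auto
    then have "u \<noteq> []" using lu by auto
    then obtain u' b where u: "u = u' @ [b]" by (metis append_butlast_last_id)
    have i': "i = length u' + 1" using iN lu u by simp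
    have b: "b = a + 1" using i(3) unfolding va u i' by (simp add: nth_append)
    have v2: "v = (u' @ [a + 1]) @ [a + 1]" by (simp add: va u b)
    let ?w = "a # a # u'"
    have l: "length (u' @ [a + 1]) + 1 = N" "length (a # u') + 1 = N" "length ?w = N" using lu u by auto
    have s: "sigma ?w 1 = k"
    proof -
      have "k = sigma (a # u' @ [a + 1]) (length u' + 2)"
        unfolding k_def v2 i' using sigma_rotate[of "length u' + 1" "u' @ [a + 1]" a] by simp
      also have "\<dots> = sigma ((a # u') @ [a + 1]) (length (a # u') + 1)" by simp
      also have "\<dots> = sigma ?w 1" using sigma_rotate[of "length (a # u') + 1" "a # u'" a] by simp
      finally show ?thesis ..
    qed
    have ok: "tie_ok ?w" using l by (intro IH smaller_sum) (simp_all add: v2)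
    have "entry ?w 1 = entry ?w (1 + 1)" by simp
    then have 1: "step 1 (- (1 / of_int d)) (jack \<tau> ?w) = mscale (swap_coeff d) (jack \<tau>' ?w)"
      using ok \<tau> iN unfolding tie_ok_def d_def \<tau>'_def s[symmetric] by simp
    have rr: "jack \<rho> v = \<Psi> (\<Psi> (jack \<rho> ?w))" if "\<rho> \<in> RST lam" for \<rho>
      unfolding v2 jack_rotate[OF that l(1)] using jack_rotate[OF that l(2), of a] by simp
    have m: "jack \<tau> ?w \<in> M lam" using l(3) \<tau> by (rule M_jack[rotated])
    have "step i (- (1 / of_int d)) (jack \<tau> v) = \<Psi> (\<Psi> (mscale (swap_coeff d) (jack \<tau>' ?w)))"
      unfolding rr[OF \<tau>] iN(1) step_Psi_Psi[OF m iN(2)] 1 ..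
    also have "\<dots> = mscale (swap_coeff d) (jack \<tau>' v)"
      using R rr[of \<tau>'] unfolding m_Psi_mscale by (cases "swap_coeff d = 0") simp_all
    finally show ?thesis .
  qed
  then show "step i (- (1 / of_int (CTdiff lam \<tau> (sigma v i)))) (jack \<tau> v) =
      mscale (swap_coeff (CTdiff lam \<tau> (sigma v i))) (jack (interchange (sigma v i) \<tau>) v)"
    unfolding d_def k_def \<tau>'_def .
qed

text \<open>Beside the tie, two steps carry the third entry past both tied ones. The Yang-Baxter
  equation moves the step with parameter \<open>-1/d\<close> to the innermost place and exchanges
  the two other parameters; exchanged, they are those of \<open>\<tau>'\<close>, whose spectral
  vector is that of \<open>\<tau>\<close> with the tied entries swapped.\<close>

lemma tie_ok_descent:
  assumes v: "length v = N" and dj: "descent v j"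
    and IH: "\<And>w. (w, v) \<in> smaller \<Longrightarrow> length w = N \<Longrightarrow> tie_ok w"
  shows "tie_ok v"
  unfolding tie_ok_def
proof (intro ballI allI impI)
  fix \<tau> i assume \<tau>: "\<tau> \<in> RST lam" and "1 \<le> i \<and> i < N \<and> entry v i = entry v (i + 1)"
  then have i: "1 \<le> i" "i < N" "entry v i = entry v (i + 1)" by auto
  have j: "1 \<le> j" "j < N" "entry v (j + 1) < entry v j" using dj v by (auto simp: descent_def)
  have jj: "1 \<le> j" "j < length v" using j v by auto
  define k where "k = sigma v i"
  define d where "d = CTdiff lam \<tau> k"
  define \<tau>' where "\<tau>' = interchange k \<tau>"
  note tr = tie_rel[OF v \<tau> i, folded k_def, folded d_def]
  have d0: "d \<noteq> 0" unfolding d_def using CTdiff_nonzero[OF \<tau> tr(1,2)] .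
  have R: "\<tau>' \<in> RST lam" if "swap_coeff d \<noteq> 0"
    unfolding \<tau>'_def using swap_coeff_RST[OF \<tau> tr(1,2)] that by (simp add: d_def)
  have zt': "zeta lam (\<tau>', v) l = zeta lam (\<tau>, v) (transpose i (i + 1) l)" if "1 \<le> l" "l \<le> N" for l
    unfolding \<tau>'_def k_def using zeta_interchange[OF RST_bijective[OF \<tau>] v i that] .
  define vj where "vj = swap_entries v j"
  have lj: "length vj = N" by (simp add: vj_def v)
  note zj = zeta_swap_simps[OF v j(1,2) less_imp_neq[OF j(3), symmetric], folded vj_def]
  note ej = entry_swap_simps[OF jj, folded vj_def]
  have sj: "(vj, v) \<in> smaller" unfolding vj_def by (rule smaller_swap[OF dj])
  have jv: "jack \<rho> v = step j (par \<rho> v j) (jack \<rho> vj)" if "\<rho> \<in> RST lam" for \<rho>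
    unfolding vj_def by (rule jack_swap[OF that v dj])
  have "i \<noteq> j" using i j by auto
  then consider "i + 1 < j \<or> j + 1 < i" | "j = i + 1" | "i = j + 1" by linarith
  then have "step i (- (1 / of_int d)) (jack \<tau> v) = mscale (swap_coeff d) (jack \<tau>' v)"
  proof cases
    case 1
    have e: "entry vj i = entry vj (i + 1)"
      using ej(3)[of i] ej(3)[of "i + 1"] 1 i by auto
    have s: "sigma vj i = k" unfolding k_def using zj(6)[of i] 1 i by auto
    have ok: "tie_ok vj" using sj lj by (rule IH)
    have eq: "step i (- (1 / of_int d)) (jack \<tau> vj) = mscale (swap_coeff d) (jack \<tau>' vj)"
      using ok \<tau> i e unfolding tie_ok_def d_def \<tau>'_def s[symmetric] by simp
    have p: "par \<tau>' v j = par \<tau> v j"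
      using zt'[of j] zt'[of "j + 1"] 1 j by (auto simp: par_def)
    have m: "jack \<tau> vj \<in> M lam" using lj \<tau> by (rule M_jack[rotated])
    have "step i (- (1 / of_int d)) (jack \<tau> v) = step j (par \<tau> v j) (mscale (swap_coeff d) (jack \<tau>' vj))"
      unfolding jv[OF \<tau>] step_far_step[OF m i(1,2) j(1,2) 1] eq ..
    also have "\<dots> = mscale (swap_coeff d) (jack \<tau>' v)"
      using R jv[of \<tau>'] p unfolding step_mscale by (cases "swap_coeff d = 0") simp_all
    finally show ?thesis .
  next
    case 2
    \<comment> \<open>The smaller third entry moves to the left of the tied pair, so the tie sits at
      \<open>i + 1\<close> in \<open>w\<close>.\<close>
    define x y z where "x = zeta lam (\<tau>, v) i" and "y = zeta lam (\<tau>, v) (i + 1)" and "z = zeta lam (\<tau>, v) (i + 2)"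
    have i2: "i + 2 \<le> N" using 2 j by simp
    have ent: "entry v (i + 2) < entry v (i + 1)" using j(3) 2 by simp
    have xy: "x - y = of_int d" using tr(4) by (simp add: x_def y_def)
    have "x - y \<noteq> 0" unfolding xy using d0 by simp
    moreover have "y \<noteq> z" "x \<noteq> z"
      unfolding x_def y_def z_def using ent i(3) by (intro zeta_diff_ne; simp)+
    ultimately have ne: "x \<noteq> y" "y \<noteq> z" "x \<noteq> z" by auto
    have z': "zeta lam (\<tau>', v) i = y" "zeta lam (\<tau>', v) (i + 1) = x" "zeta lam (\<tau>', v) (i + 2) = z"
      using zt'[of i] zt'[of "i + 1"] zt'[of "i + 2"] i i2 by (auto simp: x_def y_def z_def)
    have e_vj: "entry vj i = entry v i" "entry vj (i + 1) = entry v (i + 2)" "entry vj (i + 2) = entry v (i + 1)"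
      using ej(1,2) ej(3)[of i] i 2 by auto
    define w where "w = swap_entries vj i"
    have lw: "length w = N" by (simp add: w_def lj)
    have di: "descent vj i" using e_vj ent i lj by (simp add: descent_def)
    have ne_vj: "entry vj i \<noteq> entry vj (i + 1)" using e_vj ent i(3) by simp
    note zw = zeta_swap_simps[OF lj i(1,2) ne_vj, folded w_def]
    have ew: "entry w (i + 1) = entry w (i + 2)"
      using entry_swap_simps(2)[of i vj] entry_swap_simps(3)[of i vj "i + 2"] e_vj i i2 lj
      by (auto simp: w_def)
    have s: "sigma w (i + 1) = k"
      unfolding k_def using zw(5) zj(6)[of i] i 2 by simp
    have sw: "(w, v) \<in> smaller"
      using sj smaller_swap[OF di] unfolding w_def smaller_def by (auto dest: less_trans)
    have ok: "tie_ok w" using sw lw by (rule IH)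
    have eq: "step (i + 1) (- (1 / of_int d)) (jack \<tau> w) = mscale (swap_coeff d) (jack \<tau>' w)"
      using ok \<tau> i i2 ew unfolding tie_ok_def d_def \<tau>'_def s[symmetric] by simp
    have pj: "par \<rho> vj i = 1 / (zeta lam (\<rho>, v) i - zeta lam (\<rho>, v) (i + 2))" for \<rho>
      using zj(1)[of \<rho>] zj(3)[of i \<rho>] i 2 by (simp add: par_def)
    have jv2: "jack \<rho> v = step (i + 1) (1 / (zeta lam (\<rho>, v) (i + 1) - zeta lam (\<rho>, v) (i + 2)))
        (step i (1 / (zeta lam (\<rho>, v) i - zeta lam (\<rho>, v) (i + 2))) (jack \<rho> w))" if "\<rho> \<in> RST lam" for \<rho>
      using jv[OF that] jack_swap[OF that lj di] unfolding pj w_def[symmetric] 2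
      by (simp add: par_def)
    have m: "jack \<tau> w \<in> M lam" using lw \<tau> by (rule M_jack[rotated])
    have rel: "1 / (x - z) * - (1 / of_int d) = 1 / (y - z) * (1 / (x - z) + - (1 / of_int d))"
      unfolding xy[symmetric] using partial_fractions[of "x - z" "y - z"] ne by simp
    have "step i (- (1 / of_int d)) (jack \<tau> v) =
        step (i + 1) (1 / (x - z)) (step i (1 / (y - z)) (mscale (swap_coeff d) (jack \<tau>' w)))"
      unfolding jv2[OF \<tau>] x_def[symmetric] y_def[symmetric] z_def[symmetric]
      using yang_baxter[OF m i(1) _ rel] i2 eq by simp
    also have "\<dots> = mscale (swap_coeff d) (jack \<tau>' v)"
      using R jv2[of \<tau>'] unfolding step_mscale z' by (cases "swap_coeff d = 0") simp_all
    finally show ?thesis .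
  next
    case 3
    \<comment> \<open>The mirror image: the larger entry moves to the right of the tied pair, so the
      tie sits at \<open>j\<close> in \<open>w\<close>.\<close>
    define x y z where "x = zeta lam (\<tau>, v) i" and "y = zeta lam (\<tau>, v) (i + 1)" and "z = zeta lam (\<tau>, v) j"
    have ent: "entry v i < entry v j" using j(3) 3 by simp
    have xy: "x - y = of_int d" using tr(4) by (simp add: x_def y_def)
    have "x - y \<noteq> 0" unfolding xy using d0 by simp
    moreover have "z \<noteq> y" "z \<noteq> x"
      unfolding x_def y_def z_def using ent i(3) by (intro zeta_diff_ne; simp)+
    ultimately have ne: "x \<noteq> y" "z \<noteq> y" "z \<noteq> x" by auto
    have z': "zeta lam (\<tau>', v) i = y" "zeta lam (\<tau>', v) (i + 1) = x" "zeta lam (\<tau>', v) j = z"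
      using zt'[of i] zt'[of "i + 1"] zt'[of j] i j 3 by (auto simp: x_def y_def z_def)
    have e_vj: "entry vj j = entry v i" "entry vj i = entry v j" "entry vj (i + 1) = entry v (i + 1)"
      using ej(1,2) ej(3)[of "i + 1"] i 3 by auto
    define w where "w = swap_entries vj i"
    have lw: "length w = N" by (simp add: w_def lj)
    have di: "descent vj i" using e_vj ent i lj by (simp add: descent_def)
    have ne_vj: "entry vj i \<noteq> entry vj (i + 1)" using e_vj ent i(3) by simp
    note zw = zeta_swap_simps[OF lj i(1,2) ne_vj, folded w_def]
    have ew: "entry w j = entry w (j + 1)"
      using entry_swap_simps(1)[of i vj] entry_swap_simps(3)[of i vj j] e_vj i j 3 lj
      by (auto simp: w_def)
    have s: "sigma w j = k"
      unfolding k_def using zw(6)[of j] zj(4) j 3 by simp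
    have sw: "(w, v) \<in> smaller"
      using sj smaller_swap[OF di] unfolding w_def smaller_def by (auto dest: less_trans)
    have ok: "tie_ok w" using sw lw by (rule IH)
    have eq: "step j (- (1 / of_int d)) (jack \<tau> w) = mscale (swap_coeff d) (jack \<tau>' w)"
      using ok \<tau> j ew unfolding tie_ok_def d_def \<tau>'_def s[symmetric] by simp
    have pj: "par \<rho> vj i = 1 / (zeta lam (\<rho>, v) j - zeta lam (\<rho>, v) (i + 1))" for \<rho>
      using zj(2)[of \<rho>] zj(3)[of "i + 1" \<rho>] i 3 by (simp add: par_def)
    have jv2: "jack \<rho> v = step j (1 / (zeta lam (\<rho>, v) j - zeta lam (\<rho>, v) i))
        (step i (1 / (zeta lam (\<rho>, v) j - zeta lam (\<rho>, v) (i + 1))) (jack \<rho> w))" if "\<rho> \<in> RST lam" for \<rho>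
    proof -
      have "par \<rho> v j = 1 / (zeta lam (\<rho>, v) j - zeta lam (\<rho>, v) i)" by (simp add: par_def 3)
      then show ?thesis using jv[OF that] jack_swap[OF that lj di] unfolding pj w_def[symmetric] by simp
    qed
    have m: "jack \<tau> w \<in> M lam" using lw \<tau> by (rule M_jack[rotated])
    have rel: "- (1 / of_int d) * (1 / (z - y)) = 1 / (z - x) * (- (1 / of_int d) + 1 / (z - y))"
      unfolding xy[symmetric] using partial_fractions[of "z - y" "z - x"] ne
      by (simp add: mult.commute add.commute)
    have "step i (- (1 / of_int d)) (jack \<tau> v) =
        step j (1 / (z - y)) (step i (1 / (z - x)) (mscale (swap_coeff d) (jack \<tau>' w)))"
      unfolding jv2[OF \<tau>] x_def[symmetric] y_def[symmetric] z_def[symmetric]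
      using yang_baxter[OF m j(1) _ rel] i 3 eq by simp
    also have "\<dots> = mscale (swap_coeff d) (jack \<tau>' v)"
      using R jv2[of \<tau>'] unfolding step_mscale z' by (cases "swap_coeff d = 0") simp_all
    finally show ?thesis .
  qed
  then show "step i (- (1 / of_int (CTdiff lam \<tau> (sigma v i)))) (jack \<tau> v) =
      mscale (swap_coeff (CTdiff lam \<tau> (sigma v i))) (jack (interchange (sigma v i) \<tau>) v)"
    unfolding d_def k_def \<tau>'_def .
qed

lemma tie_ok_all: "length v = N \<Longrightarrow> tie_ok v"
proof (induction v rule: wf_induct_rule[OF wf_smaller])
  case (1 v)
  show ?case
  proof (cases "\<exists>j. descent v j")
    case True
    then show ?thesis using tie_ok_descent[OF 1(2)] 1(1) by blast
  next
    case no: False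
    show ?thesis
    proof (cases "v = [] \<or> last v = 0")
      case False
      then have "v = butlast v @ [last v - 1 + 1]" by simp
      then show ?thesis using tie_ok_rotate[OF 1(2)] 1(1) by blast
    next
      case True
      then have v: "v = replicate N 0" using no_descent_zero[of v] no 1(2) by simp
      show ?thesis unfolding tie_ok_def v
        by (auto intro!: step_eqI simp: sigma_replicate[simplified] jack_zero S_tensor_one)
    qed
  qed
qed

lemma jack_tie:
  assumes "\<tau> \<in> RST lam" "length v = N" "1 \<le> i" "i < N" "entry v i = entry v (i + 1)"
  shows "step i (- (1 / of_int (CTdiff lam \<tau> (sigma v i)))) (jack \<tau> v) =
       mscale (swap_coeff (CTdiff lam \<tau> (sigma v i))) (jack (interchange (sigma v i) \<tau>) v)"
  using tie_ok_all[OF assms(2)] assms unfolding tie_ok_def by blast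

end

section \<open>Tableaux given by a linear order of the boxes\<close>

definition lexless :: "nat \<times> nat \<Rightarrow> nat \<times> nat \<Rightarrow> bool" where
  "lexless b b' \<longleftrightarrow> fst b < fst b' \<or> fst b = fst b' \<and> snd b < snd b'"

lemma lexless_trans: "lexless a b \<Longrightarrow> lexless b c \<Longrightarrow> lexless a c"
  by (auto simp: lexless_def)

lemma lexless_irrefl [simp]: "\<not> lexless a a"
  by (simp add: lexless_def)

lemma lexless_total: "a \<noteq> b \<Longrightarrow> lexless a b \<or> lexless b a"
  by (auto simp: lexless_def prod_eq_iff)

context shape begin

text \<open>Labels \<open>N\<close>, ..., 1 in the lexicographic order of the keys:
  \<open>id\<close> reads column by column, \<open>prod.swap\<close> row by row.\<close>

definition rank_tab :: "(nat \<times> nat \<Rightarrow> nat \<times> nat) \<Rightarrow> filling" where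
  "rank_tab key = (\<lambda>b. if b \<in> B then N - card {b' \<in> B. lexless (key b') (key b)} else 0)"

lemma root_tab_rank: "root_tab lam = rank_tab id"
proof
  fix b
  have "{(c', r') \<in> B. c' < fst b \<or> (c' = fst b \<and> r' < snd b)} = {b' \<in> B. lexless (id b') (id b)}"
    by (auto simp: lexless_def)
  then show "root_tab lam b = rank_tab id b"
    by (cases b) (simp add: root_tab_def rank_tab_def)
qed

lemma rank_tab_less:
  assumes b: "b \<in> B" "b' \<in> B" and less: "lexless (key b) (key b')"
  shows "rank_tab key b' < rank_tab key b"
proof -
  let ?A = "\<lambda>b. {b' \<in> B. lexless (key b') (key b)}"
  have "b \<in> ?A b'" "b \<notin> ?A b" "?A b \<subseteq> ?A b'" using b less by (auto intro: lexless_trans)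
  then have "?A b \<subset> ?A b'" by blast
  then have "card (?A b) < card (?A b')" by (intro psubset_card_mono) auto
  moreover have "card (?A b') < N"
  proof -
    have "?A b' \<subset> B" using b lexless_irrefl by blast
    then show ?thesis using psubset_card_mono[OF finite_boxes] card_boxes by metis
  qed
  ultimately show ?thesis using b by (simp add: rank_tab_def)
qed

lemma bijective_rank_tab:
  assumes "inj key"
  shows "bijective (rank_tab key)"
proof -
  have inj: "inj_on (rank_tab key) B"
  proof (rule inj_onI, rule ccontr)
    fix b b' assume b: "b \<in> B" "b' \<in> B" and eq: "rank_tab key b = rank_tab key b'" and ne: "b \<noteq> b'"
    have "key b \<noteq> key b'" using ne injD[OF assms] by blast
    then show False using lexless_total[of "key b" "key b'"] rank_tab_less[of b b' key] rank_tab_less[of b' b key] b eq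
      by auto
  qed
  have "rank_tab key b \<in> {1..N}" if "b \<in> B" for b
  proof -
    have "{b' \<in> B. lexless (key b') (key b)} \<subset> B" using that lexless_irrefl by blast
    then have "card {b' \<in> B. lexless (key b') (key b)} < N"
      using psubset_card_mono[OF finite_boxes] card_boxes by metis
    then show ?thesis using that by (simp add: rank_tab_def)
  qed
  then have "rank_tab key ` B \<subseteq> {1..N}" by blast
  moreover have "card (rank_tab key ` B) = N" using card_image[OF inj] card_boxes by simp
  ultimately have "rank_tab key ` B = {1..N}" by (intro card_subset_eq) auto
  then show ?thesis using inj unfolding bijective_def bij_betw_def by blast
qed

text \<open>The induced total order extends the componentwise order of boxes, which makes the
  labelling a tableau.\<close>

definition box_key :: "(nat \<times> nat \<Rightarrow> nat \<times> nat) \<Rightarrow> bool" where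
  "box_key key \<longleftrightarrow> inj key \<and> (\<forall>c r c' r'. c \<le> c' \<and> r \<le> r' \<and> (c, r) \<noteq> (c', r') \<longrightarrow> lexless (key (c, r)) (key (c', r')))"

lemma box_key_id: "box_key id" and box_key_swap: "box_key prod.swap"
  by (auto simp: box_key_def lexless_def)

lemma rank_tab_RST:
  assumes "box_key key"
  shows "rank_tab key \<in> RST lam"
proof -
  have "bij_betw (rank_tab key) B {1..N}"
    using bijective_rank_tab assms by (simp add: box_key_def bijective_def)
  moreover have "\<forall>b. b \<notin> B \<longrightarrow> rank_tab key b = 0" by (simp add: rank_tab_def)
  moreover have "rank_tab key (c', r') < rank_tab key (c, r)"
    if "(c, r) \<in> B" "(c', r') \<in> B" "c \<le> c'" "r \<le> r'" "(c, r) \<noteq> (c', r')" for c r c' r'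
    using that assms by (intro rank_tab_less) (auto simp: box_key_def)
  ultimately show ?thesis unfolding RST_def by auto
qed

text \<open>Exactly \<open>N - \<tau> b\<close> labels exceed \<open>\<tau> b\<close>, and they sit
  on the boxes that precede \<open>b\<close>.\<close>

lemma rank_tab_unique:
  assumes \<tau>: "\<tau> \<in> RST lam" and key: "box_key key"
    and mono: "\<And>b b'. b \<in> B \<Longrightarrow> b' \<in> B \<Longrightarrow> lexless (key b) (key b') \<Longrightarrow> \<tau> b' < \<tau> b"
  shows "\<tau> = rank_tab key"
proof
  fix b
  note bij = RST_bijective[OF \<tau>]
  show "\<tau> b = rank_tab key b"
  proof (cases "b \<in> B")
    case True
    have iff: "lexless (key b') (key b) \<longleftrightarrow> \<tau> b < \<tau> b'" if "b' \<in> B" for b'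
    proof
      assume "\<tau> b < \<tau> b'"
      moreover have "key b' \<noteq> key b"
        using key calculation unfolding box_key_def inj_def by (metis less_irrefl)
      ultimately show "lexless (key b') (key b)"
        using lexless_total[of "key b'" "key b"] mono[OF True that] by auto
    qed (use mono True that in blast)
    have "\<tau> ` {b' \<in> B. lexless (key b') (key b)} = {\<tau> b<..N}"
    proof (intro equalityI subsetI)
      fix x assume "x \<in> \<tau> ` {b' \<in> B. lexless (key b') (key b)}"
      then show "x \<in> {\<tau> b<..N}" using iff bijective_range[OF bij] by auto
    next
      fix x assume x: "x \<in> {\<tau> b<..N}"
      obtain c r where "(c, r) \<in> B" "\<tau> (c, r) = x"
        by (rule bijective_box[OF bij, of x]) (use x in auto)
      then show "x \<in> \<tau> ` {b' \<in> B. lexless (key b') (key b)}" using iff x by force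
    qed
    moreover have "inj_on \<tau> {b' \<in> B. lexless (key b') (key b)}"
      using bij unfolding bijective_def bij_betw_def by (auto intro: inj_on_subset)
    ultimately have "card {b' \<in> B. lexless (key b') (key b)} = N - \<tau> b"
      by (metis card_image card_greaterThanAtMost)
    then show ?thesis using True bijective_range[OF bij True] by (simp add: rank_tab_def)
  qed (use RST_outside[OF \<tau>] in \<open>simp add: rank_tab_def\<close>)
qed

section \<open>The Yang-Baxter graph\<close>

lemma finite_RST: "finite (RST lam)"
proof (rule finite_subset)
  show "RST lam \<subseteq> {f. \<forall>x. (x \<in> B \<longrightarrow> f x \<in> {1..N}) \<and> (x \<notin> B \<longrightarrow> f x = 0)}"
    using bijective_range[OF RST_bijective] RST_outside by fastforce
  show "finite {f. \<forall>x. (x \<in> B \<longrightarrow> f x \<in> {1..N}) \<and> (x \<notin> B \<longrightarrow> f x = (0::nat))}"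
    by (rule finite_set_of_finite_funs) auto
qed

text \<open>An interchange changes this by the content difference. On the finite set of tableaux it
  has a minimum, which serves both reachability and the choice of an extremal tableau in the support
  of an eigenvector.\<close>

definition potential :: "filling \<Rightarrow> int" where
  "potential \<tau> = (\<Sum>k\<in>{1..N}. int k * CT lam \<tau> k)"

lemma potential_interchange:
  assumes "bijective \<tau>" "1 \<le> i" "i < N"
  shows "potential (interchange i \<tau>) = potential \<tau> + CTdiff lam \<tau> i"
proof -
  let ?A = "{1..N} - {i, i + 1}"
  note split = sum_split_pair[OF assms(2,3)]
  have "(\<Sum>j\<in>?A. int j * CT lam (interchange i \<tau>) j) = (\<Sum>j\<in>?A. int j * CT lam \<tau> j)"
    using assms by (intro sum.cong) (auto simp: CT_interchange)
  moreover have "CT lam (interchange i \<tau>) i = CT lam \<tau> (i + 1)" "CT lam (interchange i \<tau>) (i + 1) = CT lam \<tau> i"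
    using CT_interchange[OF assms, of i] CT_interchange[OF assms, of "i + 1"] assms by auto
  ultimately show ?thesis unfolding potential_def split by (simp add: algebra_simps)
qed

text \<open>If \<open>k + 1\<close> stood in a column to the right of \<open>k\<close>, the bound on
  the contents would put it in a row weakly above, where labels must be smaller. So columns weakly
  decrease as labels grow, which characterises the reading by columns.\<close>

lemma root_tab_terminal:
  assumes \<tau>: "\<tau> \<in> RST lam" and d: "\<And>k. 1 \<le> k \<Longrightarrow> k < N \<Longrightarrow> CTdiff lam \<tau> k \<ge> - 1"
  shows "\<tau> = root_tab lam"
proof -
  note bij = RST_bijective[OF \<tau>]
  define col where "col = (\<lambda>k. fst (the_inv_into B \<tau> k))"
  have col: "col (\<tau> (c, r)) = c" if "(c, r) \<in> B" for c r
    unfolding col_def using that bij by (simp add: bijective_def bij_betw_def the_inv_into_f_f)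
  have step: "col (k + 1) \<le> col k" if k: "1 \<le> k" "k < N" for k
  proof -
    obtain c r where b: "(c, r) \<in> B" "\<tau> (c, r) = k" by (rule bijective_box[OF bij, of k]) (use k in auto)
    obtain c' r' where b': "(c', r') \<in> B" "\<tau> (c', r') = k + 1"
      by (rule bijective_box[OF bij, of "k + 1"]) (use k in auto)
    have "int c - int r - (int c' - int r') \<ge> - 1"
      using d[OF k] CT_box[OF bij b(1)] CT_box[OF bij b'(1)] b b' by simp
    moreover have "\<not> (c < c' \<and> r \<le> r')"
      using RST_decreasing[OF \<tau> b(1) b'(1)] b b' by force
    ultimately have "c' \<le> c" by linarith
    then show ?thesis using col[OF b(1)] col[OF b'(1)] b b' by simp
  qed
  have anti: "col k \<le> col j" if "j \<le> k" "1 \<le> j" "k \<le> N" for j k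
    using that
  proof (induction k rule: dec_induct)
    case (step k)
    then show ?case using \<open>\<And>k. 1 \<le> k \<Longrightarrow> k < N \<Longrightarrow> col (k + 1) \<le> col k\<close>[of k] by simp
  qed simp
  have "\<tau> = rank_tab id"
  proof (rule rank_tab_unique[OF \<tau> box_key_id])
    fix b b' assume b: "b \<in> B" "b' \<in> B" and less: "lexless (id b) (id b')"
    obtain c r c' r' where cr: "b = (c, r)" "b' = (c', r')" by (cases b, cases b')
    show "\<tau> b' < \<tau> b"
    proof (cases "c < c'")
      case True
      show ?thesis
      proof (rule ccontr)
        assume "\<not> \<tau> b' < \<tau> b"
        then have "col (\<tau> b') \<le> col (\<tau> b)"
          using anti bijective_range[OF bij] b by auto
        then show False using col b cr True by simp
      qed
    next
      case False
      then show ?thesis using less cr b RST_decreasing[OF \<tau>, of c r c' r'] by (auto simp: lexless_def)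
    qed
  qed
  then show ?thesis by (simp add: root_tab_rank)
qed

text \<open>Take an unreachable tableau of least potential. A content difference below -1 would
  yield, by interchange, a tableau of lower potential, hence a reachable one, with an edge back. So
  the tableau is the root.\<close>

lemma reachable_zero:
  assumes "\<tau> \<in> RST lam"
  shows "Some (\<tau>, replicate N 0) \<in> G_verts lam"
proof (rule ccontr)
  assume "Some (\<tau>, replicate N 0) \<notin> G_verts lam"
  then have ne: "{\<rho> \<in> RST lam. Some (\<rho>, replicate N 0) \<notin> G_verts lam} \<noteq> {}" (is "?A \<noteq> {}")
    using assms by blast
  have fin: "finite ?A" using finite_RST by simp
  define \<rho> where "\<rho> = arg_min_on potential ?A"
  have \<rho>: "\<rho> \<in> RST lam" "Some (\<rho>, replicate N 0) \<notin> G_verts lam"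
    using arg_min_if_finite(1)[OF fin ne, of potential] by (auto simp: \<rho>_def)
  have min: "potential \<rho> \<le> potential \<rho>'" if "\<rho>' \<in> ?A" for \<rho>'
    using arg_min_least[OF fin ne that, of potential] by (simp add: \<rho>_def)
  have "CTdiff lam \<rho> k \<ge> - 1" if k: "1 \<le> k" "k < N" for k
  proof (rule ccontr)
    assume less: "\<not> CTdiff lam \<rho> k \<ge> - 1"
    let ?\<rho> = "interchange k \<rho>"
    note bij = RST_bijective[OF \<rho>(1)]
    have R: "?\<rho> \<in> RST lam" using interchange_RST[OF \<rho>(1) k] less by simp
    have "potential ?\<rho> < potential \<rho>" using potential_interchange[OF bij k] less by simp
    then have "?\<rho> \<notin> ?A" using min by fastforce
    then have reach: "Some (?\<rho>, replicate N 0) \<in> G_verts lam" using R by blast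
    have s: "sigma (replicate N 0) k = k" using sigma_replicate k by simp
    have "CTdiff lam ?\<rho> k \<ge> 2" using CTdiff_interchange[OF bij k] less by simp
    moreover have "entry (replicate N 0) k = entry (replicate N (0::nat)) (k + 1)" using k by simp
    ultimately have "G_edge lam (Refl k) (?\<rho>, replicate N 0) (Some (interchange (sigma (replicate N 0) k) ?\<rho>, replicate N 0))"
      using k s by (intro G_edge.tab) simp_all
    then have "Some (\<rho>, replicate N 0) \<in> G_verts lam" using G_verts.step[OF reach] by (simp add: s)
    then show False using \<rho> by blast
  qed
  then have "\<rho> = root_tab lam" by (rule root_tab_terminal[OF \<rho>(1)])
  then show False using \<rho>(2) G_verts.root[of lam] by (simp add: G_root_def)
qed

text \<open>The path is the one that the recursion of \<open>jack\<close> undoes.\<close>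

lemma reachable:
  assumes \<tau>: "\<tau> \<in> RST lam" and "length v = N"
  shows "Some (\<tau>, v) \<in> G_verts lam"
  using assms(2)
proof (induction v rule: wf_induct_rule[OF wf_smaller])
  case (1 v)
  consider i where "descent v i" | "\<And>i. \<not> descent v i" "v = [] \<or> last v = 0" | "v \<noteq> []" "last v > 0" by blast
  then show ?case
  proof cases
    case (1 i)
    have i: "1 \<le> i" "i < N" "entry v (i + 1) < entry v i" using 1 \<open>length v = N\<close> by (auto simp: descent_def)
    have ii: "1 \<le> i" "i < length v" using i \<open>length v = N\<close> by auto
    have r: "Some (\<tau>, swap_entries v i) \<in> G_verts lam"
      using "1.IH" smaller_swap[OF 1] \<open>length v = N\<close> by simp
    have "G_edge lam (Refl i) (\<tau>, swap_entries v i) (Some (\<tau>, swap_entries (swap_entries v i) i))"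
      using i entry_swap_simps(1,2)[OF ii] by (intro G_edge.swap) simp_all
    then show ?thesis using G_verts.step[OF r] swap_swap[OF ii] by simp
  next
    case 2
    then have "v = replicate N 0" using no_descent_zero[of v] \<open>length v = N\<close> by simp
    then show ?thesis using reachable_zero[OF \<tau>] by simp
  next
    case 3
    define u a where "u = butlast v" and "a = last v - 1"
    have v: "v = u @ [a + 1]" using 3 by (simp add: u_def a_def)
    have "(a # u, v) \<in> smaller" by (rule smaller_sum) (simp add: v)
    then have r: "Some (\<tau>, a # u) \<in> G_verts lam" using "1.IH" \<open>length v = N\<close> v by simp
    show ?thesis using G_verts.step[OF r G_edge.Psi] v by simp
  qed
qed

lemma G_edge_RST:
  assumes "G_edge lam e x y" "fst x \<in> RST lam" "length (snd x) = N" "y = Some z"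
  shows "fst z \<in> RST lam \<and> length (snd z) = N"
  using assms
proof (induction rule: G_edge.induct)
  case (tab i v \<tau>)
  have "1 \<le> sigma v i" "sigma v i < N"
    using tie_rel(1,2)[of v \<tau> i] tab by auto
  then have "interchange (sigma v i) \<tau> \<in> RST lam" using tab by (intro interchange_RST) auto
  then show ?case using tab by auto
qed auto

lemma root_tab_RST: "root_tab lam \<in> RST lam"
  using rank_tab_RST[OF box_key_id] by (simp add: root_tab_rank)

lemma H_verts_eq: "H_verts lam = {(\<tau>, v). \<tau> \<in> RST lam \<and> length v = N}"
proof -
  have "fst x \<in> RST lam \<and> length (snd x) = N" if "Some x \<in> G_verts lam" for x
    using that
  proof (induction "Some x" arbitrary: x rule: G_verts.induct)
    case root
    then show ?case using root_tab_RST by (simp add: G_root_def)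
  next
    case (step x e y)
    then show ?case using G_edge_RST by blast
  qed
  then show ?thesis using reachable unfolding H_verts_def by auto
qed

text \<open>Every path yields the same value. On a swap edge the parameter at the source is
  \<open>par\<close> at the target, where the two spectral entries have changed places; on a tableau
  edge the content difference is at least 2, so \<open>swap_coeff\<close> is 1.\<close>

lemma J_rel_jack:
  assumes "J_rel lam x P"
  shows "fst x \<in> RST lam \<and> length (snd x) = N \<and> P = jack (fst x) (snd x)"
  using assms
proof (induction rule: J_rel.induct)
  case root
  then show ?case using root_tab_RST by (simp add: G_root_def jack_zero)
next
  case (refl x P i y)
  have y: "fst y \<in> RST lam" "length (snd y) = N" using G_edge_RST[OF refl(2)] refl(3) by auto
  obtain \<tau> v where x: "x = (\<tau>, v)" by (cases x)
  have \<tau>: "\<tau> \<in> RST lam" and v: "length v = N" and P: "P = jack \<tau> v" using refl(3) x by auto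
  have "step i (1 / (zeta lam x (i + 1) - zeta lam x i)) (jack \<tau> v) = jack (fst y) (snd y)"
    using refl(2)[unfolded x]
  proof cases
    case swap
    have ii: "1 \<le> i" "i < length v" using swap v by auto
    have d: "descent (swap_entries v i) i"
      using entry_swap_simps(1,2)[OF ii] swap ii by (simp add: descent_def)
    have "par \<tau> (swap_entries v i) i = 1 / (zeta lam (\<tau>, v) (i + 1) - zeta lam (\<tau>, v) i)"
      using zeta_swap_simps(1,2)[OF v, of i \<tau>] swap by (simp add: par_def)
    then show ?thesis using jack_swap[OF \<tau> _ d] swap_swap[OF ii] swap v x by simp
  next
    case tab
    define d where "d = CTdiff lam \<tau> (sigma v i)"
    have d: "d \<ge> 2" using tab by (simp add: d_def)
    have "zeta lam (\<tau>, v) i - zeta lam (\<tau>, v) (i + 1) = of_int d"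
      using tie_rel(4)[OF v \<tau>, of i] tab by (simp add: d_def)
    then have "zeta lam (\<tau>, v) (i + 1) - zeta lam (\<tau>, v) i = - of_int d"
      by (metis minus_diff_eq)
    then have "1 / (zeta lam (\<tau>, v) (i + 1) - zeta lam (\<tau>, v) i) = - (1 / of_int d)" by simp
    moreover have "swap_coeff d = 1" using d by (simp add: swap_coeff_def)
    ultimately show ?thesis using jack_tie[OF \<tau> v, of i] tab x unfolding d_def[symmetric] by simp
  qed
  then show ?case using y by (simp add: step_def P)
next
  case (Psi x P y)
  have y: "fst y \<in> RST lam" "length (snd y) = N" using G_edge_RST[OF Psi(2)] Psi(3) by auto
  have "\<Psi> (jack (fst x) (snd x)) = jack (fst y) (snd y)"
    using Psi(2)
  proof cases
    case (Psi \<tau> a u)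
    then show ?thesis using jack_rotate[of \<tau> u a] \<open>fst x \<in> RST lam \<and> length (snd x) = N \<and> P = jack (fst x) (snd x)\<close> by simp
  qed
  then show ?case using y Psi by simp
qed

lemma J_jack:
  assumes "\<tau> \<in> RST lam" "length v = N"
  shows "J lam (\<tau>, v) = jack \<tau> v"
proof -
  have ex: "\<exists>P. J_rel lam x P" if "Some x \<in> G_verts lam" for x
    using that
  proof (induction "Some x" arbitrary: x rule: G_verts.induct)
    case root
    then show ?case using J_rel.root by (auto simp: G_root_def)
  next
    case (step x e y)
    then show ?case by (cases e) (auto intro: J_rel.refl J_rel.Psi)
  qed
  then obtain P where P: "J_rel lam (\<tau>, v) P" using reachable[OF assms] by blast
  show ?thesis unfolding J_def
  proof (rule the_equality)
    show "J_rel lam (\<tau>, v) (jack \<tau> v)" using J_rel_jack[OF P] P by simp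
  qed (use J_rel_jack in force)
qed

end

section \<open>Degrees and leading terms\<close>

definition exp_deg :: "(nat \<Rightarrow>\<^sub>0 nat) \<Rightarrow> nat" where
  "exp_deg m = (\<Sum>j\<in>keys m. lookup m j)"

lemma homogeneous_iff: "homogeneous d P \<longleftrightarrow> (\<forall>\<tau> m. coef P \<tau> m \<noteq> 0 \<longrightarrow> exp_deg m = d)"
  unfolding homogeneous_def coef_def exp_deg_def by (auto simp: in_keys_iff)

lemma exp_deg_finite:
  assumes "finite A" "keys m \<subseteq> A"
  shows "exp_deg m = (\<Sum>j\<in>A. lookup m j)"
  unfolding exp_deg_def using assms by (intro sum.mono_neutral_left) (auto simp: in_keys_iff)

lemma exp_deg_exp_swap [simp]: "exp_deg (exp_swap i m) = exp_deg m"
proof -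
  have "keys (exp_swap i m) = transpose i (i + 1) ` keys m"
    by (intro set_eqI) (simp only: in_transpose_image_iff in_keys_iff lookup_exp_swap)
  then show ?thesis
    unfolding exp_deg_def by (simp add: sum.reindex)
qed

lemma exp_deg_minus_unit:
  assumes "lookup m j \<noteq> 0"
  shows "exp_deg m = exp_deg (m - exp_unit j) + 1"
proof -
  let ?A = "keys m"
  have j: "j \<in> ?A" using assms by (simp add: in_keys_iff)
  have sub: "keys (m - exp_unit j) \<subseteq> ?A"
    by (auto simp: in_keys_iff lookup_minus)
  have "exp_deg (m - exp_unit j) = (\<Sum>k\<in>?A. lookup (m - exp_unit j) k)"
    by (rule exp_deg_finite[OF _ sub]) simp
  also have "\<dots> = (lookup m j - 1) + (\<Sum>k\<in>?A - {j}. lookup m k)"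
    using j by (simp add: sum.remove[OF _ j] lookup_minus exp_unit_def lookup_single when_def)
  also have "\<dots> + 1 = exp_deg m"
    unfolding exp_deg_def using assms by (simp add: sum.remove[OF _ j])
  finally show ?thesis ..
qed

context shape begin

lemma homogeneous_add: "homogeneous d P \<Longrightarrow> homogeneous d Q \<Longrightarrow> homogeneous d (P + Q)"
  unfolding homogeneous_iff coef_add by (metis add.right_neutral)

lemma homogeneous_mscale: "homogeneous d P \<Longrightarrow> homogeneous d (mscale c P)"
  unfolding homogeneous_iff by auto

lemma homogeneous_sum: "(\<And>a. a \<in> A \<Longrightarrow> homogeneous d (f a)) \<Longrightarrow> homogeneous d (sum f A)"
  by (induction A rule: infinite_finite_induct) (auto intro: homogeneous_add simp: homogeneous_iff[of _ 0])

lemma homogeneous_S: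
  assumes "homogeneous d P"
  shows "homogeneous d (S i P)"
  unfolding homogeneous_iff
proof (intro allI impI)
  fix \<tau> m assume "coef (S i P) \<tau> m \<noteq> 0"
  then have "coef P \<tau> (exp_swap i m) \<noteq> 0 \<or> coef P (interchange i \<tau>) (exp_swap i m) \<noteq> 0"
    by (auto simp: coef_m_refl)
  then have "exp_deg (exp_swap i m) = d" using assms unfolding homogeneous_iff by blast
  then show "exp_deg m = d" by simp
qed

lemma homogeneous_fold_S: "homogeneous d P \<Longrightarrow> homogeneous d (fold S is P)"
  by (induction "is" arbitrary: P) (auto intro: homogeneous_S)

lemma homogeneous_Psi:
  assumes "homogeneous d P"
  shows "homogeneous (d + 1) (\<Psi> P)"
  unfolding homogeneous_iff
proof (intro allI impI)
  fix \<tau> m assume "coef (\<Psi> P) \<tau> m \<noteq> 0"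
  then have m: "lookup m N \<noteq> 0" "coef (\<Theta> P) \<tau> (m - exp_unit N) \<noteq> 0"
    by (auto simp: m_Psi_def coef_var_times split: if_splits)
  then have "exp_deg (m - exp_unit N) = d"
    using homogeneous_fold_S[OF assms] unfolding homogeneous_iff by blast
  then show "exp_deg m = d + 1" using exp_deg_minus_unit[OF m(1)] by simp
qed

text \<open>\<open>P\<close> specialises, as \<open>\<alpha> \<rightarrow> \<infinity>\<close>, to the monomial \<open>x\<^sup>m\<close> times a nonzero vector.\<close>

definition lead :: "melem \<Rightarrow> (nat \<Rightarrow>\<^sub>0 nat) \<Rightarrow> bool" where
  "lead P m \<longleftrightarrow> (\<forall>\<tau> m'. finite_scalar (coef P \<tau> m')) \<and>
    (\<forall>\<tau> m'. m' \<noteq> m \<longrightarrow> infinitesimal (coef P \<tau> m')) \<and> (\<exists>\<tau>. \<not> infinitesimal (coef P \<tau> m))"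

lemma finite_scalar_swap_coeff: "finite_scalar (swap_coeff d)"
  using finite_scalar_diff[OF finite_scalar_1 finite_scalar_mult[OF finite_scalar_inverse_int[of d] finite_scalar_inverse_int[of d]]]
  unfolding swap_coeff_def power2_eq_square by simp

lemma infinitesimal_coef_S:
  assumes "\<And>\<tau>. infinitesimal (coef P \<tau> (exp_swap i m))"
  shows "infinitesimal (coef (S i P) \<tau> m)"
proof -
  have "infinitesimal (1 / of_int (CTdiff lam \<tau> i) * coef P \<tau> (exp_swap i m))"
    by (intro infinitesimal_mult(1) finite_scalar_inverse_int assms)
  moreover have "infinitesimal (swap_coeff (CTdiff lam (interchange i \<tau>) i) * coef P (interchange i \<tau>) (exp_swap i m))"
    by (intro infinitesimal_mult(1) finite_scalar_swap_coeff assms)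
  ultimately show ?thesis unfolding coef_m_refl using infinitesimal_add by fastforce
qed

text \<open>The leading vector cannot vanish: if its image were infinitesimal, reflecting once more
  would make the original infinitesimal.\<close>

lemma lead_S:
  assumes P: "P \<in> M lam" and L: "lead P m" and i: "1 \<le> i" "i < N"
  shows "lead (S i P) (exp_swap i m)"
  unfolding lead_def
proof (intro conjI allI impI)
  fix \<tau> m'
  have "finite_scalar (1 / of_int (CTdiff lam \<tau> i) * coef P \<tau> (exp_swap i m'))"
    using L unfolding lead_def by (intro finite_scalar_mult finite_scalar_inverse_int) blast
  moreover have "finite_scalar (swap_coeff (CTdiff lam (interchange i \<tau>) i) * coef P (interchange i \<tau>) (exp_swap i m'))"
    using L unfolding lead_def by (intro finite_scalar_mult finite_scalar_swap_coeff) blast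
  ultimately show "finite_scalar (coef (S i P) \<tau> m')"
    unfolding coef_m_refl using finite_scalar_add by fastforce
next
  fix \<tau> m' assume "m' \<noteq> exp_swap i m"
  then have "exp_swap i m' \<noteq> m" by auto
  then show "infinitesimal (coef (S i P) \<tau> m')"
    using L unfolding lead_def by (intro infinitesimal_coef_S) blast
next
  show "\<exists>\<tau>. \<not> infinitesimal (coef (S i P) \<tau> (exp_swap i m))"
  proof (rule ccontr)
    assume "\<not> ?thesis"
    then have a: "infinitesimal (coef (S i P) \<tau> (exp_swap i m))" for \<tau> by blast
    have "infinitesimal (coef (S i (S i P)) \<tau> m)" for \<tau>
      by (rule infinitesimal_coef_S) (rule a)
    then show False using L unfolding S_involutory[OF P i] lead_def by blast
  qed
qed

text \<open>The scalar term is infinitesimal, so to leading order the step is a plain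
  reflection.\<close>

lemma lead_step:
  assumes P: "P \<in> M lam" and L: "lead P m" and i: "1 \<le> i" "i < N" and c: "infinitesimal c"
  shows "lead (step i c P) (exp_swap i m)"
proof -
  have small: "infinitesimal (c * coef P \<tau> m')" for \<tau> m'
    using L c unfolding lead_def by (intro infinitesimal_mult(2)) auto
  have coef: "coef (step i c P) \<tau> m' = coef (S i P) \<tau> m' + c * coef P \<tau> m'" for \<tau> m'
    by (simp add: step_def)
  note LS = lead_S[OF P L i, unfolded lead_def]
  show ?thesis unfolding lead_def
  proof (intro conjI allI impI)
    fix \<tau> m'
    show "finite_scalar (coef (step i c P) \<tau> m')"
      unfolding coef using LS by (intro finite_scalar_add[OF _ infinitesimal_imp_finite[OF small]]) blast
    assume "m' \<noteq> exp_swap i m"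
    then show "infinitesimal (coef (step i c P) \<tau> m')"
      unfolding coef using LS small by (intro infinitesimal_add) auto
  next
    obtain \<tau> where \<tau>: "\<not> infinitesimal (coef (S i P) \<tau> (exp_swap i m))" using LS by blast
    have "infinitesimal (coef (S i P) \<tau> (exp_swap i m))"
      if "infinitesimal (coef (step i c P) \<tau> (exp_swap i m))"
      using infinitesimal_add[OF that infinitesimal_minus[OF small[of \<tau> "exp_swap i m"]]] by (simp add: coef)
    then show "\<exists>\<tau>. \<not> infinitesimal (coef (step i c P) \<tau> (exp_swap i m))" using \<tau> by blast
  qed
qed

lemma lead_fold_S:
  assumes "P \<in> M lam" "lead P m" "set is \<subseteq> {1..<N}"
  shows "lead (fold S is P) (fold exp_swap is m)"
  using assms by (induction "is" arbitrary: P m) (auto simp: M_S lead_S)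

lemma lead_var_times:
  assumes L: "lead P m"
  shows "lead (pol_times (var j) P) (m + exp_unit j)"
  unfolding lead_def
proof (intro conjI allI impI)
  fix \<tau> m'
  show "finite_scalar (coef (pol_times (var j) P) \<tau> m')"
    using L unfolding lead_def coef_var_times by simp
  assume ne: "m' \<noteq> m + exp_unit j"
  show "infinitesimal (coef (pol_times (var j) P) \<tau> m')"
  proof (cases "lookup m' j = 0")
    case False
    have "m' - exp_unit j \<noteq> m"
    proof
      assume "m' - exp_unit j = m"
      then have "m' = m + exp_unit j" using False
        by (auto intro!: poly_mapping_eqI simp: exp_unit_def lookup_add lookup_minus lookup_single when_def)
      then show False using ne by blast
    qed
    then show ?thesis using L False unfolding lead_def coef_var_times by simp
  qed (simp add: coef_var_times)
next
  have "lookup (m + exp_unit j) j \<noteq> 0" by (simp add: lookup_add exp_unit_def)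
  then show "\<exists>\<tau>. \<not> infinitesimal (coef (pol_times (var j) P) \<tau> (m + exp_unit j))"
    using L unfolding lead_def coef_var_times by simp
qed

end

section \<open>Exponent vectors of lists\<close>

definition exponent :: "nat list \<Rightarrow> (nat \<Rightarrow>\<^sub>0 nat)" where
  "exponent v = (\<Sum>j\<in>{1..length v}. single j (entry v j))"

lemma lookup_exponent:
  "lookup (exponent v) j = (if 1 \<le> j \<and> j \<le> length v then entry v j else 0)"
proof -
  have "lookup (exponent v) j = (\<Sum>k\<in>{1..length v}. if k = j then entry v k else 0)"
    unfolding exponent_def by (simp add: lookup_sum lookup_single when_def)
  then show ?thesis by auto
qed

lemma exponent_inj: "length v = length w \<Longrightarrow> exponent v = exponent w \<Longrightarrow> v = w"
  by (rule entry_eqI) (auto dest!: arg_cong[where f = lookup] simp: fun_eq_iff lookup_exponent split: if_splits)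

lemma exponent_swap:
  assumes "1 \<le> i" "i < length v"
  shows "exp_swap i (exponent (swap_entries v i)) = exponent v"
proof (rule poly_mapping_eqI)
  fix j
  show "lookup (exp_swap i (exponent (swap_entries v i))) j = lookup (exponent v) j"
  proof (cases "1 \<le> j \<and> j \<le> length v")
    case True
    then have "1 \<le> transpose i (i + 1) j" "transpose i (i + 1) j \<le> length v"
      using transpose_range[OF assms, of j] by auto
    then show ?thesis using True entry_swap[OF assms, of "transpose i (i + 1) j"]
      by (simp add: lookup_exponent)
  next
    case False
    then have "transpose i (i + 1) j = j" using assms by (auto simp: transpose_def)
    then show ?thesis using False by (auto simp: lookup_exponent)
  qed
qed

text \<open>On exponents \<theta> is a cyclic rotation, here truncated to the first \<open>k\<close>
  places for the induction.\<close>

lemma lookup_fold_exp_swap: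
  "1 \<le> k \<Longrightarrow> lookup (fold exp_swap [1..<k] m) j =
    (if 1 \<le> j \<and> j < k then lookup m (j + 1) else if j = k then lookup m 1
     else lookup m j)"
proof (induction k arbitrary: j rule: dec_induct)
  case (step k)
  have "[1..<Suc k] = [1..<k] @ [k]" using step by simp
  then show ?case using step by (auto simp: step.IH transpose_def)
qed auto

lemma exponent_rotate:
  "fold exp_swap [1..<length u + 1] (exponent (a # u)) + exp_unit (length u + 1) = exponent (u @ [a + 1])"
proof (rule poly_mapping_eqI)
  fix j
  consider "j = 0" | "1 \<le> j" "j \<le> length u" | "j = length u + 1" | "j > length u + 1" by linarith
  then show "lookup (fold exp_swap [1..<length u + 1] (exponent (a # u)) + exp_unit (length u + 1)) j =
      lookup (exponent (u @ [a + 1])) j"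
    unfolding lookup_add lookup_fold_exp_swap[of "length u + 1", OF le_add2]
  proof cases
    case 2
    then have "j - 1 < length u" by simp
    then show "(if 1 \<le> j \<and> j < length u + 1 then lookup (exponent (a # u)) (j + 1)
        else if j = length u + 1 then lookup (exponent (a # u)) 1 else lookup (exponent (a # u)) j) +
        lookup (exp_unit (length u + 1)) j = lookup (exponent (u @ [a + 1])) j" using 2
      by (simp add: lookup_exponent exp_unit_def lookup_single when_def nth_append)
  qed (simp_all add: lookup_exponent exp_unit_def lookup_single when_def nth_append)
qed

context shape begin

text \<open>Descents join different entries, so every step parameter is infinitesimal and in the
  limit the monomial just follows the path of \<open>v\<close>.\<close>

lemma jack_lead:
  assumes "\<tau> \<in> RST lam" "length v = N"
  shows "homogeneous (sum_list v) (jack \<tau> v) \<and> lead (jack \<tau> v) (exponent v)"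
  using assms(2)
proof (induction v rule: wf_induct_rule[OF wf_smaller])
  case (1 v)
  note \<tau> = assms(1)
  consider i where "descent v i" | "\<And>i. \<not> descent v i" "v = [] \<or> last v = 0" | "v \<noteq> []" "last v > 0" by blast
  then show ?case
  proof cases
    case d: (1 i)
    have i: "1 \<le> i" "i < N" "entry v i \<noteq> entry v (i + 1)" using d \<open>length v = N\<close> by (auto simp: descent_def)
    have ii: "1 \<le> i" "i < length v" using i \<open>length v = N\<close> by auto
    let ?w = "swap_entries v i"
    have IH: "homogeneous (sum_list v) (jack \<tau> ?w)" "lead (jack \<tau> ?w) (exponent ?w)"
      using "1.IH"[OF smaller_swap[OF d]] \<open>length v = N\<close> sum_list_swap[OF ii] by auto
    have m: "jack \<tau> ?w \<in> M lam" using \<tau> \<open>length v = N\<close> by (intro M_jack) simp_all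
    have "infinitesimal (par \<tau> v i)"
      unfolding par_def using infinitesimal_zeta_diff[OF i(3), of lam \<tau> 0] by simp
    then have "lead (jack \<tau> v) (exponent v)"
      using lead_step[OF m IH(2) i(1,2)] unfolding jack_swap[OF \<tau> \<open>length v = N\<close> d] exponent_swap[OF ii] by blast
    moreover have "homogeneous (sum_list v) (jack \<tau> v)"
      unfolding jack_swap[OF \<tau> \<open>length v = N\<close> d] step_def
      by (intro homogeneous_add homogeneous_S homogeneous_mscale IH)
    ultimately show ?thesis by blast
  next
    case 2
    then have v: "v = replicate N 0" using no_descent_zero[of v] \<open>length v = N\<close> by simp
    have "lookup (exponent v) k = 0" for k
      unfolding v by (cases "1 \<le> k \<and> k \<le> N") (auto simp: lookup_exponent)
    then have e: "exponent v = 0" by (intro poly_mapping_eqI) simp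
    have c: "coef (jack \<tau> v) \<rho> m = (if \<rho> = \<tau> \<and> m = 0 then 1 else 0)" for \<rho> m
      unfolding v jack_zero by (simp add: coef_tensor lookup_single lookup_one when_def)
    show ?thesis unfolding homogeneous_iff lead_def c e by (auto simp: v exp_deg_def)
  next
    case 3
    define u a where "u = butlast v" and "a = last v - 1"
    have v: "v = u @ [a + 1]" using 3 by (simp add: u_def a_def)
    have lu: "length u + 1 = N" using v \<open>length v = N\<close> by simp
    have "(a # u, v) \<in> smaller" by (rule smaller_sum) (simp add: v)
    then have IH: "homogeneous (sum_list (a # u)) (jack \<tau> (a # u))" "lead (jack \<tau> (a # u)) (exponent (a # u))"
      using "1.IH"[of "a # u"] lu by (simp_all del: sum_list.Cons)
    have m: "jack \<tau> (a # u) \<in> M lam" using \<tau> lu by (intro M_jack) simp_all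
    have "lead (\<Psi> (jack \<tau> (a # u))) (fold exp_swap [1..<N] (exponent (a # u)) + exp_unit N)"
      unfolding m_Psi_def by (intro lead_var_times lead_fold_S m IH) auto
    then have "lead (jack \<tau> v) (exponent v)"
      unfolding v jack_rotate[OF \<tau> lu] exponent_rotate[of u a, symmetric] lu .
    moreover have "homogeneous (sum_list v) (jack \<tau> v)"
      using homogeneous_Psi[OF IH(1)] unfolding v jack_rotate[OF \<tau> lu] by (simp add: add.commute)
    ultimately show ?thesis by blast
  qed
qed

end

section \<open>The decreasing rearrangement\<close>

lemma length_vplus [simp]: "length (vplus v) = length v"
  by (simp add: vplus_def)

lemma vplus_antimono:
  assumes "1 \<le> i" "i \<le> j" "j \<le> length v"
  shows "entry (vplus v) j \<le> entry (vplus v) i"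
proof -
  have "sorted (rev (vplus v))" by (simp add: vplus_def)
  then show ?thesis using sorted_rev_nth_mono[of "vplus v" "i - 1" "j - 1"] assms by simp
qed

lemma vplus_cong: "mset v = mset w \<Longrightarrow> vplus v = vplus w"
  unfolding vplus_def by (metis sorted_list_of_multiset_mset)

lemma vplus_swap: "1 \<le> i \<Longrightarrow> i < length v \<Longrightarrow> vplus (swap_entries v i) = vplus v"
  by (rule vplus_cong) (rule mset_swap)

lemma card_entries:
  "card {j \<in> {1..length v}. Q (entry v j)} = size (filter_mset Q (mset v))"
proof -
  have "card {j \<in> {1..length v}. Q (entry v j)} = card {j. j < length v \<and> Q (v ! j)}"
    by (rule bij_betw_same_card[of "\<lambda>j. j - 1"], rule bij_betw_byWitness[where f' = "\<lambda>j. j + 1"]) auto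
  also have "\<dots> = length (filter Q v)" by (simp add: length_filter_conv_card)
  also have "\<dots> = size (filter_mset Q (mset v))" by (metis mset_filter size_mset)
  finally show ?thesis .
qed

text \<open>The rank of \<open>i\<close> exceeds the number of entries larger than
  \<open>entry v i\<close> and is at most the number of entries not smaller than it. Both numbers
  are the same for the rearrangement, where they locate the value.\<close>

lemma entry_vplus_sigma:
  assumes i: "1 \<le> i" "i \<le> length v"
  shows "entry (vplus v) (sigma v i) = entry v i"
proof -
  let ?u = "vplus v" and ?x = "entry v i" and ?k = "sigma v i" and ?n = "length v"
  have k: "1 \<le> ?k" "?k \<le> ?n" using sigma_range[OF i] by auto
  have ms: "mset ?u = mset v" by (simp add: vplus_def)
  have card_eq: "card {j \<in> {1..?n}. Q (entry ?u j)} = card {j \<in> {1..?n}. Q (entry v j)}" for Q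
    using card_entries[of ?u Q] card_entries[of v Q] ms by simp
  have gt: "card {j \<in> {1..?n}. entry v j > ?x} < ?k"
  proof -
    have "i \<in> before v i" "{j \<in> {1..?n}. entry v j > ?x} \<subseteq> before v i - {i}"
      using i by (auto simp: before_def)
    then show ?thesis unfolding sigma_before
      by (metis card_Diff1_less card_mono finite_Diff finite_before le_less_trans)
  qed
  have ge: "?k \<le> card {j \<in> {1..?n}. entry v j \<ge> ?x}"
    unfolding sigma_before by (intro card_mono) (auto simp: before_def)
  show ?thesis
  proof (rule ccontr)
    assume "entry ?u ?k \<noteq> ?x"
    then consider "entry ?u ?k > ?x" | "entry ?u ?k < ?x" by linarith
    then show False
    proof cases
      case 1
      have "{1..?k} \<subseteq> {j \<in> {1..?n}. entry ?u j > ?x}"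
        using vplus_antimono[of _ ?k v] 1 k by (auto intro: less_le_trans)
      then have "?k \<le> card {j \<in> {1..?n}. entry ?u j > ?x}"
        using card_mono[of "{j \<in> {1..?n}. entry ?u j > ?x}" "{1..?k}"] by simp
      then show False using gt card_eq[of "\<lambda>y. y > ?x"] by simp
    next
      case 2
      have "{j \<in> {1..?n}. entry ?u j \<ge> ?x} \<subseteq> {1..<?k}"
      proof
        fix j assume j: "j \<in> {j \<in> {1..?n}. entry ?u j \<ge> ?x}"
        show "j \<in> {1..<?k}"
        proof (rule ccontr)
          assume "j \<notin> {1..<?k}"
          then have "entry ?u j \<le> entry ?u ?k" using j k by (intro vplus_antimono) auto
          then show False using 2 j by simp
        qed
      qed
      then have "card {j \<in> {1..?n}. entry ?u j \<ge> ?x} \<le> ?k - 1"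
        using card_mono[of "{1..<?k}" "{j \<in> {1..?n}. entry ?u j \<ge> ?x}"] by simp
      then show False using ge k card_eq[of "\<lambda>y. y \<ge> ?x"] by simp
    qed
  qed
qed

section \<open>Extremal fillings\<close>

text \<open>The common properties of the two fillings: \<open>T\<^sub>1\<close> with \<open>\<epsilon> = 1\<close> and \<open>T\<^sub>d\<^sub>e\<^sub>t\<close> with \<open>\<epsilon> = -1\<close>.
  The component of \<open>T\<close> contains a single tableau \<open>\<tau>\<^sub>0\<close>, so it has no edge that changes the tableau.\<close>

locale extremal_filling = shape +
  fixes \<epsilon> :: int and T \<tau>\<^sub>0 :: filling
  assumes eps: "\<epsilon> = 1 \<or> \<epsilon> = - 1"
    and tau0: "\<tau>\<^sub>0 \<in> RST lam"
    and T_outside: "b \<notin> B \<Longrightarrow> T b = 0"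
    and T_rigid: "\<tau> \<in> RST lam \<Longrightarrow> (\<And>b b'. b \<in> B \<Longrightarrow> b' \<in> B \<Longrightarrow> T b < T b' \<Longrightarrow> \<tau> b' < \<tau> b) \<Longrightarrow> \<tau> = \<tau>\<^sub>0"
    and T_mono: "b \<in> B \<Longrightarrow> b' \<in> B \<Longrightarrow> \<tau>\<^sub>0 b < \<tau>\<^sub>0 b' \<Longrightarrow> T b' \<le> T b"
    and T_tie: "b \<in> B \<Longrightarrow> b' \<in> B \<Longrightarrow> \<tau>\<^sub>0 b = k \<Longrightarrow> \<tau>\<^sub>0 b' = k + 1 \<Longrightarrow> T b = T b' \<Longrightarrow> CTdiff lam \<tau>\<^sub>0 k = \<epsilon>"
    and T_bound: "\<tau> \<in> RST lam \<Longrightarrow>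
      (\<And>i j. 1 \<le> i \<Longrightarrow> i \<le> j \<Longrightarrow> j \<le> N \<Longrightarrow> u j \<le> (u i :: nat)) \<Longrightarrow>
      (\<And>k. 1 \<le> k \<Longrightarrow> k < N \<Longrightarrow> u k = u (k + 1) \<Longrightarrow> 1 \<le> \<epsilon> * CTdiff lam \<tau> k) \<Longrightarrow>
      b \<in> B \<Longrightarrow> T b \<le> u (\<tau> b)"
begin

abbreviation e :: scalar where "e \<equiv> of_int \<epsilon>"

lemma e_square [simp]: "e * e = 1"
  using eps by auto

lemma eps_nonzero [simp]: "\<epsilon> \<noteq> 0"
  using eps by auto

lemma inverse_e: "1 / e = e"
  using eps by auto

lemma bij0: "bijective \<tau>\<^sub>0"
  using RST_bijective[OF tau0] .

text \<open>\<open>T\<close> read in the order of the labels of \<open>\<tau>\<^sub>0\<close>: the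
  decreasing vector common to all vertices of the component.\<close>

definition \<mu> :: "nat list" where
  "\<mu> = map (\<lambda>k. T (the_inv_into B \<tau>\<^sub>0 (k + 1))) [0..<N]"

lemma length_mu [simp]: "length \<mu> = N"
  by (simp add: \<mu>_def)

lemma entry_mu:
  assumes "b \<in> B"
  shows "entry \<mu> (\<tau>\<^sub>0 b) = T b"
proof -
  have "1 \<le> \<tau>\<^sub>0 b" "\<tau>\<^sub>0 b \<le> N" using bijective_range[OF bij0 assms] by auto
  moreover have "the_inv_into B \<tau>\<^sub>0 (\<tau>\<^sub>0 b) = b"
    using assms bij0 by (simp add: bijective_def bij_betw_def the_inv_into_f_f)
  moreover from calculation have "[0..<N] ! (\<tau>\<^sub>0 b - 1) = \<tau>\<^sub>0 b - 1" "\<tau>\<^sub>0 b - 1 < N" by simp_all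
  ultimately show ?thesis by (simp add: \<mu>_def)
qed

lemma mu_antimono:
  assumes "1 \<le> i" "i \<le> j" "j \<le> N"
  shows "entry \<mu> j \<le> entry \<mu> i"
proof (cases "i = j")
  case False
  obtain c r where b: "(c, r) \<in> B" "\<tau>\<^sub>0 (c, r) = i" by (rule bijective_box[OF bij0, of i]) (use assms in auto)
  obtain c' r' where b': "(c', r') \<in> B" "\<tau>\<^sub>0 (c', r') = j" by (rule bijective_box[OF bij0, of j]) (use assms in auto)
  show ?thesis using T_mono[OF b(1) b'(1)] entry_mu[OF b(1)] entry_mu[OF b'(1)] b b' assms False by simp
qed simp

definition V :: "nat list set" where
  "V = {v. length v = N \<and> vplus v = \<mu>}"

lemma V_length: "v \<in> V \<Longrightarrow> length v = N"
  by (simp add: V_def)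

lemma V_swap: "v \<in> V \<Longrightarrow> 1 \<le> i \<Longrightarrow> i < N \<Longrightarrow> swap_entries v i \<in> V"
  by (simp add: V_def vplus_swap)

lemma finite_V: "finite V"
proof (rule finite_subset)
  have "set v = set \<mu>" if "v \<in> V" for v
  proof -
    have "set (vplus v) = set v" by (simp add: vplus_def)
    then show ?thesis using that by (simp add: V_def)
  qed
  then show "V \<subseteq> {v. set v \<subseteq> set \<mu> \<and> length v = N}" by (auto simp: V_def)
qed (simp add: finite_lists_length_eq)

text \<open>Rearranged entries weakly decrease with the label, so a larger value of \<open>T\<close>
  forces a smaller label; rigidity then fixes the tableau.\<close>

lemma HT_verts_eq: "HT_verts lam T = Pair \<tau>\<^sub>0 ` V"
proof (intro equalityI subsetI)
  fix x assume x: "x \<in> HT_verts lam T"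
  obtain \<tau> v where xv: "x = (\<tau>, v)" by (cases x)
  have \<tau>: "\<tau> \<in> RST lam" and v: "length v = N" and f: "fill lam (\<tau>, v) = T"
    using x unfolding HT_verts_def H_verts_eq xv by auto
  have ent: "entry (vplus v) (\<tau> b) = T b" if "b \<in> B" for b
    using fun_cong[OF f, of b] that by (simp add: fill_def)
  have "\<tau> = \<tau>\<^sub>0"
  proof (rule T_rigid[OF \<tau>])
    fix b b' assume b: "b \<in> B" "b' \<in> B" and less: "T b < T b'"
    show "\<tau> b' < \<tau> b"
    proof (rule ccontr)
      assume "\<not> \<tau> b' < \<tau> b"
      then have "entry (vplus v) (\<tau> b') \<le> entry (vplus v) (\<tau> b)"
        using bijective_range[OF RST_bijective[OF \<tau>]] b v by (intro vplus_antimono) auto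
      then show False using less ent b by simp
    qed
  qed
  moreover have "vplus v = \<mu>"
  proof (rule entry_eqI)
    fix j assume j: "1 \<le> j" "j \<le> length (vplus v)"
    obtain c r where b: "(c, r) \<in> B" "\<tau>\<^sub>0 (c, r) = j"
      by (rule bijective_box[OF bij0, of j]) (use j v in auto)
    then show "entry (vplus v) j = entry \<mu> j"
      using ent[OF b(1)] entry_mu[OF b(1)] \<open>\<tau> = \<tau>\<^sub>0\<close> by simp
  qed (simp add: v)
  ultimately show "x \<in> Pair \<tau>\<^sub>0 ` V" using v xv by (simp add: V_def)
next
  fix x assume "x \<in> Pair \<tau>\<^sub>0 ` V"
  then obtain v where x: "x = (\<tau>\<^sub>0, v)" "length v = N" "vplus v = \<mu>" by (auto simp: V_def)
  have "fill lam x = T"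
  proof
    fix b show "fill lam x b = T b"
      using x T_outside[of b] entry_mu[of b] by (cases "b \<in> B") (simp_all add: fill_def)
  qed
  then show "x \<in> HT_verts lam T" unfolding HT_verts_def H_verts_eq using x tau0 by simp
qed

text \<open>Tied positions carry consecutive labels of \<open>\<tau>\<^sub>0\<close> in boxes with
  equal values of \<open>T\<close>. The difference is thus never 2 or more, which rules out tableau
  edges.\<close>

lemma V_tie:
  assumes v: "v \<in> V" and i: "1 \<le> i" "i < N" "entry v i = entry v (i + 1)"
  shows "CTdiff lam \<tau>\<^sub>0 (sigma v i) = \<epsilon>"
proof -
  note l = V_length[OF v]
  note tr = tie_rel[OF l tau0 i]
  obtain c r where b: "(c, r) \<in> B" "\<tau>\<^sub>0 (c, r) = sigma v i"
    by (rule bijective_box[OF bij0, of "sigma v i"]) (use tr in auto)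
  obtain c' r' where b': "(c', r') \<in> B" "\<tau>\<^sub>0 (c', r') = sigma v i + 1"
    by (rule bijective_box[OF bij0, of "sigma v i + 1"]) (use tr in auto)
  have "entry \<mu> (sigma v i) = entry v i" "entry \<mu> (sigma v (i + 1)) = entry v (i + 1)"
    using entry_vplus_sigma[of i v] entry_vplus_sigma[of "i + 1" v] v l i by (simp_all add: V_def)
  then have "T (c, r) = T (c', r')" using entry_mu[OF b(1)] entry_mu[OF b'(1)] b b' tr(3) i(3) by simp
  then show ?thesis using T_tie[OF b(1) b'(1) b(2) b'(2)] by simp
qed

lemma HT_edge_iff:
  "HT_edge lam T i x y \<longleftrightarrow> (\<exists>v\<in>V. x = (\<tau>\<^sub>0, v) \<and> y = (\<tau>\<^sub>0, swap_entries v i) \<and> 1 \<le> i \<and> i < N \<and> entry v i < entry v (i + 1))"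
proof
  assume E: "HT_edge lam T i x y"
  then obtain v w where v: "v \<in> V" "x = (\<tau>\<^sub>0, v)" and w: "w \<in> V" "y = (\<tau>\<^sub>0, w)"
    unfolding HT_edge_def HT_verts_eq by auto
  have "G_edge lam (Refl i) (\<tau>\<^sub>0, v) (Some y)" using E v unfolding HT_edge_def by simp
  then show "\<exists>v\<in>V. x = (\<tau>\<^sub>0, v) \<and> y = (\<tau>\<^sub>0, swap_entries v i) \<and> 1 \<le> i \<and> i < N \<and> entry v i < entry v (i + 1)"
  proof cases
    case swap
    then show ?thesis using v by auto
  next
    case tab
    then have "CTdiff lam \<tau>\<^sub>0 (sigma v i) = \<epsilon>" using V_tie[OF v(1)] by simp
    then show ?thesis using tab eps by auto
  qed
next
  assume "\<exists>v\<in>V. x = (\<tau>\<^sub>0, v) \<and> y = (\<tau>\<^sub>0, swap_entries v i) \<and> 1 \<le> i \<and> i < N \<and> entry v i < entry v (i + 1)"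
  then obtain v where v: "v \<in> V" "x = (\<tau>\<^sub>0, v)" "y = (\<tau>\<^sub>0, swap_entries v i)" "1 \<le> i" "i < N" "entry v i < entry v (i + 1)"
    by blast
  then show "HT_edge lam T i x y"
    unfolding HT_edge_def HT_verts_eq using V_swap[OF v(1,4,5)] G_edge.swap[of i lam v \<tau>\<^sub>0] by auto
qed

text \<open>For \<open>\<epsilon> = 1\<close> the factor of an edge in \<open>E_rel\<close>. For
  \<open>\<epsilon> = - 1\<close> that of \<open>F_rel\<close>, which uses the spectral vector at
  the end of the edge, where the difference is \<open>-D\<close>.\<close>

definition factor :: "scalar \<Rightarrow> scalar" where
  "factor D = e * D / (D + e)"

definition inversions :: "nat list \<Rightarrow> (nat \<times> nat) set" where
  "inversions v = {(p, q). 1 \<le> p \<and> p < q \<and> q \<le> length v \<and> entry v q < entry v p}"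

definition gap :: "nat list \<Rightarrow> nat \<times> nat \<Rightarrow> scalar" where
  "gap v = (\<lambda>(p, q). zeta lam (\<tau>\<^sub>0, v) q - zeta lam (\<tau>\<^sub>0, v) p)"

text \<open>A closed form that is visibly independent of the path: entries keep their spectral
  values when swapped, so an edge creates one inversion with its own factor and leaves the other
  factors unchanged.\<close>

definition coeff :: "nat list \<Rightarrow> scalar" where
  "coeff v = (\<Prod>x\<in>inversions v. factor (gap v x))"

lemma finite_inversions [simp]: "finite (inversions v)"
  by (rule finite_subset[of _ "{1..length v} \<times> {1..length v}"]) (auto simp: inversions_def)

lemma inversions_swap:
  assumes i: "1 \<le> i" "i < length v" "entry v i < entry v (i + 1)"
  shows "inversions (swap_entries v i) =
    insert (i, i + 1) (map_prod (transpose i (i + 1)) (transpose i (i + 1)) ` inversions v)"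
    (is "_ = insert _ (map_prod ?t ?t ` _)")
proof -
  have im: "x \<in> map_prod ?t ?t ` inversions v \<longleftrightarrow> map_prod ?t ?t x \<in> inversions v" for x
  proof
    assume "map_prod ?t ?t x \<in> inversions v"
    then have "map_prod ?t ?t (map_prod ?t ?t x) \<in> map_prod ?t ?t ` inversions v" by blast
    then show "x \<in> map_prod ?t ?t ` inversions v" by (cases x) simp
  qed auto
  have "(p, q) \<in> inversions (swap_entries v i) \<longleftrightarrow> (p, q) = (i, i + 1) \<or> (?t p, ?t q) \<in> inversions v" for p q
  proof (cases "1 \<le> p \<and> p \<le> length v \<and> 1 \<le> q \<and> q \<le> length v")
    case True
    have ent: "entry (swap_entries v i) p = entry v (?t p)" "entry (swap_entries v i) q = entry v (?t q)"
      using True i by (intro entry_swap; simp)+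
    have rng: "1 \<le> ?t p" "?t p \<le> length v" "1 \<le> ?t q" "?t q \<le> length v"
      using transpose_range[OF i(1,2)] True by auto
    \<comment> \<open>The transposition preserves the order of every pair except the adjacent pair
      itself.\<close>
    have "p < q \<longleftrightarrow> ?t p < ?t q" if "(p, q) \<noteq> (i, i + 1)" "(p, q) \<noteq> (i + 1, i)"
      using that by (auto simp: transpose_def)
    then consider "(p, q) = (i, i + 1)" | "(p, q) = (i + 1, i)" | "p < q \<longleftrightarrow> ?t p < ?t q" "(p, q) \<noteq> (i, i + 1)"
      by blast
    then show ?thesis
    proof cases
      case 1
      then show ?thesis using i entry_swap_simps(1,2)[OF i(1,2)] by (simp add: inversions_def)
    next
      case 2
      then show ?thesis using i by (simp add: inversions_def)
    next
      case 3
      then show ?thesis unfolding inversions_def using ent rng True by auto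
    qed
  next
    case False
    then have "\<not> (1 \<le> ?t p \<and> ?t p \<le> length v \<and> 1 \<le> ?t q \<and> ?t q \<le> length v)"
      using transpose_range[OF i(1,2), of "?t p"] transpose_range[OF i(1,2), of "?t q"] by auto
    then show ?thesis using False i by (auto simp: inversions_def)
  qed
  then show ?thesis using im by (auto simp: set_eq_iff)
qed

lemma coeff_swap:
  assumes v: "length v = N" and i: "1 \<le> i" "i < N" "entry v i < entry v (i + 1)"
  shows "coeff (swap_entries v i) = factor (zeta lam (\<tau>\<^sub>0, v) i - zeta lam (\<tau>\<^sub>0, v) (i + 1)) * coeff v"
proof -
  let ?t = "transpose i (i + 1)" and ?w = "swap_entries v i"
  have ne: "entry v i \<noteq> entry v (i + 1)" using i by simp
  have "(i, i + 1) \<notin> map_prod ?t ?t ` inversions v"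
  proof
    assume "(i, i + 1) \<in> map_prod ?t ?t ` inversions v"
    then obtain x y where xy: "(x, y) \<in> inversions v" "i = ?t x" "i + 1 = ?t y" by auto
    have "x = ?t i" "y = ?t (i + 1)" using xy(2,3) transpose_involutory by metis+
    then have "x = i + 1" "y = i" by simp_all
    then show False using xy(1) by (simp add: inversions_def)
  qed
  then have "coeff ?w = factor (gap ?w (i, i + 1)) * (\<Prod>x\<in>map_prod ?t ?t ` inversions v. factor (gap ?w x))"
    unfolding coeff_def using inversions_swap[of i v] i v by simp
  also have "(\<Prod>x\<in>map_prod ?t ?t ` inversions v. factor (gap ?w x)) = (\<Prod>x\<in>inversions v. factor (gap ?w (map_prod ?t ?t x)))"
    by (subst prod.reindex) (auto simp: inj_on_def dest: transpose_eq_imp_eq)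
  also have "\<dots> = coeff v"
    unfolding coeff_def
  proof (rule prod.cong[OF HOL.refl])
    fix x assume x: "x \<in> inversions v"
    obtain p q where pq: "x = (p, q)" by (cases x)
    have r: "1 \<le> p" "p \<le> N" "1 \<le> q" "q \<le> N" using x v by (auto simp: inversions_def pq)
    have "zeta lam (\<tau>\<^sub>0, ?w) (?t k) = zeta lam (\<tau>\<^sub>0, v) k" if "1 \<le> k" "k \<le> N" for k
      using zeta_swap[of i v "?t k" lam \<tau>\<^sub>0] transpose_range[of i N k] i v ne that by simp
    then show "factor (gap ?w (map_prod ?t ?t x)) = factor (gap v x)" using r by (simp add: pq gap_def)
  qed
  also have "gap ?w (i, i + 1) = zeta lam (\<tau>\<^sub>0, v) i - zeta lam (\<tau>\<^sub>0, v) (i + 1)"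
    using zeta_swap_simps(1,2)[OF v i(1,2) ne, of \<tau>\<^sub>0] by (simp add: gap_def)
  finally show ?thesis .
qed

lemma no_descent_coeff:
  assumes "\<And>i. \<not> descent v i"
  shows "coeff v = 1"
proof -
  have mono: "entry v p \<le> entry v q" if "1 \<le> p" "p \<le> q" "q \<le> length v" for p q
    using that(2,1,3)
  proof (induction q rule: dec_induct)
    case (step q)
    then show ?case using assms[of q] by (auto simp: descent_def not_less)
  qed simp
  have "x \<notin> inversions v" for x
    using mono[of "fst x" "snd x"] by (cases x) (auto simp: inversions_def)
  then have "inversions v = {}" by blast
  then show ?thesis by (simp add: coeff_def)
qed

lemma no_incoming_no_descent:
  assumes v: "v \<in> V" and none: "\<And>i y. \<not> HT_edge lam T i y (\<tau>\<^sub>0, v)"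
  shows "\<not> descent v i"
proof
  assume d: "descent v i"
  then have i: "1 \<le> i" "i < N" "entry v (i + 1) < entry v i" "i < length v"
    using V_length[OF v] by (auto simp: descent_def)
  have "HT_edge lam T i (\<tau>\<^sub>0, swap_entries v i) (\<tau>\<^sub>0, v)"
    unfolding HT_edge_iff
    using V_swap[OF v i(1,2)] i entry_swap_simps(1,2)[OF i(1,4)] swap_swap[OF i(1,4)]
    by (intro bexI[of _ "swap_entries v i"]) simp_all
  then show False using none by blast
qed

text \<open>Stated for any relation \<open>R\<close>, so that it gives existence for both
  \<open>E_rel\<close> and \<open>F_rel\<close>, by going back along edges to the vertex without
  incoming edge.\<close>

lemma coeff_total:
  assumes root: "\<And>x. x \<in> HT_verts lam T \<Longrightarrow> (\<And>i y. \<not> HT_edge lam T i y x) \<Longrightarrow> \<exists>c. R x c"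
    and step: "\<And>x c i y. R x c \<Longrightarrow> HT_edge lam T i x y \<Longrightarrow> \<exists>c. R y c"
    and v: "v \<in> V"
  shows "\<exists>c. R (\<tau>\<^sub>0, v) c"
  using v
proof (induction v rule: wf_induct_rule[OF wf_smaller])
  case (1 v)
  show ?case
  proof (cases "\<exists>i y. HT_edge lam T i y (\<tau>\<^sub>0, v)")
    case True
    then obtain i w where w: "w \<in> V" and E: "HT_edge lam T i (\<tau>\<^sub>0, w) (\<tau>\<^sub>0, v)"
      and sw: "v = swap_entries w i" and i: "1 \<le> i" "i < length w" "entry w i < entry w (i + 1)"
      using V_length by (auto simp: HT_edge_iff)
    have "descent v i" using i entry_swap_simps(1,2)[OF i(1,2)] by (simp add: descent_def sw)
    then have "(w, v) \<in> smaller" using smaller_swap[of v i] swap_swap[OF i(1,2)] by (simp add: sw)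
    then obtain c where "R (\<tau>\<^sub>0, w) c" using 1(1) w by blast
    then show ?thesis using step E by blast
  next
    case False
    then show ?thesis using root[of "(\<tau>\<^sub>0, v)"] 1(2) unfolding HT_verts_eq by blast
  qed
qed

lemma coeff_root:
  assumes "x \<in> HT_verts lam T" "\<And>i y. \<not> HT_edge lam T i y x"
  shows "coeff (snd x) = 1"
  using assms no_incoming_no_descent unfolding HT_verts_eq by (auto intro!: no_descent_coeff)

lemma coeff_edge:
  assumes "HT_edge lam T i x y"
  shows "coeff (snd y) = factor (zeta lam x i - zeta lam x (i + 1)) * coeff (snd x)"
    "zeta lam y i - zeta lam y (i + 1) = - (zeta lam x i - zeta lam x (i + 1))"
proof -
  obtain v where v: "v \<in> V" "x = (\<tau>\<^sub>0, v)" "y = (\<tau>\<^sub>0, swap_entries v i)" "1 \<le> i" "i < N" "entry v i < entry v (i + 1)"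
    using assms unfolding HT_edge_iff by blast
  show "coeff (snd y) = factor (zeta lam x i - zeta lam x (i + 1)) * coeff (snd x)"
    using coeff_swap[OF V_length[OF v(1)] v(4-6)] v by simp
  show "zeta lam y i - zeta lam y (i + 1) = - (zeta lam x i - zeta lam x (i + 1))"
    using zeta_swap_simps(1,2)[OF V_length[OF v(1)] v(4,5), of \<tau>\<^sub>0] v by simp
qed

lemma E_coeff_eq:
  assumes "\<epsilon> = 1" "v \<in> V"
  shows "E_coeff lam T (\<tau>\<^sub>0, v) = coeff v"
proof -
  have f: "factor D = D / (D + 1)" for D
    unfolding factor_def by (simp add: assms(1))
  have u: "c = coeff (snd x)" if "E_rel lam T x c" for x c
    using that
  proof (induction rule: E_rel.induct)
    case (root x)
    then show ?case using coeff_root by simp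
  next
    case (step x c i y)
    then show ?case using coeff_edge(1)[OF step(2)] by (simp add: f)
  qed
  have "\<exists>c. E_rel lam T (\<tau>\<^sub>0, v) c"
    by (rule coeff_total[OF _ _ assms(2)]) (blast intro: E_rel.intros)+
  then obtain c where c: "E_rel lam T (\<tau>\<^sub>0, v) c" by blast
  have "(THE c. E_rel lam T (\<tau>\<^sub>0, v) c) = c"
    by (rule the_equality) (use u[OF c] u c in auto)
  then show ?thesis unfolding E_coeff_def using u[OF c] by simp
qed

lemma F_coeff_eq:
  assumes "\<epsilon> = - 1" "v \<in> V"
  shows "F_coeff lam T (\<tau>\<^sub>0, v) = coeff v"
proof -
  have f: "- ((- D) / (- D + 1)) = factor D" for D
  proof -
    have "factor D = (- D) / (- (- D + 1))" unfolding factor_def by (simp add: assms(1))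
    then show ?thesis by (simp only: divide_minus_right)
  qed
  have u: "c = coeff (snd x)" if "F_rel lam T x c" for x c
    using that
  proof (induction rule: F_rel.induct)
    case (root x)
    then show ?case using coeff_root by simp
  next
    case (step x c i y)
    then show ?case unfolding coeff_edge(1)[OF step(2)] coeff_edge(2)[OF step(2)] f by simp
  qed
  have "\<exists>c. F_rel lam T (\<tau>\<^sub>0, v) c"
    by (rule coeff_total[OF _ _ assms(2)]) (blast intro: F_rel.intros)+
  then obtain c where c: "F_rel lam T (\<tau>\<^sub>0, v) c" by blast
  have "(THE c. F_rel lam T (\<tau>\<^sub>0, v) c) = c"
    by (rule the_equality) (use u[OF c] u c in auto)
  then show ?thesis unfolding F_coeff_def using u[OF c] by simp
qed

definition total :: melem where
  "total = (\<Sum>v\<in>V. mscale (coeff v) (jack \<tau>\<^sub>0 v))"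

lemma J_sym_total: "\<epsilon> = 1 \<Longrightarrow> J_sym lam T = total"
  unfolding J_sym_def HT_verts_eq total_def
  by (subst sum.reindex) (auto intro!: sum.cong simp: inj_on_def E_coeff_eq J_jack[OF tau0] V_length)

lemma J_asym_total: "\<epsilon> = - 1 \<Longrightarrow> J_asym lam T = total"
  unfolding J_asym_def HT_verts_eq total_def
  by (subst sum.reindex) (auto intro!: sum.cong simp: inj_on_def F_coeff_eq J_jack[OF tau0] V_length)

end

lemma swap_tie:
  assumes "1 \<le> i" "i < length v" "entry v i = entry v (i + 1)"
  shows "swap_entries v i = v"
proof (rule entry_eqI)
  fix j assume j: "1 \<le> j" "j \<le> length (swap_entries v i)"
  have "entry v (transpose i (i + 1) j) = entry v j" using assms(3) by (auto simp: transpose_def)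
  then show "entry (swap_entries v i) j = entry v j" using entry_swap[OF assms(1,2), of j] j by simp
qed simp

context extremal_filling begin

section \<open>The sum over the component is an eigenvector of the reflections\<close>

text \<open>The off-diagonal entry of the reflection on the pair \<open>v\<close>,
  \<open>swap_entries v i\<close>: along an edge it is 1, against an edge it is forced by
  involutivity, and at a tie there is none.\<close>

definition side :: "nat list \<Rightarrow> nat \<Rightarrow> scalar" where
  "side v i = (if entry v i < entry v (i + 1) then 1
    else if entry v (i + 1) < entry v i then 1 - (par \<tau>\<^sub>0 v i)\<^sup>2 else 0)"

lemma par_swap:
  assumes "length v = N" "1 \<le> i" "i < N" "entry v i \<noteq> entry v (i + 1)"
  shows "par \<tau>\<^sub>0 (swap_entries v i) i = - par \<tau>\<^sub>0 v i"
proof -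
  have "1 / (y - x) = - (1 / (x - y))" for x y :: scalar
    by (metis minus_diff_eq minus_divide_right)
  then show ?thesis unfolding par_def zeta_swap_simps(1,2)[OF assms] .
qed

lemma S_jack:
  assumes v: "v \<in> V" and i: "1 \<le> i" "i < N"
  shows "S i (jack \<tau>\<^sub>0 v) = mscale (par \<tau>\<^sub>0 v i) (jack \<tau>\<^sub>0 v) + mscale (side v i) (jack \<tau>\<^sub>0 (swap_entries v i))"
proof -
  note l = V_length[OF v]
  have ii: "1 \<le> i" "i < length v" using i l by auto
  let ?w = "swap_entries v i" and ?b = "par \<tau>\<^sub>0 v i"
  have lw: "length ?w = N" by (simp add: l)
  consider "entry v i < entry v (i + 1)" | "entry v (i + 1) < entry v i" | "entry v i = entry v (i + 1)" by linarith
  then show ?thesis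
  proof cases
    case 1
    then have "descent ?w i" using ii entry_swap_simps(1,2)[OF ii] by (simp add: descent_def)
    then have "jack \<tau>\<^sub>0 ?w = step i (- ?b) (jack \<tau>\<^sub>0 v)"
      using jack_swap[OF tau0 lw] par_swap[OF l i] swap_swap[OF ii] 1 by simp
    then show ?thesis using 1 by (intro melem_eqI) (simp add: step_def side_def)
  next
    case 2
    then have "descent v i" using ii by (simp add: descent_def)
    then have j: "jack \<tau>\<^sub>0 v = S i (jack \<tau>\<^sub>0 ?w) + mscale ?b (jack \<tau>\<^sub>0 ?w)"
      using jack_swap[OF tau0 l] by (simp add: step_def)
    have "S i (jack \<tau>\<^sub>0 v) = jack \<tau>\<^sub>0 ?w + mscale ?b (S i (jack \<tau>\<^sub>0 ?w))"
      unfolding j m_refl_add m_refl_mscale S_involutory[OF M_jack[OF tau0 lw] i] ..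
    also have "S i (jack \<tau>\<^sub>0 ?w) = jack \<tau>\<^sub>0 v - mscale ?b (jack \<tau>\<^sub>0 ?w)" using j by simp
    finally have eq: "S i (jack \<tau>\<^sub>0 v) = jack \<tau>\<^sub>0 ?w + mscale ?b (jack \<tau>\<^sub>0 v - mscale ?b (jack \<tau>\<^sub>0 ?w))" .
    show ?thesis unfolding eq using 2
      by (intro melem_eqI) (simp add: side_def algebra_simps power2_eq_square)
  next
    case 3
    have ct: "CTdiff lam \<tau>\<^sub>0 (sigma v i) = \<epsilon>" by (rule V_tie[OF v i 3])
    \<comment> \<open>The interchanged term drops out, so the reflection acts by the scalar
      \<open>\<epsilon>\<close>.\<close>
    have "swap_coeff \<epsilon> = 0" using eps by auto
    then have "step i (- (1 / e)) (jack \<tau>\<^sub>0 v) = mscale 0 (jack (interchange (sigma v i) \<tau>\<^sub>0) v)"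
      using jack_tie[OF tau0 l i 3] unfolding ct by simp
    then have "S i (jack \<tau>\<^sub>0 v) = mscale (1 / e) (jack \<tau>\<^sub>0 v)"
      by (simp add: step_def add_eq_0_iff2 eq_neg_iff_add_eq_0)
    moreover have "?b = 1 / e" unfolding par_def tie_rel(4)[OF l tau0 i 3] ct ..
    ultimately show ?thesis using 3 by (simp add: side_def)
  qed
qed

text \<open>The eigenvector equation at the term of \<open>v\<close>, which receives contributions
  from \<open>v\<close> and from \<open>swap_entries v i\<close> only.\<close>

lemma coeff_side:
  assumes v: "v \<in> V" and i: "1 \<le> i" "i < N"
  shows "coeff v * par \<tau>\<^sub>0 v i + coeff (swap_entries v i) * side (swap_entries v i) i = e * coeff v"
proof -
  note l = V_length[OF v]
  have ii: "1 \<le> i" "i < length v" using i l by auto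
  let ?w = "swap_entries v i"
  have lw: "length ?w = N" by (simp add: l)
  note ew = entry_swap_simps(1,2)[OF ii]
  consider "entry v i < entry v (i + 1)" | "entry v (i + 1) < entry v i" | "entry v i = entry v (i + 1)" by linarith
  then show ?thesis
  proof cases
    case 1
    define D where "D = zeta lam (\<tau>\<^sub>0, v) i - zeta lam (\<tau>\<^sub>0, v) (i + 1)"
    have D: "D \<noteq> 0" "D + e \<noteq> 0"
      using zeta_diff_nonzero[of v i "i + 1" lam \<tau>\<^sub>0 0] zeta_diff_nonzero[of v i "i + 1" lam \<tau>\<^sub>0 \<epsilon>] 1
      by (auto simp: D_def)
    have c: "coeff ?w = e * D / (D + e) * coeff v"
      using coeff_swap[OF l i 1] by (simp add: D_def factor_def)
    have s: "side ?w i = 1 - (1 / D)\<^sup>2"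
      using par_swap[OF l i] 1 ew by (simp add: side_def par_def D_def)
    have p: "par \<tau>\<^sub>0 v i = 1 / D" by (simp add: par_def D_def)
    \<comment> \<open>As \<open>e * e = 1\<close>, the numerator coming from \<open>side\<close>
      cancels the denominator of \<open>factor\<close> for either sign.\<close>
    have q: "D * D - 1 = (D + e) * (D - e)" by (simp add: algebra_simps)
    have "1 / D + e * D / (D + e) * (1 - (1 / D)\<^sup>2) = 1 / D + e * (D * D - 1) / (D * (D + e))"
      using D by (simp add: power2_eq_square divide_simps)
    also have "\<dots> = 1 / D + e * (D - e) / D" unfolding q using D by simp
    also have "\<dots> = e" using D by (simp add: field_simps)
    finally have "coeff v * (1 / D + e * D / (D + e) * (1 - (1 / D)\<^sup>2)) = coeff v * e" by simp
    then show ?thesis unfolding c s p by (simp add: algebra_simps)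
  next
    case 2
    define D where "D = zeta lam (\<tau>\<^sub>0, ?w) i - zeta lam (\<tau>\<^sub>0, ?w) (i + 1)"
    have lt: "entry ?w i < entry ?w (i + 1)" using 2 ew by simp
    have D: "D \<noteq> 0" "D + e \<noteq> 0"
      using zeta_diff_nonzero[of ?w i "i + 1" lam \<tau>\<^sub>0 0] zeta_diff_nonzero[of ?w i "i + 1" lam \<tau>\<^sub>0 \<epsilon>] lt
      by (auto simp: D_def)
    have c: "coeff v = e * D / (D + e) * coeff ?w"
      using coeff_swap[OF lw i lt] swap_swap[OF ii] by (simp add: D_def factor_def)
    have p: "par \<tau>\<^sub>0 v i = - (1 / D)"
      using par_swap[OF lw i] lt swap_swap[OF ii] by (simp add: par_def D_def)
    have s: "side ?w i = 1" using lt by (simp add: side_def)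
    have k: "(e + 1 / D) * (e * D / (D + e)) = 1"
    proof -
      have "(e + 1 / D) * (e * D / (D + e)) = (e * e * D + e) / (D + e)"
        using D by (simp add: divide_simps) (simp add: algebra_simps)
      also have "\<dots> = 1" using D by simp
      finally show ?thesis .
    qed
    have "(e + 1 / D) * coeff v = (e + 1 / D) * (e * D / (D + e)) * coeff ?w"
      unfolding c by (simp only: mult.assoc)
    then have "coeff ?w = (e + 1 / D) * coeff v" unfolding k by simp
    then show ?thesis unfolding p s by (simp add: algebra_simps)
  next
    case 3
    have "par \<tau>\<^sub>0 v i = e"
      unfolding par_def tie_rel(4)[OF l tau0 i 3] V_tie[OF v i 3] by (rule inverse_e)
    then show ?thesis unfolding swap_tie[OF ii 3] using 3 by (simp add: side_def)
  qed
qed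

lemma M_total: "total \<in> M lam"
  unfolding total_def by (intro M_sum M_mscale M_jack tau0 V_length)

lemma S_total:
  assumes i: "1 \<le> i" "i < N"
  shows "S i total = mscale e total"
proof -
  have "S i total = (\<Sum>v\<in>V. mscale (coeff v * par \<tau>\<^sub>0 v i) (jack \<tau>\<^sub>0 v)) +
      (\<Sum>v\<in>V. mscale (coeff v * side v i) (jack \<tau>\<^sub>0 (swap_entries v i)))"
    unfolding total_def m_refl_sum sum.distrib[symmetric]
    by (intro sum.cong) (simp_all add: m_refl_mscale S_jack[OF _ i] mvs.scale_right_distrib)
  \<comment> \<open>Swapping two adjacent entries is an involution of \<open>V\<close>, with the
    ties as fixed points.\<close>
  also have "(\<Sum>v\<in>V. mscale (coeff v * side v i) (jack \<tau>\<^sub>0 (swap_entries v i))) =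
      (\<Sum>v\<in>V. mscale (coeff (swap_entries v i) * side (swap_entries v i) i) (jack \<tau>\<^sub>0 v))"
    using i V_swap V_length
    by (intro sum.reindex_bij_witness[of _ "\<lambda>v. swap_entries v i" "\<lambda>v. swap_entries v i"]) auto
  also have "(\<Sum>v\<in>V. mscale (coeff v * par \<tau>\<^sub>0 v i) (jack \<tau>\<^sub>0 v)) + \<dots> = (\<Sum>v\<in>V. mscale e (mscale (coeff v) (jack \<tau>\<^sub>0 v)))"
    unfolding sum.distrib[symmetric] mvs.scale_left_distrib[symmetric]
    by (intro sum.cong) (simp_all add: coeff_side[OF _ i])
  also have "\<dots> = mscale e total" unfolding total_def by (rule mvs.scale_sum_right[symmetric])
  finally show ?thesis .
qed

section \<open>Degree and nonvanishing of the sum\<close>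

lemma sum_boxes:
  assumes "bijective \<tau>"
  shows "(\<Sum>b\<in>B. f (\<tau> b)) = (\<Sum>j\<in>{1..N}. f j)"
  using assms unfolding bijective_def by (rule sum.reindex_bij_betw)

lemma homogeneous_total: "homogeneous (\<Sum>b\<in>B. T b) total"
proof -
  have "sum_list v = (\<Sum>b\<in>B. T b)" if "v \<in> V" for v
  proof -
    have "mset (vplus v) = mset v" by (simp add: vplus_def)
    then have "mset v = mset \<mu>" using that by (simp add: V_def)
    then have "sum_list v = sum_list \<mu>" by (metis sum_mset_sum_list)
    also have "\<dots> = (\<Sum>j\<in>{0..<N}. \<mu> ! j)" by (simp add: sum_list_sum_nth)
    also have "\<dots> = (\<Sum>j\<in>{1..N}. entry \<mu> j)"
      by (rule sum.reindex_bij_witness[of _ "\<lambda>j. j - 1" "\<lambda>j. j + 1"]) auto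
    also have "\<dots> = (\<Sum>b\<in>B. entry \<mu> (\<tau>\<^sub>0 b))" by (rule sum_boxes[OF bij0, symmetric])
    also have "\<dots> = (\<Sum>b\<in>B. T b)" by (rule sum.cong[OF HOL.refl entry_mu])
    finally show ?thesis .
  qed
  then have "homogeneous (\<Sum>b\<in>B. T b) (jack \<tau>\<^sub>0 v)" if "v \<in> V" for v
    using jack_lead[OF tau0 V_length[OF that]] that by auto
  then show ?thesis unfolding total_def by (intro homogeneous_sum homogeneous_mscale)
qed

lemma finite_scalar_coeff: "finite_scalar (coeff v)"
  unfolding coeff_def
proof (rule finite_scalar_prod)
  fix x assume "x \<in> inversions v"
  then obtain p q where x: "x = (p, q)" and ne: "entry v q \<noteq> entry v p"
    by (auto simp: inversions_def)
  define D where "D = zeta lam (\<tau>\<^sub>0, v) q - zeta lam (\<tau>\<^sub>0, v) p"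
  have D: "D + e \<noteq> 0" "infinitesimal (1 / (D + e))"
    using zeta_diff_nonzero[OF ne] infinitesimal_zeta_diff[OF ne] by (auto simp: D_def)
  \<comment> \<open>The gap is infinitely large, so the factor is infinitesimally close to
    \<open>e\<close>.\<close>
  have "e * D / (D + e) = e - 1 / (D + e)"
    using D by (simp add: field_simps)
  moreover have "finite_scalar (e - 1 / (D + e))"
    by (intro finite_scalar_diff infinitesimal_imp_finite D finite_scalar_of_int)
  ultimately show "finite_scalar (factor (gap v x))" by (simp add: x factor_def gap_def D_def)
qed

text \<open>At the monomial of the increasing vector, whose coefficient is 1, all other terms are a
  finite coefficient times an infinitesimal, so nothing can cancel the leading term.\<close>

lemma total_nonzero: "total \<noteq> 0"
proof
  assume zero: "total = 0"
  define v\<^sub>0 where "v\<^sub>0 = rev \<mu>"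
  have "sorted v\<^sub>0"
  proof -
    have "sorted_wrt (\<ge>) \<mu>"
      unfolding sorted_wrt_iff_nth_less using mu_antimono[of "_ + 1" "_ + 1"] by auto
    then show ?thesis unfolding v\<^sub>0_def by (simp add: sorted_wrt_rev)
  qed
  then have V0: "v\<^sub>0 \<in> V" by (simp add: V_def vplus_def sorted_sort_id) (simp add: v\<^sub>0_def)
  have "\<not> descent v\<^sub>0 i" for i
    using \<open>sorted v\<^sub>0\<close> sorted_nth_mono[of v\<^sub>0 "i - 1" i] by (auto simp: descent_def)
  then have c0: "coeff v\<^sub>0 = 1" by (rule no_descent_coeff)
  have lead: "lead (jack \<tau>\<^sub>0 v) (exponent v)" if "v \<in> V" for v
    using jack_lead[OF tau0 V_length[OF that]] by blast
  obtain \<tau> where \<tau>: "\<not> infinitesimal (coef (jack \<tau>\<^sub>0 v\<^sub>0) \<tau> (exponent v\<^sub>0))"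
    using lead[OF V0] unfolding lead_def by blast
  have small: "infinitesimal (coeff v * coef (jack \<tau>\<^sub>0 v) \<tau> (exponent v\<^sub>0))" if "v \<in> V - {v\<^sub>0}" for v
  proof -
    have "exponent v\<^sub>0 \<noteq> exponent v"
      using exponent_inj[of v\<^sub>0 v] that V_length[OF V0] V_length[of v] by auto
    then show ?thesis
      using lead[of v] that unfolding lead_def by (intro infinitesimal_mult(1) finite_scalar_coeff) blast
  qed
  have "0 = coef total \<tau> (exponent v\<^sub>0)" by (simp add: zero)
  also have "\<dots> = (\<Sum>v\<in>V. coeff v * coef (jack \<tau>\<^sub>0 v) \<tau> (exponent v\<^sub>0))"
    by (simp add: total_def coef_sum)
  also have "\<dots> = coef (jack \<tau>\<^sub>0 v\<^sub>0) \<tau> (exponent v\<^sub>0) + (\<Sum>v\<in>V - {v\<^sub>0}. coeff v * coef (jack \<tau>\<^sub>0 v) \<tau> (exponent v\<^sub>0))"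
    using sum.remove[OF finite_V V0, of "\<lambda>v. coeff v * coef (jack \<tau>\<^sub>0 v) \<tau> (exponent v\<^sub>0)"] c0 by simp
  finally have "coef (jack \<tau>\<^sub>0 v\<^sub>0) \<tau> (exponent v\<^sub>0) = - (\<Sum>v\<in>V - {v\<^sub>0}. coeff v * coef (jack \<tau>\<^sub>0 v) \<tau> (exponent v\<^sub>0))"
    by (simp add: eq_neg_iff_add_eq_0)
  moreover have "infinitesimal (- (\<Sum>v\<in>V - {v\<^sub>0}. coeff v * coef (jack \<tau>\<^sub>0 v) \<tau> (exponent v\<^sub>0)))"
    using small by (intro infinitesimal_minus infinitesimal_sum)
  ultimately show False using \<tau> by simp
qed

section \<open>The minimal degree\<close>

lemma eigen_coef:
  assumes "S i P = mscale e P"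
  shows "e * coef P \<tau> m = coef P \<tau> (exp_swap i m) / of_int (CTdiff lam \<tau> i) +
     swap_coeff (CTdiff lam (interchange i \<tau>) i) * coef P (interchange i \<tau>) (exp_swap i m)"
  using coef_m_refl[of lam i P \<tau> m] by (simp add: assms)

text \<open>A support monomial with least \<open>\<Sum>j. j * m\<^sub>j\<close> is dominant; among its tableaux one that is extremal
  for \<open>\<Sum>k. k * CT[k]\<close> has strictly monotone contents along each run of equal exponents.\<close>

lemma extremal_support:
  assumes P: "P \<in> M lam" and eig: "\<And>i. 1 \<le> i \<Longrightarrow> i < N \<Longrightarrow> S i P = mscale e P" and nz: "P \<noteq> 0"
  obtains \<tau> m where "coef P \<tau> m \<noteq> 0"
    "\<And>i j. 1 \<le> i \<Longrightarrow> i \<le> j \<Longrightarrow> j \<le> N \<Longrightarrow> lookup m j \<le> lookup m i"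
    "\<And>b. b \<in> B \<Longrightarrow> T b \<le> lookup m (\<tau> b)"
proof -
  define wt where "wt = (\<lambda>m. \<Sum>j\<in>{1..N}. j * lookup m j)"
  have "\<exists>m \<tau>. coef P \<tau> m \<noteq> 0" using nz melem_eqI[of P 0] by auto
  then obtain m where m: "\<exists>\<tau>. coef P \<tau> m \<noteq> 0" and
    least: "\<And>m'. \<exists>\<tau>. coef P \<tau> m' \<noteq> 0 \<Longrightarrow> wt m \<le> wt m'"
    using ex_has_least_nat[of "\<lambda>m. \<exists>\<tau>. coef P \<tau> m \<noteq> 0" _ wt] by blast
  \<comment> \<open>At an ascent, the eigenvector equation expresses a nonzero coefficient through
    coefficients at the swapped exponent, whose \<open>wt\<close> is smaller.\<close>
  have step: "lookup m (i + 1) \<le> lookup m i" if i: "1 \<le> i" "i < N" for i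
  proof (rule ccontr)
    assume less: "\<not> lookup m (i + 1) \<le> lookup m i"
    obtain \<tau> where \<tau>: "coef P \<tau> m \<noteq> 0" using m by blast
    have "e * coef P \<tau> m \<noteq> 0" using \<tau> by simp
    then have "coef P \<tau> (exp_swap i m) \<noteq> 0 \<or> coef P (interchange i \<tau>) (exp_swap i m) \<noteq> 0"
      unfolding eigen_coef[OF eig[OF i]] by auto
    then have "wt m \<le> wt (exp_swap i m)" using least by blast
    moreover have "(\<Sum>j\<in>{1..N} - {i, i + 1}. j * lookup (exp_swap i m) j) =
        (\<Sum>j\<in>{1..N} - {i, i + 1}. j * lookup m j)"
      by (intro sum.cong) auto
    moreover have "lookup (exp_swap i m) i = lookup m (i + 1)"
      "lookup (exp_swap i m) (i + 1) = lookup m i" by simp_all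
    ultimately show False unfolding wt_def sum_split_pair[OF i] using less by (simp add: algebra_simps)
  qed
  have anti: "lookup m j \<le> lookup m i" if "1 \<le> i" "i \<le> j" "j \<le> N" for i j
    using that(2,1,3)
  proof (induction j rule: dec_induct)
    case (step j)
    then show ?case using \<open>\<And>i. 1 \<le> i \<Longrightarrow> i < N \<Longrightarrow> lookup m (i + 1) \<le> lookup m i\<close>[of j] by simp
  qed simp
  let ?A = "{\<tau>. coef P \<tau> m \<noteq> 0}"
  have sub: "?A \<subseteq> RST lam" using P unfolding M_iff by blast
  have fin: "finite ?A" by (rule finite_subset[OF sub finite_RST])
  have ne: "?A \<noteq> {}" using m by blast
  \<comment> \<open>The sign turns both cases into a minimisation: an interchange changes
    \<open>f\<close> by \<open>\<epsilon>\<close> times the content difference.\<close>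
  define f where "f = (\<lambda>\<tau>. \<epsilon> * potential \<tau>)"
  define \<tau> where "\<tau> = arg_min_on f ?A"
  have \<tau>: "coef P \<tau> m \<noteq> 0" using arg_min_if_finite(1)[OF fin ne, of f] by (simp add: \<tau>_def)
  have min: "f \<tau> \<le> f \<rho>" if "\<rho> \<in> ?A" for \<rho>
    using arg_min_least[OF fin ne that, of f] by (simp add: \<tau>_def)
  have R: "\<tau> \<in> RST lam" using \<tau> sub by blast
  have run: "1 \<le> \<epsilon> * CTdiff lam \<tau> k"
    if k: "1 \<le> k" "k < N" and tie: "lookup m k = lookup m (k + 1)" for k
  proof (rule ccontr)
    define d where "d = CTdiff lam \<tau> k"
    assume "\<not> 1 \<le> \<epsilon> * CTdiff lam \<tau> k"
    moreover have "d \<noteq> 0" using CTdiff_nonzero[OF R k] by (simp add: d_def)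
    ultimately have neg: "\<epsilon> * d < 0" using eps by (auto simp: d_def)
    have sm: "exp_swap k m = m" by (rule poly_mapping_eqI) (simp add: transpose_def tie)
    \<comment> \<open>The diagonal entry differs from the eigenvalue, so the off-diagonal term must
      be nonzero. Hence the interchanged tableau is in the support too, with smaller
      \<open>f\<close>.\<close>
    have "1 / of_int d \<noteq> e"
    proof
      assume "1 / of_int d = e"
      then have "of_int (\<epsilon> * d) = (1 :: scalar)" using \<open>d \<noteq> 0\<close> by (simp add: field_simps)
      then have "\<epsilon> * d = 1" by (simp only: of_int_eq_1_iff)
      then show False using neg by simp
    qed
    then have "(e - 1 / of_int d) * coef P \<tau> m \<noteq> 0" using \<tau> by simp
    moreover have "(e - 1 / of_int d) * coef P \<tau> m =
        swap_coeff (CTdiff lam (interchange k \<tau>) k) * coef P (interchange k \<tau>) m"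
      using eigen_coef[OF eig[OF k], of \<tau> m] unfolding sm d_def[symmetric] by (simp add: algebra_simps)
    ultimately have "f \<tau> \<le> f (interchange k \<tau>)" by (intro min) auto
    then show False
      using potential_interchange[OF RST_bijective[OF R] k] neg by (simp add: f_def d_def algebra_simps)
  qed
  have "T b \<le> lookup m (\<tau> b)" if "b \<in> B" for b
    using T_bound[OF R anti run that] by simp
  then show ?thesis using that[OF \<tau> anti] by blast
qed

text \<open>Summing the bound \<open>T b \<le> lookup m (\<tau> b)\<close> over the boxes gives the
  degree. Equality makes it an equality at every box, and rigidity then fixes tableau and monomial;
  this singles out one coefficient that detects nonzero solutions.\<close>

lemma minimal_degree:
  assumes P: "P \<in> M lam" and eig: "\<And>i. 1 \<le> i \<Longrightarrow> i < N \<Longrightarrow> S i P = mscale e P" and nz: "P \<noteq> 0"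
    and hom: "homogeneous d P"
  shows "(\<Sum>b\<in>B. T b) \<le> d" "d = (\<Sum>b\<in>B. T b) \<Longrightarrow> coef P \<tau>\<^sub>0 (exponent \<mu>) \<noteq> 0"
proof -
  obtain \<tau> m where \<tau>m: "coef P \<tau> m \<noteq> 0"
    and anti: "\<And>i j. 1 \<le> i \<Longrightarrow> i \<le> j \<Longrightarrow> j \<le> N \<Longrightarrow> lookup m j \<le> lookup m i"
    and bound: "\<And>b. b \<in> B \<Longrightarrow> T b \<le> lookup m (\<tau> b)"
    using extremal_support[OF P eig nz] by blast
  have R: "\<tau> \<in> RST lam" and keys: "keys m \<subseteq> {1..N}" using P \<tau>m unfolding M_iff by blast+
  note bij = RST_bijective[OF R]
  have "d = exp_deg m" using hom \<tau>m unfolding homogeneous_iff by blast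
  also have "\<dots> = (\<Sum>j\<in>{1..N}. lookup m j)" by (rule exp_deg_finite[OF _ keys]) simp
  also have "\<dots> = (\<Sum>b\<in>B. lookup m (\<tau> b))" by (rule sum_boxes[OF bij, symmetric])
  finally have d: "d = (\<Sum>b\<in>B. lookup m (\<tau> b))" .
  show "(\<Sum>b\<in>B. T b) \<le> d" unfolding d by (intro sum_mono bound)
  assume eq: "d = (\<Sum>b\<in>B. T b)"
  have Tm: "T b = lookup m (\<tau> b)" if "b \<in> B" for b
    using sum_mono_inv[of T B "\<lambda>b. lookup m (\<tau> b)" b] eq d bound that by simp
  have t: "\<tau> = \<tau>\<^sub>0"
  proof (rule T_rigid[OF R], rule ccontr)
    fix b b' assume b: "b \<in> B" "b' \<in> B" "T b < T b'" and "\<not> \<tau> b' < \<tau> b"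
    then have "lookup m (\<tau> b') \<le> lookup m (\<tau> b)"
      using bijective_range[OF bij] by (intro anti) auto
    then show False using b Tm by simp
  qed
  have "m = exponent \<mu>"
  proof (rule poly_mapping_eqI)
    fix j
    show "lookup m j = lookup (exponent \<mu>) j"
    proof (cases "1 \<le> j \<and> j \<le> N")
      case True
      obtain c r where b: "(c, r) \<in> B" "\<tau>\<^sub>0 (c, r) = j"
        by (rule bijective_box[OF bij0, of j]) (use True in auto)
      then show ?thesis using True Tm[OF b(1)] entry_mu[OF b(1)] t by (simp add: lookup_exponent)
    next
      case False
      then have "j \<notin> keys m" using keys by auto
      then show ?thesis using False by (auto simp: lookup_exponent in_keys_iff)
    qed
  qed
  then show "coef P \<tau>\<^sub>0 (exponent \<mu>) \<noteq> 0" using \<tau>m t by simp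
qed

section \<open>The part of minimal degree\<close>

definition eigenspace :: "melem set" where
  "eigenspace = {P \<in> M lam. \<forall>i\<in>{1..<N}. S i P = mscale e P}"

lemma total_eigenspace: "total \<in> eigenspace"
  unfolding eigenspace_def using M_total S_total by simp

lemma min_degree_eigenspace: "min_degree eigenspace = (\<Sum>b\<in>B. T b)"
  unfolding min_degree_def
proof (rule Least_equality)
  show "\<exists>P\<in>eigenspace. P \<noteq> 0 \<and> homogeneous (\<Sum>b\<in>B. T b) P"
    using total_eigenspace total_nonzero homogeneous_total by blast
next
  fix d assume "\<exists>P\<in>eigenspace. P \<noteq> 0 \<and> homogeneous d P"
  then obtain P where "P \<in> eigenspace" "P \<noteq> 0" "homogeneous d P" by blast
  then show "(\<Sum>b\<in>B. T b) \<le> d" using minimal_degree(1)[of P d] unfolding eigenspace_def by auto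
qed

lemma min_degree_part_eigenspace: "min_degree_part eigenspace = mvs.span {total}"
proof (intro equalityI subsetI)
  fix P assume "P \<in> mvs.span {total}"
  then obtain c where P: "P = mscale c total" unfolding mvs.span_singleton by blast
  have "P \<in> eigenspace"
    using total_eigenspace unfolding eigenspace_def P
    by (auto simp: M_mscale m_refl_mscale mvs.scale_left_commute)
  then show "P \<in> min_degree_part eigenspace"
    unfolding min_degree_part_def min_degree_eigenspace P using homogeneous_mscale[OF homogeneous_total] by blast
next
  fix P assume P: "P \<in> min_degree_part eigenspace"
  let ?n = "\<Sum>b\<in>B. T b" and ?c = "\<lambda>P. coef P \<tau>\<^sub>0 (exponent \<mu>)"
  have PM: "P \<in> M lam" and Pe: "\<And>i. 1 \<le> i \<Longrightarrow> i < N \<Longrightarrow> S i P = mscale e P" and Ph: "homogeneous ?n P"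
    using P unfolding min_degree_part_def min_degree_eigenspace unfolding eigenspace_def by auto
  have nz: "?c total \<noteq> 0" using minimal_degree(2)[OF M_total S_total total_nonzero homogeneous_total] by simp
  \<comment> \<open>Chosen so that the detecting coefficient of \<open>Q\<close> vanishes.\<close>
  define c where "c = - (?c P / ?c total)"
  define Q where "Q = P + mscale c total"
  have "Q \<in> M lam" unfolding Q_def by (intro M_add M_mscale PM M_total)
  moreover have "S i Q = mscale e Q" if "1 \<le> i" "i < N" for i
    unfolding Q_def m_refl_add m_refl_mscale Pe[OF that] S_total[OF that]
    by (simp add: mvs.scale_right_distrib mvs.scale_left_commute)
  moreover have "homogeneous ?n Q"
    unfolding Q_def by (intro homogeneous_add homogeneous_mscale Ph homogeneous_total)
  moreover have "?c Q = 0" using nz by (simp add: Q_def c_def)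
  ultimately have "Q = 0" using minimal_degree(2)[of Q ?n] by blast
  then have "P = mscale (- c) total" unfolding Q_def by (simp add: eq_neg_iff_add_eq_0)
  then show "P \<in> mvs.span {total}" unfolding mvs.span_singleton by blast
qed

lemma dim_min_degree_part: "mvs.dim (min_degree_part eigenspace) = 1"
proof -
  have "mvs.independent {total}" using total_nonzero by (simp add: mvs.dependent_single)
  then show ?thesis unfolding min_degree_part_eigenspace mvs.dim_span by (simp add: mvs.dim_eq_card_independent)
qed

end

section \<open>The two extremal fillings\<close>

context shape begin

text \<open>Where \<open>u\<close> is constant, the contents times \<open>\<epsilon>\<close>
  decrease at each label from \<open>a\<close> to \<open>b\<close>; their telescoped difference
  contradicts \<open>sgn\<close>.\<close>

lemma content_chain:
  assumes anti: "\<And>i j. 1 \<le> i \<Longrightarrow> i \<le> j \<Longrightarrow> j \<le> N \<Longrightarrow> u j \<le> (u i :: nat)"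
    and run: "\<And>k. 1 \<le> k \<Longrightarrow> k < N \<Longrightarrow> u k = u (k + 1) \<Longrightarrow> 1 \<le> \<epsilon> * CTdiff lam \<tau> k"
    and ab: "1 \<le> a" "a < b" "b \<le> N" and sgn: "\<epsilon> * (CT lam \<tau> a - CT lam \<tau> b) < 0"
  shows "u b < u a"
proof (rule ccontr)
  assume "\<not> u b < u a"
  then have eq: "u b = u a" using anti[of a b] ab by simp
  have const: "u k = u a" if "a \<le> k" "k \<le> b" for k
    using anti[of a k] anti[of k b] that ab eq by simp
  have "0 \<le> \<epsilon> * (CT lam \<tau> a - CT lam \<tau> k)" if "a \<le> k" "k \<le> b" for k
    using that
  proof (induction k rule: dec_induct)
    case (step k)
    have "1 \<le> \<epsilon> * CTdiff lam \<tau> k" using run[of k] const[of k] const[of "k + 1"] step ab by simp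
    then show ?case using step by (simp add: algebra_simps)
  qed simp
  from this[of b] show False using sgn ab by simp
qed

text \<open>Within a row labels decrease from left to right anyway, so ordering whole rows leaves
  only the reading by rows.\<close>

lemma extremal_T_one: "extremal_filling lam 1 (T_one lam) (rank_tab prod.swap)"
proof
  have T: "T_one lam (c, r) = r - 1" if "(c, r) \<in> B" for c r using that by (simp add: T_one_def)
  show R0: "rank_tab prod.swap \<in> RST lam" by (rule rank_tab_RST[OF box_key_swap])
  show "T_one lam b = 0" if "b \<notin> B" for b using that by (cases b) (simp add: T_one_def)
  show "\<tau> = rank_tab prod.swap"
    if \<tau>: "\<tau> \<in> RST lam" and mono: "\<And>b b'. b \<in> B \<Longrightarrow> b' \<in> B \<Longrightarrow> T_one lam b < T_one lam b' \<Longrightarrow> \<tau> b' < \<tau> b" for \<tau>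
  proof (rule rank_tab_unique[OF \<tau> box_key_swap])
    fix b b' assume b: "b \<in> B" "b' \<in> B" and less: "lexless (prod.swap b) (prod.swap b')"
    obtain c r c' r' where cr: "b = (c, r)" "b' = (c', r')" by (cases b, cases b')
    show "\<tau> b' < \<tau> b"
    proof (cases "r < r'")
      case True
      then have "r - 1 < r' - 1" using b boxes_pos[of c r] by (simp add: cr diff_less_mono)
      then show ?thesis using mono[OF b] b T by (simp add: cr)
    next
      case False
      then show ?thesis using less b RST_decreasing[OF \<tau>, of c r c' r'] by (simp add: cr lexless_def)
    qed
  qed
  show "T_one lam b' \<le> T_one lam b"
    if "b \<in> B" "b' \<in> B" "rank_tab prod.swap b < rank_tab prod.swap b'" for b b'
  proof (rule ccontr)
    assume "\<not> T_one lam b' \<le> T_one lam b"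
    then have "lexless (prod.swap b) (prod.swap b')"
      using that T by (cases b, cases b') (auto simp: lexless_def)
    then show False using rank_tab_less[OF that(1,2)] that(3) by fastforce
  qed
  show "CTdiff lam (rank_tab prod.swap) k = 1"
    if "b \<in> B" "b' \<in> B" "rank_tab prod.swap b = k" "rank_tab prod.swap b' = k + 1" "T_one lam b = T_one lam b'" for b b' k
  proof -
    obtain c r c' r' where cr: "b = (c, r)" "b' = (c', r')" by (cases b, cases b')
    have "r = r'" using that T[of c r] T[of c' r'] boxes_pos[of c r] boxes_pos[of c' r'] by (auto simp: cr)
    then show ?thesis using same_row_consecutive[OF R0, of c' r c k] that by (simp add: cr)
  qed
  fix \<tau> :: filling and u :: "nat \<Rightarrow> nat" and b
  assume \<tau>: "\<tau> \<in> RST lam" and anti: "\<And>i j. 1 \<le> i \<Longrightarrow> i \<le> j \<Longrightarrow> j \<le> N \<Longrightarrow> u j \<le> u i"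
    and run: "\<And>k. 1 \<le> k \<Longrightarrow> k < N \<Longrightarrow> u k = u (k + 1) \<Longrightarrow> 1 \<le> 1 * CTdiff lam \<tau> k" and b: "b \<in> B"
  note bij = RST_bijective[OF \<tau>]
  \<comment> \<open>One step up a column lowers both label and content, so by
    \<open>content_chain\<close> it raises \<open>u\<close>; there are \<open>r - 1\<close> such
    steps.\<close>
  have "r - 1 \<le> u (\<tau> (c, r))" if "(c, r) \<in> B" for c r
    using that
  proof (induction r)
    case (Suc r)
    show ?case
    proof (cases "r = 0")
      case False
      then have low: "(c, r) \<in> B" using box_below[OF Suc.prems, of c r] boxes_pos[OF Suc.prems] by simp
      have "\<tau> (c, Suc r) < \<tau> (c, r)" using RST_decreasing[OF \<tau> low Suc.prems] by simp
      moreover have "1 \<le> \<tau> (c, Suc r)" "\<tau> (c, r) \<le> N" using bijective_range[OF bij] low Suc.prems by auto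
      ultimately have "u (\<tau> (c, r)) < u (\<tau> (c, Suc r))"
        using content_chain[of u 1 \<tau> "\<tau> (c, Suc r)" "\<tau> (c, r)", OF anti run] CT_box[OF bij low] CT_box[OF bij Suc.prems]
        by simp
      then show ?thesis using Suc.IH[OF low] by simp
    qed simp
  qed simp
  then show "T_one lam b \<le> u (\<tau> b)" using b T by (cases b) simp
qed simp

text \<open>The transposed argument: columns replace rows, and the signs of content differences are
  reversed.\<close>

lemma extremal_T_det: "extremal_filling lam (- 1) (T_det lam) (root_tab lam)"
proof
  have T: "T_det lam (c, r) = c - 1" if "(c, r) \<in> B" for c r using that by (simp add: T_det_def)
  show R0: "root_tab lam \<in> RST lam" by (rule root_tab_RST)
  show "T_det lam b = 0" if "b \<notin> B" for b using that by (cases b) (simp add: T_det_def)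
  show "\<tau> = root_tab lam"
    if \<tau>: "\<tau> \<in> RST lam" and mono: "\<And>b b'. b \<in> B \<Longrightarrow> b' \<in> B \<Longrightarrow> T_det lam b < T_det lam b' \<Longrightarrow> \<tau> b' < \<tau> b" for \<tau>
    unfolding root_tab_rank
  proof (rule rank_tab_unique[OF \<tau> box_key_id])
    fix b b' assume b: "b \<in> B" "b' \<in> B" and less: "lexless (id b) (id b')"
    obtain c r c' r' where cr: "b = (c, r)" "b' = (c', r')" by (cases b, cases b')
    show "\<tau> b' < \<tau> b"
    proof (cases "c < c'")
      case True
      then have "c - 1 < c' - 1" using b boxes_pos[of c r] by (simp add: cr diff_less_mono)
      then show ?thesis using mono[OF b] b T by (simp add: cr)
    next
      case False
      then show ?thesis using less b RST_decreasing[OF \<tau>, of c r c' r'] by (simp add: cr lexless_def)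
    qed
  qed
  show "T_det lam b' \<le> T_det lam b"
    if "b \<in> B" "b' \<in> B" "root_tab lam b < root_tab lam b'" for b b'
  proof (rule ccontr)
    assume "\<not> T_det lam b' \<le> T_det lam b"
    then have "lexless (id b) (id b')"
      using that T by (cases b, cases b') (auto simp: lexless_def)
    then show False using rank_tab_less[OF that(1,2)] that(3) unfolding root_tab_rank by fastforce
  qed
  show "CTdiff lam (root_tab lam) k = - 1"
    if "b \<in> B" "b' \<in> B" "root_tab lam b = k" "root_tab lam b' = k + 1" "T_det lam b = T_det lam b'" for b b' k
  proof -
    obtain c r c' r' where cr: "b = (c, r)" "b' = (c', r')" by (cases b, cases b')
    have "c = c'" using that T[of c r] T[of c' r'] boxes_pos[of c r] boxes_pos[of c' r'] by (auto simp: cr)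
    then show ?thesis using same_column_consecutive[OF R0, of c r' r k] that by (simp add: cr)
  qed
  fix \<tau> :: filling and u :: "nat \<Rightarrow> nat" and b
  assume \<tau>: "\<tau> \<in> RST lam" and anti: "\<And>i j. 1 \<le> i \<Longrightarrow> i \<le> j \<Longrightarrow> j \<le> N \<Longrightarrow> u j \<le> u i"
    and run: "\<And>k. 1 \<le> k \<Longrightarrow> k < N \<Longrightarrow> u k = u (k + 1) \<Longrightarrow> 1 \<le> - 1 * CTdiff lam \<tau> k" and b: "b \<in> B"
  note bij = RST_bijective[OF \<tau>]
  \<comment> \<open>One step to the right lowers the label and raises the content, which for
    \<open>\<epsilon> = - 1\<close> again raises \<open>u\<close>.\<close>
  have "c - 1 \<le> u (\<tau> (c, r))" if "(c, r) \<in> B" for c r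
    using that
  proof (induction c)
    case (Suc c)
    show ?case
    proof (cases "c = 0")
      case False
      then have low: "(c, r) \<in> B" using box_below[OF Suc.prems, of c r] boxes_pos[OF Suc.prems] by simp
      have "\<tau> (Suc c, r) < \<tau> (c, r)" using RST_decreasing[OF \<tau> low Suc.prems] by simp
      moreover have "1 \<le> \<tau> (Suc c, r)" "\<tau> (c, r) \<le> N" using bijective_range[OF bij] low Suc.prems by auto
      ultimately have "u (\<tau> (c, r)) < u (\<tau> (Suc c, r))"
        using content_chain[of u "- 1" \<tau> "\<tau> (Suc c, r)" "\<tau> (c, r)", OF anti run] CT_box[OF bij low] CT_box[OF bij Suc.prems]
        by simp
      then show ?thesis using Suc.IH[OF low] by simp
    qed simp
  qed simp
  then show "T_det lam b \<le> u (\<tau> b)" using b T by (cases b) simp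
qed simp

end

theorem theorem5p22:
  fixes N l :: nat and lam :: "nat list"
  assumes "is_partition N lam" and "length lam = l"
  shows
    "mvs.dim (min_degree_part (symmetric lam)) = 1 \<and>
     min_degree_part (symmetric lam) = mvs.span {J_sym lam (T_one lam)} \<and>
     mvs.dim (min_degree_part (antisymmetric lam)) = 1 \<and>
     min_degree_part (antisymmetric lam) = mvs.span {J_asym lam (T_det lam)}"
proof -
  have "sum_list lam = N" using assms(1) by (simp add: is_partition_def)
  then interpret shape lam using assms(1) by unfold_locales simp
  interpret one: extremal_filling lam 1 "T_one lam" "rank_tab prod.swap" by (rule extremal_T_one)
  interpret det: extremal_filling lam "- 1" "T_det lam" "root_tab lam" by (rule extremal_T_det)
  have "symmetric lam = one.eigenspace"
    unfolding symmetric_def one.eigenspace_def by simp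
  moreover have "antisymmetric lam = det.eigenspace"
  proof -
    have "mscale (- 1) P = - P" for P by (rule melem_eqI) simp
    then show ?thesis unfolding antisymmetric_def det.eigenspace_def by simp
  qed
  ultimately show ?thesis
    using one.dim_min_degree_part one.min_degree_part_eigenspace one.J_sym_total
      det.dim_min_degree_part det.min_degree_part_eigenspace det.J_asym_total
    by simp
qed

end
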